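(* Let $X$ be a smooth manifold, let $t\in\mathcal G^r_s(X)$ be a generalized $(r,s)$-tensor field and let $\tilde p\in\widetilde X_c$. Let $\omega_1,\dots,\omega_r$ and $\omega'_1,\dots,\omega'_r$ be generalized one-forms (elements of $\mathcal G^0_1(X)$) with $\omega_i(\tilde p)=\omega'_i(\tilde p)$ for $1\le i\le r$, and let $\xi_1,\dots,\xi_s$ and $\xi'_1,\dots,\xi'_s$ be generalized vector fields (elements of $\mathcal G^1_0(X)$) with $\xi_i(\tilde p)=\xi'_i(\tilde p)$ for $1\le i\le s$. Then $$\big(t(\omega_1,\dots,\omega_r,\xi_1,\dots,\xi_s)\big)(\tilde p)=\big(t(\omega'_1,\dots,\omega'_r,\xi'_1,\dots,\xi'_s)\big)(\tilde p).$$
   Context: Manifolds are smooth, paracompact, Hausdorff and finite-dimensional. $I=(0,1]$, $\mathbb N=\{1,2,\dots\}$, $\mathbb N_0=\mathbb N\cup\{0\}$; $O(\cdot)$ refers to $\varepsilon\to0$. $K\subset\subset X$ means that $K$ is a compact subset of $X$. $\mathrm{cl}[\cdot]$ denotes equivalence classes. **Generalized functions and numbers.** Let $\mathcal P(X)$ be the linear differential operators on $X$. $\mathcal E_M(X)$ is the set of nets $(u_\varepsilon)_\varepsilon\in C^\infty(X)^I$ such that $\forall K\subset\subset X\ \forall P\in\mathcal P(X)\ \exists N\in\mathbb N:\sup_{p\in K}|Pu_\varepsilon(p)|=O(\varepsilon^{-N})$; $\mathcal N(X)$ is the set of those $(u_\varepsilon)_\varepsilon\in\mathcal E_M(X)$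 with $\sup_{p\in K}|u_\varepsilon(p)|=O(\varepsilon^q)$ for all $K\subset\subset X$, $q\in\mathbb N_0$; $\mathcal G(X):=\mathcal E_M(X)/\mathcal N(X)$. The ring $\mathcal K$ of generalized numbers is the set of nets of scalars $(r_\varepsilon)_\varepsilon$ with $|r_\varepsilon|=O(\varepsilon^{-N})$ for some $N$, modulo those with $|r_\varepsilon|=O(\varepsilon^m)$ for all $m$. **Generalized sections and tensor fields.** For a vector bundle $(E,X,\pi)$ let $\mathcal P(X,E)$ be the linear differential operators on the space $\Gamma(X,E)$ of smooth sections, and $\|\cdot\|_h$ the norm on fibers of $E$ induced by any Riemannian (fiber) metric $h$ on $E$. $\Gamma_{\mathcal E_M}(X,E)$ is the set of nets $(s_\varepsilon)_\varepsilon\in\Gamma(X,E)^I$ such that $\forall P\in\mathcal P(X,E)\ \forall K\subset\subset X\ \exists N\in\mathbb N:\sup_{p\in K}\|Ps_\varepsilon(p)\|_h=O(\varepsilon^{-N})$; $\Gamma_{\mathcal N}(X,E)$ is the set of those $(s_\varepsilon)_\varepsilon\in\Gamma_{\mathcal E_M}(X,E)$ with $\sup_{p\in K}\|s_\varepsilon(p)\|_h=O(\varepsilon^m)$ for all $K\subset\subset X$, $m\in\mathbb N$. $\Gamma_{\mathcal G}(X,E):=\Gamma_{\mathcal E_M}(X,E)/\Gamma_{\mathcal N}(X,E)$. $\mathcal G^r_s(X):=\Gamma_{\mathcal G}(X,T^r_s(X))$, where $T^r_s(X)$ is the bundle of $(r,s)$-tensors ($T^1_0(X)=TX$, $T^0_1(X)=T^*X$;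 an $(r,s)$-tensor takes $r$ covectors and $s$ vectors as arguments). Elements of $\mathcal G^r_s(X)$ act as $\mathcal G(X)$-multilinear maps $\mathcal G^0_1(X)^r\times\mathcal G^1_0(X)^s\to\mathcal G(X)$, defined by inserting representatives: $t(\omega_1,\dots,\xi_s)=\mathrm{cl}[(t_\varepsilon(\omega_{1\varepsilon},\dots,\xi_{s\varepsilon}))_\varepsilon]$. **Generalized points.** $\widetilde X_c$ is the set of nets $(p_\varepsilon)_\varepsilon\in X^I$ that lie in some fixed compact set for all small $\varepsilon$, modulo $(p_\varepsilon)_\varepsilon\sim(q_\varepsilon)_\varepsilon:\Leftrightarrow d_g(p_\varepsilon,q_\varepsilon)=O(\varepsilon^m)$ for all $m>0$, where $d_g$ is the distance function of one (equivalently every) Riemannian metric $g$ on $X$ ($d_g=\infty$ between different components). For $f=\mathrm{cl}[(f_\varepsilon)_\varepsilon]\in\mathcal G(X)$, $f(\tilde p):=\mathrm{cl}[(f_\varepsilon(p_\varepsilon))_\varepsilon]\in\mathcal K$. **Generalized vector bundle points.** For a vector bundle $(E,X,\pi)$, a vector bundle chart $(W,\Psi)$ over a chart $(W,\psi)$ of $X$ is written $\Psi(z)=(\psi(\pi(z)),\boldsymbol\psi(z))$, with $\boldsymbol\psi(z)$ in the typical fiber. A net $(e_\varepsilon)_\varepsilon\in E^I$ is $vb$-moderate if (i) there are $K\subset\subset X$, $\varepsilon_0>0$ with $\pi(e_\varepsilon)\in K$ for $\varepsilon<\varepsilon_0$; (ii) for some Riemannian (fiber) metric $h$ on $E$ there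 are $\varepsilon_1>0$, $N\in\mathbb N$, $C>0$ with $\|e_\varepsilon\|_h\le C\varepsilon^{-N}$ for $\varepsilon<\varepsilon_1$. Two such nets are $\sim_{vb}$-equivalent if (iii) $(\pi(e_\varepsilon))_\varepsilon\sim(\pi(e'_\varepsilon))_\varepsilon$, i.e. $d_g(\pi(e_\varepsilon),\pi(e'_\varepsilon))=O(\varepsilon^m)$ for all $m>0$ and one (equivalently every) Riemannian metric $g$ on $X$; (iv) for all $m\in\mathbb N$, vector bundle charts $(W,\Psi)$ of $E$ and $L'\subset\subset W$ there are $\varepsilon_1>0$, $C>0$ with $|\boldsymbol\psi(e_\varepsilon)-\boldsymbol\psi(e'_\varepsilon)|\le C\varepsilon^m$ for all $\varepsilon<\varepsilon_1$ for which both $\pi(e_\varepsilon)$ and $\pi(e'_\varepsilon)$ lie in $L'$. The set of classes is $E_c^{\sim_{vb}}$. For $u=\mathrm{cl}[(u_\varepsilon)_\varepsilon]\in\Gamma_{\mathcal G}(X,E)$ the point value is $u(\tilde p):=\mathrm{cl}[(u_\varepsilon(p_\varepsilon))_\varepsilon]\in E_c^{\sim_{vb}}$ (well defined). The hypotheses $\omega_i(\tilde p)=\omega_i'(\tilde p)$ and $\xi_i(\tilde p)=\xi_i'(\tilde p)$ are equalities in $(T^*X)_c^{\sim_{vb}}$ and $(TX)_c^{\sim_{vb}}$; the conclusion is an equality in $\mathcal K$. *)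

theory Defs
  imports "HOL-Analysis.Analysis" "HOL-Library.Function_Algebras" "HOL-Library.Landau_Symbols"
begin

section \<open>Pointwise real vector space structure on function types\<close>

instantiation "fun" :: (type, real_vector) real_vector
begin

definition scaleR_fun :: "real \<Rightarrow> ('a \<Rightarrow> 'b) \<Rightarrow> 'a \<Rightarrow> 'b"
  where "scaleR_fun a f = (\<lambda>x. a *\<^sub>R f x)"

instance
  by standard (simp_all add: scaleR_fun_def fun_eq_iff scaleR_add_right scaleR_add_left)

end


section \<open>Smooth functions on open subsets of Euclidean space\<close>

text \<open>
  Points of n-dimensional Euclidean space are those of \<^const>\<open>Euclidean_space\<close> \<open>n\<close>, i.e.
  functions \<^typ>\<open>nat \<Rightarrow> real\<close> vanishing at all indices \<open>\<ge> n\<close>. In this way the dimension is a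
  natural number and may be \<open>0\<close>.
\<close>

definition partial_deriv :: "nat \<Rightarrow> ((nat \<Rightarrow> real) \<Rightarrow> real) \<Rightarrow> (nat \<Rightarrow> real) \<Rightarrow> real"
  where "partial_deriv i f x = deriv (\<lambda>t. f (x(i := t))) (x i)"

text \<open>A list of indices \<open>[i\<^sub>1, \<dots>, i\<^sub>k]\<close> stands for \<open>\<partial>\<^sub>i\<^sub>1 \<dots> \<partial>\<^sub>i\<^sub>k\<close>.\<close>

definition partial_derivs :: "nat list \<Rightarrow> ((nat \<Rightarrow> real) \<Rightarrow> real) \<Rightarrow> (nat \<Rightarrow> real) \<Rightarrow> real"
  where "partial_derivs \<alpha> f = foldr partial_deriv \<alpha> f"

text \<open>
  For \<open>V\<close> open in \<^const>\<open>Euclidean_space\<close> \<open>n\<close>: all iterated partial derivatives exist and are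
  continuous on \<open>V\<close>. The values of \<open>f\<close> outside \<open>V\<close> are irrelevant.
\<close>

definition smooth_on_Euclidean :: "nat \<Rightarrow> (nat \<Rightarrow> real) set \<Rightarrow> ((nat \<Rightarrow> real) \<Rightarrow> real) \<Rightarrow> bool"
  where "smooth_on_Euclidean n V f \<longleftrightarrow>
    (\<forall>\<alpha>. set \<alpha> \<subseteq> {..<n} \<longrightarrow>
       continuous_on V (partial_derivs \<alpha> f) \<and>
       (\<forall>x\<in>V. \<forall>i<n. (\<lambda>t. partial_derivs \<alpha> f (x(i := t))) differentiable (at (x i))))"


section \<open>Smooth manifolds\<close>

text \<open>A chart is a pair of its domain and its coordinate map.\<close>

type_synonym 'a chart = "'a set \<times> ('a \<Rightarrow> nat \<Rightarrow> real)"

abbreviation chart_inv :: "'a chart \<Rightarrow> (nat \<Rightarrow> real) \<Rightarrow> 'a"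
  where "chart_inv c \<equiv> inv_into (fst c) (snd c)"

record 'a manifold =
  mdim :: nat
  atlas :: "'a chart set"

definition is_chart :: "nat \<Rightarrow> ('a::topological_space) chart \<Rightarrow> bool"
  where "is_chart n c \<longleftrightarrow>
    open (fst c) \<and> openin (Euclidean_space n) (snd c ` fst c) \<and>
    homeomorphism (fst c) (snd c ` fst c) (snd c) (chart_inv c)"

definition smooth_transition :: "nat \<Rightarrow> 'a chart \<Rightarrow> 'a chart \<Rightarrow> bool"
  where "smooth_transition n c d \<longleftrightarrow>
    (\<forall>i<n. smooth_on_Euclidean n (snd c ` (fst c \<inter> fst d)) (\<lambda>x. snd d (chart_inv c x) i))"

definition paracompact_space :: "'a topology \<Rightarrow> bool"
  where "paracompact_space T \<longleftrightarrow>
    (\<forall>\<U>. (\<forall>U\<in>\<U>. openin T U) \<and> \<Union>\<U> = topspace T \<longrightarrow>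
      (\<exists>\<V>. (\<forall>V\<in>\<V>. openin T V \<and> (\<exists>U\<in>\<U>. V \<subseteq> U)) \<and> \<Union>\<V> = topspace T \<and> locally_finite_in T \<V>))"

text \<open>
  The underlying set of the manifold is the whole (Hausdorff) type \<open>'a\<close>; the atlas is maximal.
\<close>

definition smooth_manifold :: "('a::t2_space) manifold \<Rightarrow> bool"
  where "smooth_manifold M \<longleftrightarrow>
    paracompact_space (euclidean :: 'a topology) \<and>
    (\<forall>c\<in>atlas M. is_chart (mdim M) c) \<and>
    \<Union>(fst ` atlas M) = UNIV \<and>
    (\<forall>c\<in>atlas M. \<forall>d\<in>atlas M. smooth_transition (mdim M) c d) \<and>
    (\<forall>c. is_chart (mdim M) c \<and>
         (\<forall>d\<in>atlas M. smooth_transition (mdim M) c d \<and> smooth_transition (mdim M) d c) \<longrightarrow>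
         c \<in> atlas M)"

definition smooth_fun_on :: "'a manifold \<Rightarrow> 'a set \<Rightarrow> ('a \<Rightarrow> real) \<Rightarrow> bool"
  where "smooth_fun_on M W f \<longleftrightarrow>
    (\<forall>c\<in>atlas M. smooth_on_Euclidean (mdim M) (snd c ` (fst c \<inter> W)) (\<lambda>x. f (chart_inv c x)))"

definition smooth_funs :: "'a manifold \<Rightarrow> ('a \<Rightarrow> real) set"
  where "smooth_funs M = {f. smooth_fun_on M UNIV f}"

text \<open>
  Differential operators of order at most \<open>m\<close>; the finitely many index lists of length at most
  \<open>m\<close> play the role of multi-indices.
\<close>

definition index_lists :: "nat \<Rightarrow> nat \<Rightarrow> nat list set"
  where "index_lists n m = {\<alpha>. set \<alpha> \<subseteq> {..<n} \<and> length \<alpha> \<le> m}"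

definition diff_ops :: "'a manifold \<Rightarrow> (('a \<Rightarrow> real) \<Rightarrow> 'a \<Rightarrow> real) set"
  where "diff_ops M = {P.
    (\<forall>f\<in>smooth_funs M. P f \<in> smooth_funs M) \<and>
    (\<forall>f\<in>smooth_funs M. \<forall>g\<in>smooth_funs M. \<forall>a b. P (a *\<^sub>R f + b *\<^sub>R g) = a *\<^sub>R P f + b *\<^sub>R P g) \<and>
    (\<exists>m. \<forall>c\<in>atlas M. \<exists>a. (\<forall>\<alpha>. smooth_fun_on M (fst c) (a \<alpha>)) \<and>
       (\<forall>f\<in>smooth_funs M. \<forall>p\<in>fst c.
          P f p = (\<Sum>\<alpha>\<in>index_lists (mdim M) m.
                     a \<alpha> p * partial_derivs \<alpha> (\<lambda>x. f (chart_inv c x)) (snd c p))))}"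


section \<open>Vector bundles\<close>

text \<open>
  The total space of a bundle is the set of pairs \<open>(p, v)\<close> with \<open>v\<close> in the fibre over \<open>p\<close>, a
  linear subspace of an ambient vector space \<open>'f\<close>. The typical fibre is the space of real
  families indexed by a finite set \<open>J\<close> (functions vanishing outside \<open>J\<close>). A vector bundle chart
  is a pair of a chart \<open>(W, \<psi>)\<close> of the base and the fibre part \<open>\<Psi> p v\<close> of the
  trivialization over \<open>W\<close>. The bundle structure is given by a vector bundle atlas.
\<close>

record ('a, 'f, 'j) vbundle =
  fibre :: "'a \<Rightarrow> 'f set"
  frame_index :: "'j set"
  vb_atlas :: "('a chart \<times> ('a \<Rightarrow> 'f \<Rightarrow> 'j \<Rightarrow> real)) set"

definition typical_fibre :: "'j set \<Rightarrow> ('j \<Rightarrow> real) set"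
  where "typical_fibre J = {x. \<forall>j. j \<notin> J \<longrightarrow> x j = 0}"

definition unit_vec :: "'j \<Rightarrow> 'j \<Rightarrow> real"
  where "unit_vec j = (\<lambda>k. if k = j then 1 else 0)"

definition vb_trivialization ::
    "'a manifold \<Rightarrow> ('a, 'f::real_vector, 'j) vbundle \<Rightarrow>
     'a chart \<times> ('a \<Rightarrow> 'f \<Rightarrow> 'j \<Rightarrow> real) \<Rightarrow> bool"
  where "vb_trivialization M E = (\<lambda>(c, \<Psi>). c \<in> atlas M \<and>
    (\<forall>p\<in>fst c.
       bij_betw (\<Psi> p) (fibre E p) (typical_fibre (frame_index E)) \<and>
       (\<forall>v\<in>fibre E p. \<forall>w\<in>fibre E p. \<forall>a b.
          \<Psi> p (a *\<^sub>R v + b *\<^sub>R w) = a *\<^sub>R \<Psi> p v + b *\<^sub>R \<Psi> p w)))"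

text \<open>The \<open>j\<close>-th element of the local frame of the fibre over \<open>p\<close> given by a trivialization.\<close>

definition vb_frame :: "('a, 'f, 'j) vbundle \<Rightarrow> ('a \<Rightarrow> 'f \<Rightarrow> 'j \<Rightarrow> real) \<Rightarrow> 'a \<Rightarrow> 'j \<Rightarrow> 'f"
  where "vb_frame E \<Psi> p j = inv_into (fibre E p) (\<Psi> p) (unit_vec j)"

text \<open>All entries of the transition matrices are smooth functions on the overlap.\<close>

definition vb_transition_smooth ::
    "'a manifold \<Rightarrow> ('a, 'f, 'j) vbundle \<Rightarrow> 'a chart \<times> ('a \<Rightarrow> 'f \<Rightarrow> 'j \<Rightarrow> real) \<Rightarrow>
     'a chart \<times> ('a \<Rightarrow> 'f \<Rightarrow> 'j \<Rightarrow> real) \<Rightarrow> bool"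
  where "vb_transition_smooth M E = (\<lambda>(c, \<Psi>) (d, \<Phi>).
    \<forall>i\<in>frame_index E. \<forall>j\<in>frame_index E.
      smooth_fun_on M (fst c \<inter> fst d) (\<lambda>p. \<Phi> p (vb_frame E \<Psi> p j) i))"

text \<open>The vector bundle charts are all trivializations compatible with the given atlas.\<close>

definition vb_charts ::
    "'a manifold \<Rightarrow> ('a, 'f::real_vector, 'j) vbundle \<Rightarrow>
     ('a chart \<times> ('a \<Rightarrow> 'f \<Rightarrow> 'j \<Rightarrow> real)) set"
  where "vb_charts M E = {C. vb_trivialization M E C \<and>
    (\<forall>D\<in>vb_atlas E. vb_transition_smooth M E C D \<and> vb_transition_smooth M E D C)}"

definition smooth_sections :: "'a manifold \<Rightarrow> ('a, 'f::real_vector, 'j) vbundle \<Rightarrow> ('a \<Rightarrow> 'f) set"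
  where "smooth_sections M E = {s. (\<forall>p. s p \<in> fibre E p) \<and>
    (\<forall>(c, \<Psi>)\<in>vb_charts M E. \<forall>j\<in>frame_index E. smooth_fun_on M (fst c) (\<lambda>p. \<Psi> p (s p) j))}"

definition vb_diff_ops ::
    "'a manifold \<Rightarrow> ('a, 'f::real_vector, 'j) vbundle \<Rightarrow> (('a \<Rightarrow> 'f) \<Rightarrow> 'a \<Rightarrow> 'f) set"
  where "vb_diff_ops M E = {P.
    (\<forall>s\<in>smooth_sections M E. P s \<in> smooth_sections M E) \<and>
    (\<forall>s\<in>smooth_sections M E. \<forall>u\<in>smooth_sections M E. \<forall>a b.
       P (a *\<^sub>R s + b *\<^sub>R u) = a *\<^sub>R P s + b *\<^sub>R P u) \<and>
    (\<exists>m. \<forall>(c, \<Psi>)\<in>vb_charts M E. \<exists>a.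
       (\<forall>\<alpha>. \<forall>i\<in>frame_index E. \<forall>j\<in>frame_index E. smooth_fun_on M (fst c) (a \<alpha> i j)) \<and>
       (\<forall>s\<in>smooth_sections M E. \<forall>p\<in>fst c. \<forall>i\<in>frame_index E.
          \<Psi> p (P s p) i =
            (\<Sum>\<alpha>\<in>index_lists (mdim M) m. \<Sum>j\<in>frame_index E.
               a \<alpha> i j p *
               partial_derivs \<alpha> (\<lambda>x. \<Psi> (chart_inv c x) (s (chart_inv c x)) j) (snd c p))))}"

definition fibre_metric ::
    "'a manifold \<Rightarrow> ('a, 'f::real_vector, 'j) vbundle \<Rightarrow> ('a \<Rightarrow> 'f \<Rightarrow> 'f \<Rightarrow> real) \<Rightarrow> bool"
  where "fibre_metric M E h \<longleftrightarrow>
    (\<forall>p. \<forall>u\<in>fibre E p. \<forall>v\<in>fibre E p. h p u v = h p v u) \<and>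
    (\<forall>p. \<forall>u\<in>fibre E p. \<forall>v\<in>fibre E p. \<forall>w\<in>fibre E p. \<forall>a b.
       h p (a *\<^sub>R u + b *\<^sub>R v) w = a * h p u w + b * h p v w) \<and>
    (\<forall>p. \<forall>v\<in>fibre E p. v \<noteq> 0 \<longrightarrow> h p v v > 0) \<and>
    (\<forall>(c, \<Psi>)\<in>vb_charts M E. \<forall>i\<in>frame_index E. \<forall>j\<in>frame_index E.
       smooth_fun_on M (fst c) (\<lambda>p. h p (vb_frame E \<Psi> p i) (vb_frame E \<Psi> p j)))"

definition fibre_norm :: "('a \<Rightarrow> 'f \<Rightarrow> 'f \<Rightarrow> real) \<Rightarrow> 'a \<Rightarrow> 'f \<Rightarrow> real"
  where "fibre_norm h p v = sqrt (h p v v)"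


section \<open>Tangent, cotangent and tensor bundles\<close>

text \<open>
  A tangent vector at \<open>p\<close> is the family of its coordinate vectors with respect to all charts
  around \<open>p\<close>; these transform with the Jacobians of the chart transitions. (The family is set
  to \<open>0\<close> at pairs that are not charts around \<open>p\<close>.)
\<close>

type_synonym 'a tvec = "'a chart \<Rightarrow> nat \<Rightarrow> real"
type_synonym 'a covec = "'a tvec \<Rightarrow> real"
type_synonym 'a tensor = "'a covec list \<Rightarrow> 'a tvec list \<Rightarrow> real"

definition tangent_space :: "'a manifold \<Rightarrow> 'a \<Rightarrow> 'a tvec set"
  where "tangent_space M p = {v.
    (\<forall>c. \<not> (c \<in> atlas M \<and> p \<in> fst c) \<longrightarrow> v c = 0) \<and>
    (\<forall>c\<in>atlas M. p \<in> fst c \<longrightarrow> (\<forall>i\<ge>mdim M. v c i = 0)) \<and>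
    (\<forall>c\<in>atlas M. \<forall>d\<in>atlas M. p \<in> fst c \<inter> fst d \<longrightarrow>
       (\<forall>i<mdim M. v d i =
          (\<Sum>j<mdim M. partial_deriv j (\<lambda>x. snd d (chart_inv c x) i) (snd c p) * v c j)))}"

definition tangent_bundle :: "'a manifold \<Rightarrow> ('a, 'a tvec, nat) vbundle"
  where "tangent_bundle M =
    \<lparr>fibre = tangent_space M,
     frame_index = {..<mdim M},
     vb_atlas = {(c, \<lambda>p v. v c) | c. c \<in> atlas M}\<rparr>"

text \<open>The coordinate vector \<open>\<partial>\<^sub>i\<close> and the coordinate covector \<open>dx\<^sup>i\<close> at \<open>p\<close> in the chart \<open>c\<close>.\<close>

definition coord_vec :: "'a manifold \<Rightarrow> 'a chart \<Rightarrow> 'a \<Rightarrow> nat \<Rightarrow> 'a tvec"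
  where "coord_vec M c p i = vb_frame (tangent_bundle M) (\<lambda>p v. v c) p i"

definition coord_covec :: "'a manifold \<Rightarrow> 'a chart \<Rightarrow> 'a \<Rightarrow> nat \<Rightarrow> 'a covec"
  where "coord_covec M c p i = (\<lambda>v. if v \<in> tangent_space M p then v c i else 0)"

text \<open>
  The dual space of the tangent space. Here and in the definition of tensors, maps are extended
  by \<open>0\<close> outside their domain so that they are determined by their values on it.
\<close>

definition cotangent_space :: "'a manifold \<Rightarrow> 'a \<Rightarrow> 'a covec set"
  where "cotangent_space M p = {\<omega>.
    (\<forall>v. v \<notin> tangent_space M p \<longrightarrow> \<omega> v = 0) \<and>
    (\<forall>v\<in>tangent_space M p. \<forall>w\<in>tangent_space M p. \<forall>a b.
       \<omega> (a *\<^sub>R v + b *\<^sub>R w) = a * \<omega> v + b * \<omega> w)}"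

definition cotangent_bundle :: "'a manifold \<Rightarrow> ('a, 'a covec, nat) vbundle"
  where "cotangent_bundle M =
    \<lparr>fibre = cotangent_space M,
     frame_index = {..<mdim M},
     vb_atlas = {(c, \<lambda>p \<omega> i. if i < mdim M then \<omega> (coord_vec M c p i) else 0) | c. c \<in> atlas M}\<rparr>"

definition tensor_args :: "'a manifold \<Rightarrow> nat \<Rightarrow> nat \<Rightarrow> 'a \<Rightarrow> ('a covec list \<times> 'a tvec list) set"
  where "tensor_args M r s p = {(\<omega>s, vs).
    length \<omega>s = r \<and> set \<omega>s \<subseteq> cotangent_space M p \<and>
    length vs = s \<and> set vs \<subseteq> tangent_space M p}"

definition tensor_space :: "'a manifold \<Rightarrow> nat \<Rightarrow> nat \<Rightarrow> 'a \<Rightarrow> 'a tensor set"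
  where "tensor_space M r s p = {t.
    (\<forall>\<omega>s vs. (\<omega>s, vs) \<notin> tensor_args M r s p \<longrightarrow> t \<omega>s vs = 0) \<and>
    (\<forall>(\<omega>s, vs)\<in>tensor_args M r s p.
       (\<forall>i<r. \<forall>\<eta>\<in>cotangent_space M p. \<forall>\<theta>\<in>cotangent_space M p. \<forall>a b.
          t (\<omega>s[i := a *\<^sub>R \<eta> + b *\<^sub>R \<theta>]) vs = a * t (\<omega>s[i := \<eta>]) vs + b * t (\<omega>s[i := \<theta>]) vs) \<and>
       (\<forall>i<s. \<forall>v\<in>tangent_space M p. \<forall>w\<in>tangent_space M p. \<forall>a b.
          t \<omega>s (vs[i := a *\<^sub>R v + b *\<^sub>R w]) = a * t \<omega>s (vs[i := v]) + b * t \<omega>s (vs[i := w])))}"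

definition tensor_indices :: "nat \<Rightarrow> nat \<Rightarrow> nat \<Rightarrow> (nat list \<times> nat list) set"
  where "tensor_indices n r s = {(\<alpha>, \<beta>).
    length \<alpha> = r \<and> set \<alpha> \<subseteq> {..<n} \<and> length \<beta> = s \<and> set \<beta> \<subseteq> {..<n}}"

text \<open>The trivialization over \<open>c\<close> takes a tensor to its components \<open>t(dx\<^sup>\<alpha>, \<partial>\<^sub>\<beta>)\<close>.\<close>

definition tensor_bundle :: "'a manifold \<Rightarrow> nat \<Rightarrow> nat \<Rightarrow> ('a, 'a tensor, nat list \<times> nat list) vbundle"
  where "tensor_bundle M r s =
    \<lparr>fibre = tensor_space M r s,
     frame_index = tensor_indices (mdim M) r s,
     vb_atlas = {(c, \<lambda>p t (\<alpha>, \<beta>). if (\<alpha>, \<beta>) \<in> tensor_indices (mdim M) r s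
                       then t (map (coord_covec M c p) \<alpha>) (map (coord_vec M c p) \<beta>) else 0)
                 | c. c \<in> atlas M}\<rparr>"


section \<open>Riemannian distance\<close>

definition riemannian_metric :: "'a manifold \<Rightarrow> ('a \<Rightarrow> 'a tvec \<Rightarrow> 'a tvec \<Rightarrow> real) \<Rightarrow> bool"
  where "riemannian_metric M g \<longleftrightarrow> fibre_metric M (tangent_bundle M) g"

definition smooth_curve_on :: "('a::topological_space) manifold \<Rightarrow> real set \<Rightarrow> (real \<Rightarrow> 'a) \<Rightarrow> bool"
  where "smooth_curve_on M J \<gamma> \<longleftrightarrow>
    continuous_on J \<gamma> \<and>
    (\<forall>c\<in>atlas M. \<forall>t\<in>J. \<gamma> t \<in> fst c \<longrightarrow>
       (\<forall>i<mdim M. \<forall>k. ((deriv ^^ k) (\<lambda>\<tau>. snd c (\<gamma> \<tau>) i)) differentiable (at t)))"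

text \<open>On each closed piece the curve extends to a smooth curve on a larger open interval.\<close>

definition piecewise_smooth_curve :: "('a::topological_space) manifold \<Rightarrow> (real \<Rightarrow> 'a) \<Rightarrow> bool"
  where "piecewise_smooth_curve M \<gamma> \<longleftrightarrow>
    (\<exists>(k::nat) (\<tau>::nat \<Rightarrow> real). \<tau> 0 = 0 \<and> \<tau> k = 1 \<and>
       (\<forall>i<k. \<tau> i < \<tau> (Suc i) \<and>
          (\<exists>\<delta>>0. \<exists>\<eta>. smooth_curve_on M {\<tau> i - \<delta><..<\<tau> (Suc i) + \<delta>} \<eta> \<and>
             (\<forall>t\<in>{\<tau> i..\<tau> (Suc i)}. \<eta> t = \<gamma> t))))"

definition velocity :: "'a manifold \<Rightarrow> (real \<Rightarrow> 'a) \<Rightarrow> real \<Rightarrow> 'a tvec"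
  where "velocity M \<gamma> t = (\<lambda>c i. if c \<in> atlas M \<and> \<gamma> t \<in> fst c \<and> i < mdim M
                                 then deriv (\<lambda>\<tau>. snd c (\<gamma> \<tau>) i) t else 0)"

definition curve_length ::
    "'a manifold \<Rightarrow> ('a \<Rightarrow> 'a tvec \<Rightarrow> 'a tvec \<Rightarrow> real) \<Rightarrow> (real \<Rightarrow> 'a) \<Rightarrow> ennreal"
  where "curve_length M g \<gamma> =
    (\<integral>\<^sup>+ t. ennreal (fibre_norm g (\<gamma> t) (velocity M \<gamma> t)) * indicator {0..1} t \<partial>lborel)"

text \<open>The infimum of the empty set is \<open>\<infinity>\<close>, the distance of points in different components.\<close>

definition riemannian_dist ::
    "('a::topological_space) manifold \<Rightarrow> ('a \<Rightarrow> 'a tvec \<Rightarrow> 'a tvec \<Rightarrow> real) \<Rightarrow> 'a \<Rightarrow> 'a \<Rightarrow> ennreal"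
  where "riemannian_dist M g p q =
    (INF \<gamma>\<in>{\<gamma>. piecewise_smooth_curve M \<gamma> \<and> \<gamma> 0 = p \<and> \<gamma> 1 = q}. curve_length M g \<gamma>)"


section \<open>Nets and their classes\<close>

text \<open>
  Nets indexed by \<open>(0,1]\<close> are functions on \<^typ>\<open>real\<close> whose values outside \<open>(0,1]\<close> are never
  inspected; nets that differ only there belong to the same classes. Quotients by groups of
  negligible nets are formed as sets of cosets. Maps on quotients are defined by inserting
  representatives, chosen by \<^const>\<open>Eps\<close>.
\<close>

definition rep :: "'c set \<Rightarrow> 'c"
  where "rep A = (SOME x. x \<in> A)"

text \<open>\<open>sup\<^sub>p\<^sub>\<in>\<^sub>K |f\<^sub>\<epsilon>(p)| = O(b\<^sub>\<epsilon>)\<close> as \<open>\<epsilon> \<rightarrow> 0\<close>, with the supremum written out as a uniform bound.\<close>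

definition sup_bigo :: "'a set \<Rightarrow> (real \<Rightarrow> 'a \<Rightarrow> real) \<Rightarrow> (real \<Rightarrow> real) \<Rightarrow> bool"
  where "sup_bigo K f b \<longleftrightarrow>
    (\<exists>C>0. \<exists>\<epsilon>\<^sub>0>0. \<forall>\<epsilon>\<in>{0<..1}. \<epsilon> < \<epsilon>\<^sub>0 \<longrightarrow> (\<forall>p\<in>K. \<bar>f \<epsilon> p\<bar> \<le> C * b \<epsilon>))"

subsection \<open>Generalized numbers\<close>

definition moderate_nums :: "(real \<Rightarrow> real) set"
  where "moderate_nums = {x. \<exists>N::nat. x \<in> O[at_right 0](\<lambda>\<epsilon>. 1 / \<epsilon> ^ N)}"

definition negligible_nums :: "(real \<Rightarrow> real) set"
  where "negligible_nums = {x \<in> moderate_nums. \<forall>m::nat. x \<in> O[at_right 0](\<lambda>\<epsilon>. \<epsilon> ^ m)}"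

definition num_class :: "(real \<Rightarrow> real) \<Rightarrow> (real \<Rightarrow> real) set"
  where "num_class x = {y. y - x \<in> negligible_nums}"

definition gen_numbers :: "(real \<Rightarrow> real) set set"
  where "gen_numbers = num_class ` moderate_nums"

subsection \<open>Generalized functions\<close>

definition moderate_funs :: "('a::topological_space) manifold \<Rightarrow> (real \<Rightarrow> 'a \<Rightarrow> real) set"
  where "moderate_funs M = {u. (\<forall>\<epsilon>\<in>{0<..1}. u \<epsilon> \<in> smooth_funs M) \<and>
    (\<forall>K. compact K \<longrightarrow> (\<forall>P\<in>diff_ops M. \<exists>N::nat. sup_bigo K (\<lambda>\<epsilon>. P (u \<epsilon>)) (\<lambda>\<epsilon>. 1 / \<epsilon> ^ N)))}"

definition negligible_funs :: "('a::topological_space) manifold \<Rightarrow> (real \<Rightarrow> 'a \<Rightarrow> real) set"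
  where "negligible_funs M = {u \<in> moderate_funs M.
    \<forall>K. compact K \<longrightarrow> (\<forall>q::nat. sup_bigo K u (\<lambda>\<epsilon>. \<epsilon> ^ q))}"

definition fun_class ::
    "('a::topological_space) manifold \<Rightarrow> (real \<Rightarrow> 'a \<Rightarrow> real) \<Rightarrow> (real \<Rightarrow> 'a \<Rightarrow> real) set"
  where "fun_class M u = {v. v - u \<in> negligible_funs M}"

definition gen_funs :: "('a::topological_space) manifold \<Rightarrow> (real \<Rightarrow> 'a \<Rightarrow> real) set set"
  where "gen_funs M = fun_class M ` moderate_funs M"

subsection \<open>Generalized sections\<close>

text \<open>
  The conditions on sections below do not depend on the fibre metric \<open>h\<close>, and fibre metrics exist
  because the base is paracompact.
\<close>

definition moderate_sections ::
    "('a::topological_space) manifold \<Rightarrow> ('a, 'f::real_vector, 'j) vbundle \<Rightarrow> (real \<Rightarrow> 'a \<Rightarrow> 'f) set"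
  where "moderate_sections M E = {s. (\<forall>\<epsilon>\<in>{0<..1}. s \<epsilon> \<in> smooth_sections M E) \<and>
    (\<exists>h. fibre_metric M E h \<and>
      (\<forall>P\<in>vb_diff_ops M E. \<forall>K. compact K \<longrightarrow>
         (\<exists>N::nat. sup_bigo K (\<lambda>\<epsilon> p. fibre_norm h p (P (s \<epsilon>) p)) (\<lambda>\<epsilon>. 1 / \<epsilon> ^ N))))}"

definition negligible_sections ::
    "('a::topological_space) manifold \<Rightarrow> ('a, 'f::real_vector, 'j) vbundle \<Rightarrow> (real \<Rightarrow> 'a \<Rightarrow> 'f) set"
  where "negligible_sections M E = {s \<in> moderate_sections M E.
    \<exists>h. fibre_metric M E h \<and>
      (\<forall>K. compact K \<longrightarrow> (\<forall>m::nat. sup_bigo K (\<lambda>\<epsilon> p. fibre_norm h p (s \<epsilon> p)) (\<lambda>\<epsilon>. \<epsilon> ^ m)))}"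

definition section_class ::
    "('a::topological_space) manifold \<Rightarrow> ('a, 'f::real_vector, 'j) vbundle \<Rightarrow>
     (real \<Rightarrow> 'a \<Rightarrow> 'f) \<Rightarrow> (real \<Rightarrow> 'a \<Rightarrow> 'f) set"
  where "section_class M E s = {u. u - s \<in> negligible_sections M E}"

definition gen_sections ::
    "('a::topological_space) manifold \<Rightarrow> ('a, 'f::real_vector, 'j) vbundle \<Rightarrow>
     (real \<Rightarrow> 'a \<Rightarrow> 'f) set set"
  where "gen_sections M E = section_class M E ` moderate_sections M E"

abbreviation gen_tensor_fields ::
    "('a::topological_space) manifold \<Rightarrow> nat \<Rightarrow> nat \<Rightarrow> (real \<Rightarrow> 'a \<Rightarrow> 'a tensor) set set"
  where "gen_tensor_fields M r s \<equiv> gen_sections M (tensor_bundle M r s)"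

abbreviation gen_one_forms ::
    "('a::topological_space) manifold \<Rightarrow> (real \<Rightarrow> 'a \<Rightarrow> 'a covec) set set"
  where "gen_one_forms M \<equiv> gen_sections M (cotangent_bundle M)"

abbreviation gen_vector_fields ::
    "('a::topological_space) manifold \<Rightarrow> (real \<Rightarrow> 'a \<Rightarrow> 'a tvec) set set"
  where "gen_vector_fields M \<equiv> gen_sections M (tangent_bundle M)"

definition tensor_apply ::
    "('a::topological_space) manifold \<Rightarrow> (real \<Rightarrow> 'a \<Rightarrow> 'a tensor) set \<Rightarrow>
     (real \<Rightarrow> 'a \<Rightarrow> 'a covec) set list \<Rightarrow> (real \<Rightarrow> 'a \<Rightarrow> 'a tvec) set list \<Rightarrow>
     (real \<Rightarrow> 'a \<Rightarrow> real) set"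
  where "tensor_apply M t \<omega>s \<xi>s =
    fun_class M (\<lambda>\<epsilon> p. rep t \<epsilon> p (map (\<lambda>\<omega>. rep \<omega> \<epsilon> p) \<omega>s) (map (\<lambda>\<xi>. rep \<xi> \<epsilon> p) \<xi>s))"

subsection \<open>Generalized points and point values\<close>

definition compactly_supported_nets :: "(real \<Rightarrow> 'a::topological_space) set"
  where "compactly_supported_nets = {p. \<exists>K. compact K \<and> (\<exists>\<epsilon>\<^sub>0>0. \<forall>\<epsilon>\<in>{0<..1}. \<epsilon> < \<epsilon>\<^sub>0 \<longrightarrow> p \<epsilon> \<in> K)}"

text \<open>
  The condition on the distance is the same for all Riemannian metrics; these exist because the
  manifold is paracompact.
\<close>

definition point_nets_equiv ::
    "('a::topological_space) manifold \<Rightarrow> (real \<Rightarrow> 'a) \<Rightarrow> (real \<Rightarrow> 'a) \<Rightarrow> bool"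
  where "point_nets_equiv M p q \<longleftrightarrow>
    (\<forall>g. riemannian_metric M g \<longrightarrow>
      (\<forall>m::nat. \<exists>C>0. \<exists>\<epsilon>\<^sub>0>0. \<forall>\<epsilon>\<in>{0<..1}. \<epsilon> < \<epsilon>\<^sub>0 \<longrightarrow>
         riemannian_dist M g (p \<epsilon>) (q \<epsilon>) \<le> ennreal (C * \<epsilon> ^ m)))"

definition gen_points :: "('a::topological_space) manifold \<Rightarrow> (real \<Rightarrow> 'a) set set"
  where "gen_points M = compactly_supported_nets //
    {(p, q). p \<in> compactly_supported_nets \<and> q \<in> compactly_supported_nets \<and> point_nets_equiv M p q}"

definition fun_point_value :: "(real \<Rightarrow> 'a \<Rightarrow> real) set \<Rightarrow> (real \<Rightarrow> 'a) set \<Rightarrow> (real \<Rightarrow> real) set"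
  where "fun_point_value f p = num_class (\<lambda>\<epsilon>. rep f \<epsilon> (rep p \<epsilon>))"

definition vb_moderate_nets ::
    "('a::topological_space) manifold \<Rightarrow> ('a, 'f::real_vector, 'j) vbundle \<Rightarrow> (real \<Rightarrow> 'a \<times> 'f) set"
  where "vb_moderate_nets M E = {e.
    (\<forall>\<epsilon>\<in>{0<..1}. snd (e \<epsilon>) \<in> fibre E (fst (e \<epsilon>))) \<and>
    (\<lambda>\<epsilon>. fst (e \<epsilon>)) \<in> compactly_supported_nets \<and>
    (\<exists>h. fibre_metric M E h \<and>
      (\<exists>\<epsilon>\<^sub>1>0. \<exists>N::nat. \<exists>C>0. \<forall>\<epsilon>\<in>{0<..1}. \<epsilon> < \<epsilon>\<^sub>1 \<longrightarrow>
         fibre_norm h (fst (e \<epsilon>)) (snd (e \<epsilon>)) \<le> C * (1 / \<epsilon> ^ N)))}"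

definition vb_nets_equiv ::
    "('a::topological_space) manifold \<Rightarrow> ('a, 'f::real_vector, 'j) vbundle \<Rightarrow>
     (real \<Rightarrow> 'a \<times> 'f) \<Rightarrow> (real \<Rightarrow> 'a \<times> 'f) \<Rightarrow> bool"
  where "vb_nets_equiv M E e e' \<longleftrightarrow>
    point_nets_equiv M (\<lambda>\<epsilon>. fst (e \<epsilon>)) (\<lambda>\<epsilon>. fst (e' \<epsilon>)) \<and>
    (\<forall>m::nat. \<forall>(c, \<Psi>)\<in>vb_charts M E. \<forall>L. compact L \<and> L \<subseteq> fst c \<longrightarrow>
       (\<exists>\<epsilon>\<^sub>1>0. \<exists>C>0. \<forall>\<epsilon>\<in>{0<..1}. \<epsilon> < \<epsilon>\<^sub>1 \<and> fst (e \<epsilon>) \<in> L \<and> fst (e' \<epsilon>) \<in> L \<longrightarrow>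
          L2_set (\<Psi> (fst (e \<epsilon>)) (snd (e \<epsilon>)) - \<Psi> (fst (e' \<epsilon>)) (snd (e' \<epsilon>))) (frame_index E)
            \<le> C * \<epsilon> ^ m))"

definition vb_rel ::
    "('a::topological_space) manifold \<Rightarrow> ('a, 'f::real_vector, 'j) vbundle \<Rightarrow>
     ((real \<Rightarrow> 'a \<times> 'f) \<times> (real \<Rightarrow> 'a \<times> 'f)) set"
  where "vb_rel M E = {(e, e'). e \<in> vb_moderate_nets M E \<and> e' \<in> vb_moderate_nets M E \<and>
    vb_nets_equiv M E e e'}"

definition gen_vb_points ::
    "('a::topological_space) manifold \<Rightarrow> ('a, 'f::real_vector, 'j) vbundle \<Rightarrow>
     (real \<Rightarrow> 'a \<times> 'f) set set"
  where "gen_vb_points M E = vb_moderate_nets M E // vb_rel M E"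

definition section_point_value ::
    "('a::topological_space) manifold \<Rightarrow> ('a, 'f::real_vector, 'j) vbundle \<Rightarrow>
     (real \<Rightarrow> 'a \<Rightarrow> 'f) set \<Rightarrow> (real \<Rightarrow> 'a) set \<Rightarrow> (real \<Rightarrow> 'a \<times> 'f) set"
  where "section_point_value M E u p = vb_rel M E `` {\<lambda>\<epsilon>. (rep p \<epsilon>, rep u \<epsilon> (rep p \<epsilon>))}"

end

theory Submission
  imports Defs
begin

text \<open>
  The value of a tensor at a point is determined by the values of its arguments at that point. For
  smooth tensor fields this is trivial; for generalized ones it is a stability statement. Let
  \<open>p\<^sub>\<epsilon>\<close> represent the generalized point. In a chart the number in question is
  \<open>\<Sum> t\<^sub>\<alpha>\<^sub>\<beta>(p\<^sub>\<epsilon>) \<Prod> \<omega>\<^sub>k(p\<^sub>\<epsilon>)(\<partial>\<^sub>\<alpha>\<^sub>k) \<Prod> dx\<^sup>\<beta>\<^sup>l(\<xi>\<^sub>l(p\<^sub>\<epsilon>))\<close> (lemma \<open>tensor_expand\<close>), a polynomial in nets of real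
  numbers. All these nets are moderate, because a generalized section is bounded by a power of
  \<open>1/\<epsilon>\<close> on compact sets (\<open>component_moderate\<close>), and equality of the point values of the arguments
  means that corresponding components differ by negligible nets (\<open>component_diff_negligible\<close>).
  Negligible nets form an ideal in the moderate ones, so the two values of the polynomial differ by
  a negligible net (\<open>tensor_apply_diff_negligible\<close>). The points \<open>p\<^sub>\<epsilon>\<close> stay in a compact set, which
  is covered by compact pieces of finitely many charts (\<open>compact_chart_cover\<close>); the estimates are
  made for each piece separately, along those \<open>\<epsilon>\<close> for which \<open>p\<^sub>\<epsilon>\<close> lies in it.

  Most of the work is to connect this argument with the definitions. Bounds on sections are stated
  with fibre norms, and those on components are obtained by comparing the fibre norm with the
  Euclidean one over a compact piece of a chart (\<open>fibre_norm_chart_bounds\<close>); this is compactness of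
  the unit sphere together with continuity of the metric in vector bundle charts. Therefore the
  coordinate trivializations of the tangent, cotangent and tensor bundles have to be shown to be
  vector bundle charts: bijective on fibres, with smooth transition matrices. The entries of these
  matrices are products of entries of Jacobians, and what is used about them is the chain rule
  (\<open>jac_trans\<close>) and that smooth functions are closed under products and composition
  (\<open>C_on_compose\<close>).

  Point values and the action of tensors are defined through representatives picked from
  equivalence classes. The picked representatives are under control once the classes are known to
  be nonempty (\<open>rep_gen_section\<close>, \<open>rep_gen_point\<close>, \<open>fun_point_value_class\<close>), and an equation between
  classes of bundle points yields an equivalence of nets since the nets are moderate
  (\<open>section_point_value_eqD\<close>).
\<close>

section \<open>Calculus on open subsets of Euclidean space\<close>

lemma Euclidean_space_eq_top_of_set: "Euclidean_space n = top_of_set {x. \<forall>i\<ge>n. x i = 0}"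
  by (simp add: Euclidean_space_def euclidean_product_topology)

lemma Euclidean_space_zero: "openin (Euclidean_space n) U \<Longrightarrow> x \<in> U \<Longrightarrow> i \<ge> n \<Longrightarrow> x i = 0"
  using openin_subset[of "Euclidean_space n" U] by (auto simp: topspace_Euclidean_space)

text \<open>Points have infinitely many coordinates of which all but the first \<open>n\<close> vanish, and the product
  topology carries no norm; coordinate boxes take over the role of balls.\<close>

lemma Euclidean_space_box:
  assumes U: "openin (Euclidean_space n) U" and x: "x \<in> U"
  obtains \<delta> where "\<delta> > 0"
    "\<And>y. (\<And>i. i < n \<Longrightarrow> \<bar>y i - x i\<bar> \<le> \<delta>) \<Longrightarrow> (\<And>i. i \<ge> n \<Longrightarrow> y i = 0) \<Longrightarrow> y \<in> U"
proof -
  obtain T where T: "open T" "U = {x. \<forall>i\<ge>n. x i = 0} \<inter> T"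
    using U by (auto simp: Euclidean_space_eq_top_of_set openin_open)
  have "\<exists>X. x \<in> Pi\<^sub>E UNIV X \<and> (\<forall>i. openin euclidean (X i)) \<and>
      finite {i. X i \<noteq> topspace euclidean} \<and> Pi\<^sub>E UNIV X \<subseteq> T"
    by (rule product_topology_open_contains_basis) (use T x in \<open>auto simp: euclidean_product_topology\<close>)
  then obtain X where X: "x \<in> Pi\<^sub>E UNIV X" "\<And>i. open (X i)" "Pi\<^sub>E UNIV X \<subseteq> T"
    by auto
  have "\<exists>d>0. \<forall>y. dist y (x i) < d \<longrightarrow> y \<in> X i" for i
    using X(1,2) by (metis PiE_mem UNIV_I open_dist)
  then obtain d where d: "\<And>i. d i > 0" "\<And>i y. dist y (x i) < d i \<Longrightarrow> y \<in> X i"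
    by metis
  define \<delta> where "\<delta> = Min (insert 1 (d ` {..<n})) / 2"
  have pos: "Min (insert 1 (d ` {..<n})) > 0"
    using d(1) by auto
  show thesis
  proof
    show "\<delta> > 0" using pos by (simp add: \<delta>_def)
    fix y assume y: "\<And>i. i < n \<Longrightarrow> \<bar>y i - x i\<bar> \<le> \<delta>" "\<And>i. i \<ge> n \<Longrightarrow> y i = 0"
    have "y i \<in> X i" for i
    proof (cases "i < n")
      case True
      then have "Min (insert 1 (d ` {..<n})) \<le> d i" by auto
      then have "\<delta> < d i" using pos unfolding \<delta>_def by linarith
      then show ?thesis using y(1)[OF True] d(2) by (simp add: dist_real_def)
    next
      case False
      then have "y i = x i" using y(2) x T by auto
      then show ?thesis using d by (metis dist_self)
    qed
    then show "y \<in> U" using X(3) T y(2) by (auto simp: PiE_iff)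
  qed
qed

text \<open>The one-variable slices through a point of an open set stay in the set for a short time;
  this is what makes partial derivatives local.\<close>

lemma eventually_upd_in:
  assumes U: "openin (Euclidean_space n) U" and x: "x \<in> U" and i: "i < n"
  shows "\<forall>\<^sub>F t in nhds (x i). x(i := t) \<in> U"
proof -
  obtain \<delta> where \<delta>: "\<delta> > 0"
    "\<And>y. (\<And>i. i < n \<Longrightarrow> \<bar>y i - x i\<bar> \<le> \<delta>) \<Longrightarrow> (\<And>i. i \<ge> n \<Longrightarrow> y i = 0) \<Longrightarrow> y \<in> U"
    using Euclidean_space_box[OF U x] by blast
  have "\<forall>\<^sub>F t in nhds (x i). dist t (x i) < \<delta>"
    using \<delta>(1) eventually_nhds_metric by blast
  then show ?thesis
  proof (rule eventually_mono)
    fix t assume "dist t (x i) < \<delta>"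
    then show "x(i := t) \<in> U"
      using \<delta> i Euclidean_space_zero[OF U x] by (intro \<delta>(2)) (auto simp: dist_real_def)
  qed
qed

lemma partial_deriv_cong:
  assumes U: "openin (Euclidean_space n) U" and x: "x \<in> U" and i: "i < n"
    and fg: "\<And>y. y \<in> U \<Longrightarrow> f y = g y"
  shows "partial_deriv i f x = partial_deriv i g x"
  unfolding partial_deriv_def
  by (rule deriv_cong_ev[OF eventually_mono[OF eventually_upd_in[OF U x i]]]) (use fg in auto)

lemma differentiable_slice_cong:
  fixes f g :: "(nat \<Rightarrow> real) \<Rightarrow> real"
  assumes U: "openin (Euclidean_space n) U" and x: "x \<in> U" and i: "i < n"
    and fg: "\<And>y. y \<in> U \<Longrightarrow> f y = g y"
    and f: "(\<lambda>t. f (x(i := t))) differentiable (at (x i))"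
  shows "(\<lambda>t. g (x(i := t))) differentiable (at (x i))"
proof -
  obtain D where "((\<lambda>t. f (x(i := t))) has_field_derivative D) (at (x i))"
    using f by (auto simp: real_differentiable_def)
  moreover have "\<forall>\<^sub>F t in nhds (x i). f (x(i := t)) = g (x(i := t))"
    by (rule eventually_mono[OF eventually_upd_in[OF U x i]]) (use fg in auto)
  ultimately have "((\<lambda>t. g (x(i := t))) has_field_derivative D) (at (x i))"
    using DERIV_cong_ev[OF refl _ refl, of "\<lambda>t. f (x(i := t))" "\<lambda>t. g (x(i := t))"] by simp
  then show ?thesis by (auto simp: real_differentiable_def)
qed

lemma DERIV_partial_deriv:
  fixes f :: "(nat \<Rightarrow> real) \<Rightarrow> real"
  assumes "(\<lambda>t. f (x(i := t))) differentiable (at (x i))"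
  shows "((\<lambda>t. f (x(i := t))) has_field_derivative partial_deriv i f x) (at (x i))"
  using assms unfolding partial_deriv_def by (auto simp: real_differentiable_def DERIV_imp_deriv)

lemma partial_deriv_eqI:
  fixes f :: "(nat \<Rightarrow> real) \<Rightarrow> real"
  shows   "((\<lambda>t. f (x(i := t))) has_field_derivative D) (at (x i)) \<Longrightarrow> partial_deriv i f x = D"
  by (simp add: partial_deriv_def DERIV_imp_deriv)

subsection \<open>The chain rule\<close>

text \<open>Hadamard's form of total differentiability for a \<open>C\<^sup>1\<close> function: the increment is a linear
  combination of the coordinate increments with coefficients that tend to the partial derivatives.
  One walks from \<open>x\<close> to \<open>y\<close> along the coordinate axes and applies the mean value theorem to each
  leg. In this form the chain rule along a curve is a limit of difference quotients.\<close>

lemma Hadamard_increment: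
  assumes U: "openin (Euclidean_space n) U" and x: "x \<in> U"
    and diff: "\<forall>z\<in>U. \<forall>i<n. (\<lambda>t. f (z(i := t))) differentiable (at (z i))"
    and cont: "\<forall>i<n. continuous_on U (partial_deriv i f)"
  shows "\<exists>g. \<exists>\<delta>>0. (\<forall>y. (\<forall>i<n. \<bar>y i - x i\<bar> \<le> \<delta>) \<longrightarrow> (\<forall>i\<ge>n. y i = 0) \<longrightarrow>
         f y - f x = (\<Sum>i<n. g i y * (y i - x i))) \<and>
      (\<forall>e>0. \<forall>i<n. \<exists>d>0. \<forall>y. (\<forall>i<n. \<bar>y i - x i\<bar> \<le> d) \<longrightarrow> (\<forall>i\<ge>n. y i = 0) \<longrightarrow>
         \<bar>g i y - partial_deriv i f x\<bar> < e)"
proof -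
  obtain \<delta> where \<delta>: "\<delta> > 0"
    "\<And>y. (\<And>i. i < n \<Longrightarrow> \<bar>y i - x i\<bar> \<le> \<delta>) \<Longrightarrow> (\<And>i. i \<ge> n \<Longrightarrow> y i = 0) \<Longrightarrow> y \<in> U"
    using Euclidean_space_box[OF U x] by blast
  note x0 = Euclidean_space_zero[OF U x]
  \<comment> \<open>The corners of the walk: the first \<open>i\<close> coordinates have already been changed to those of \<open>y\<close>.\<close>
  define z where "z y i = (\<lambda>j. if j < i then y j else x j)" for y :: "nat \<Rightarrow> real" and i :: nat
  \<comment> \<open>The slope of the \<open>i\<close>-th leg; the value on a leg of length \<open>0\<close> makes it continuous at \<open>x\<close>.\<close>
  define g where "g i y = (if y i = x i then partial_deriv i f x
      else (f (z y (Suc i)) - f (z y i)) / (y i - x i))" for i y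
  have z_upd: "(z y i)(i := y i) = z y (Suc i)" "(z y i)(i := x i) = z y i" for y i
    by (auto simp: z_def fun_eq_iff)
  have g_mvt: "y i = x i \<or> (\<exists>\<tau>. \<bar>\<tau> - x i\<bar> \<le> \<bar>y i - x i\<bar> \<and> g i y = partial_deriv i f ((z y i)(i := \<tau>)))"
    if y: "\<And>i. i < n \<Longrightarrow> \<bar>y i - x i\<bar> \<le> \<delta>" "\<And>i. i \<ge> n \<Longrightarrow> y i = 0" and i: "i < n" for y i
  proof (cases "y i = x i")
    case False
    define \<phi> where "\<phi> t = f ((z y i)(i := t))" for t
    have D: "(\<phi> has_field_derivative partial_deriv i f ((z y i)(i := t))) (at t)"
      if t: "\<bar>t - x i\<bar> \<le> \<bar>y i - x i\<bar>" for t
    proof -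
      have "(z y i)(i := t) \<in> U"
      proof (rule \<delta>(2))
        fix k assume "k < n"
        then show "\<bar>((z y i)(i := t)) k - x k\<bar> \<le> \<delta>"
          using y(1)[of k] y(1)[OF i] t \<delta>(1) by (auto simp: z_def)
      next
        fix k assume "k \<ge> n"
        then show "((z y i)(i := t)) k = 0" using x0 i y(2) by (auto simp: z_def)
      qed
      from DERIV_partial_deriv[OF diff[rule_format, OF this i]] show ?thesis
        unfolding \<phi>_def by (simp only: fun_upd_upd fun_upd_same)
    qed
    have "\<exists>\<tau>. \<bar>\<tau> - x i\<bar> \<le> \<bar>y i - x i\<bar> \<and> \<phi> (y i) - \<phi> (x i) = (y i - x i) * partial_deriv i f ((z y i)(i := \<tau>))"
    proof (cases "x i < y i")
      case True
      have "\<exists>\<tau>>x i. \<tau> < y i \<and> \<phi> (y i) - \<phi> (x i) = (y i - x i) * partial_deriv i f ((z y i)(i := \<tau>))"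
        by (rule MVT2[OF True]) (rule D, auto)
      then show ?thesis by (smt (verit))
    next
      case F: False
      then have less: "y i < x i" using False by auto
      have "\<exists>\<tau>>y i. \<tau> < x i \<and> \<phi> (x i) - \<phi> (y i) = (x i - y i) * partial_deriv i f ((z y i)(i := \<tau>))"
        by (rule MVT2[OF less]) (rule D, auto)
      then obtain \<tau> where "\<tau> > y i" "\<tau> < x i" "\<phi> (x i) - \<phi> (y i) = (x i - y i) * partial_deriv i f ((z y i)(i := \<tau>))"
        by blast
      then show ?thesis by (intro exI[of _ \<tau>]) (auto simp: algebra_simps)
    qed
    then show ?thesis using False by (auto simp: g_def \<phi>_def z_upd)
  qed auto
  show ?thesis
  proof (rule exI[of _ g], rule exI[of _ \<delta>], intro conjI allI impI)
    show "\<delta> > 0" by fact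
  next
    fix y assume y: "\<forall>i<n. \<bar>y i - x i\<bar> \<le> \<delta>" "\<forall>i\<ge>n. y i = 0"
    have "z y n = y" using y(2) x0 by (auto simp: z_def fun_eq_iff)
    moreover have "z y 0 = x" by (auto simp: z_def)
    moreover have "f (z y (Suc i)) - f (z y i) = g i y * (y i - x i)" if "i < n" for i
    proof (cases "y i = x i")
      case True
      then have "z y (Suc i) = z y i" using z_upd[of y i] by metis
      then show ?thesis using True by simp
    qed (simp add: g_def)
    ultimately show "f y - f x = (\<Sum>i<n. g i y * (y i - x i))"
      using sum_lessThan_telescope[of "\<lambda>i. f (z y i)" n] by (metis (no_types, lifting) lessThan_iff sum.cong)
  next
    fix e :: real and i assume e: "e > 0" and i: "i < n"
    define W where "W = U \<inter> partial_deriv i f -` {partial_deriv i f x - e<..<partial_deriv i f x + e}"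
    have "openin (top_of_set U) W"
      unfolding W_def by (rule continuous_openin_preimage_gen[OF cont[rule_format, OF i]]) auto
    then have W: "openin (Euclidean_space n) W"
      using U unfolding Euclidean_space_eq_top_of_set by (rule openin_trans)
    have xW: "x \<in> W" using x e by (simp add: W_def)
    obtain d where d: "d > 0"
      "\<And>y. (\<And>i. i < n \<Longrightarrow> \<bar>y i - x i\<bar> \<le> d) \<Longrightarrow> (\<And>i. i \<ge> n \<Longrightarrow> y i = 0) \<Longrightarrow> y \<in> W"
      using Euclidean_space_box[OF W xW] by blast
    show "\<exists>d>0. \<forall>y. (\<forall>i<n. \<bar>y i - x i\<bar> \<le> d) \<longrightarrow> (\<forall>i\<ge>n. y i = 0) \<longrightarrow> \<bar>g i y - partial_deriv i f x\<bar> < e"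
    proof (intro exI[of _ "min d \<delta>"] conjI allI impI)
      show "min d \<delta> > 0" using d \<delta> by simp
      fix y assume y: "\<forall>i<n. \<bar>y i - x i\<bar> \<le> min d \<delta>" "\<forall>i\<ge>n. y i = 0"
      show "\<bar>g i y - partial_deriv i f x\<bar> < e"
      proof (cases "y i = x i")
        case True
        then show ?thesis using e by (simp add: g_def)
      next
        case False
        then obtain \<tau> where \<tau>: "\<bar>\<tau> - x i\<bar> \<le> \<bar>y i - x i\<bar>" "g i y = partial_deriv i f ((z y i)(i := \<tau>))"
          using g_mvt[OF _ _ i, of y] y by auto
        have "(z y i)(i := \<tau>) \<in> W"
        proof (rule d(2))
          fix k assume "k < n"
          then show "\<bar>((z y i)(i := \<tau>)) k - x k\<bar> \<le> d"
            using y(1) \<tau>(1) i d(1) by (force simp: z_def)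
        next
          fix k assume "k \<ge> n"
          then show "((z y i)(i := \<tau>)) k = 0" using x0 i y(2) by (auto simp: z_def)
        qed
        then show ?thesis using \<tau>(2) by (auto simp: W_def)
      qed
    qed
  qed
qed

lemma DERIV_along_curve:
  assumes U: "openin (Euclidean_space n) U" and x: "\<gamma> t \<in> U"
    and diff: "\<forall>z\<in>U. \<forall>i<n. (\<lambda>t. f (z(i := t))) differentiable (at (z i))"
    and cont: "\<forall>i<n. continuous_on U (partial_deriv i f)"
    and \<gamma>: "\<And>i. i < n \<Longrightarrow> ((\<lambda>s. \<gamma> s i) has_field_derivative \<gamma>' i) (at t)"
    and \<gamma>0: "\<forall>\<^sub>F s in nhds t. \<forall>i\<ge>n. \<gamma> s i = 0"
  shows "((\<lambda>s. f (\<gamma> s)) has_field_derivative (\<Sum>i<n. partial_deriv i f (\<gamma> t) * \<gamma>' i)) (at t)"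
proof -
  obtain g \<delta> where g: "\<delta> > 0"
    "\<forall>y. (\<forall>i<n. \<bar>y i - \<gamma> t i\<bar> \<le> \<delta>) \<longrightarrow> (\<forall>i\<ge>n. y i = 0) \<longrightarrow>
         f y - f (\<gamma> t) = (\<Sum>i<n. g i y * (y i - \<gamma> t i))"
    "\<forall>e>0. \<forall>i<n. \<exists>d>0. \<forall>y. (\<forall>i<n. \<bar>y i - \<gamma> t i\<bar> \<le> d) \<longrightarrow> (\<forall>i\<ge>n. y i = 0) \<longrightarrow>
         \<bar>g i y - partial_deriv i f (\<gamma> t)\<bar> < e"
    using Hadamard_increment[where f = f, OF U x diff cont] by (elim exE conjE) (rule that)
  have \<gamma>0': "\<forall>\<^sub>F s in at t. \<forall>i\<ge>n. \<gamma> s i = 0"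
    using \<gamma>0 by (simp add: eventually_at_filter eventually_mono)
  have near: "\<forall>\<^sub>F s in at t. \<forall>i<n. \<bar>\<gamma> s i - \<gamma> t i\<bar> \<le> d" if "d > 0" for d
  proof -
    have "\<forall>\<^sub>F s in at t. \<bar>\<gamma> s i - \<gamma> t i\<bar> \<le> d" if "i < n" for i
    proof -
      have "((\<lambda>s. \<gamma> s i) \<longlongrightarrow> \<gamma> t i) (at t)"
        using DERIV_isCont[OF \<gamma>[OF that]] by (simp add: isCont_def)
      from tendstoD[OF this \<open>d > 0\<close>] show ?thesis
        by (rule eventually_mono) (simp add: dist_real_def)
    qed
    then have "\<forall>\<^sub>F s in at t. \<forall>i\<in>{..<n}. \<bar>\<gamma> s i - \<gamma> t i\<bar> \<le> d"
      by (intro eventually_ball_finite) auto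
    then show ?thesis by (rule eventually_mono) auto
  qed
  have lim_g: "((\<lambda>s. g i (\<gamma> s)) \<longlongrightarrow> partial_deriv i f (\<gamma> t)) (at t)" if i: "i < n" for i
  proof (rule tendstoI)
    fix e :: real assume "e > 0"
    then obtain d where d: "d > 0" "\<forall>y. (\<forall>i<n. \<bar>y i - \<gamma> t i\<bar> \<le> d) \<longrightarrow> (\<forall>i\<ge>n. y i = 0) \<longrightarrow>
       \<bar>g i y - partial_deriv i f (\<gamma> t)\<bar> < e" using g(3) i by blast
    show "\<forall>\<^sub>F s in at t. dist (g i (\<gamma> s)) (partial_deriv i f (\<gamma> t)) < e"
      using near[OF d(1)] \<gamma>0' by eventually_elim (use d(2) in \<open>simp add: dist_real_def\<close>)
  qed
  have "((\<lambda>s. \<Sum>i<n. g i (\<gamma> s) * ((\<gamma> s i - \<gamma> t i) / (s - t))) \<longlongrightarrow>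
      (\<Sum>i<n. partial_deriv i f (\<gamma> t) * \<gamma>' i)) (at t)"
  proof (intro tendsto_sum tendsto_mult lim_g)
    fix i assume "i \<in> {..<n}"
    then show "((\<lambda>s. (\<gamma> s i - \<gamma> t i) / (s - t)) \<longlongrightarrow> \<gamma>' i) (at t)"
      using \<gamma>[of i] by (simp add: has_field_derivative_iff)
  qed simp
  moreover have "\<forall>\<^sub>F s in at t. (\<Sum>i<n. g i (\<gamma> s) * ((\<gamma> s i - \<gamma> t i) / (s - t))) =
      (f (\<gamma> s) - f (\<gamma> t)) / (s - t)"
    using near[OF g(1)] \<gamma>0'
  proof eventually_elim
    case (elim s)
    then have "f (\<gamma> s) - f (\<gamma> t) = (\<Sum>i<n. g i (\<gamma> s) * (\<gamma> s i - \<gamma> t i))"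
      using g(2) by blast
    then show ?case by (simp only: sum_divide_distrib times_divide_eq_right)
  qed
  ultimately show ?thesis
    unfolding has_field_derivative_iff by (rule Lim_transform_eventually)
qed

subsection \<open>Smooth functions\<close>

text \<open>The class \<open>C\<^sup>k\<close>, by recursion on \<open>k\<close>: closure properties of smooth functions are proved by
  induction on \<open>k\<close>, where the derivative of a product or of a composition is again a sum of
  products of functions to which the induction hypothesis applies.\<close>

primrec C_on :: "nat \<Rightarrow> (nat \<Rightarrow> real) set \<Rightarrow> nat \<Rightarrow> ((nat \<Rightarrow> real) \<Rightarrow> real) \<Rightarrow> bool" where
  "C_on n U 0 f \<longleftrightarrow> continuous_on U f"
| "C_on n U (Suc k) f \<longleftrightarrow> continuous_on U f \<and>
     (\<forall>i<n. (\<forall>x\<in>U. (\<lambda>t. f (x(i := t))) differentiable (at (x i))) \<and> C_on n U k (partial_deriv i f))"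

lemma C_on_imp_continuous_on: "C_on n U k f \<Longrightarrow> continuous_on U f"
  by (cases k) auto

lemma C_on_SucD: "C_on n U (Suc k) f \<Longrightarrow> C_on n U k f"
  by (induction k arbitrary: f) (auto dest: C_on_imp_continuous_on)

lemma smooth_imp_C_on:
  assumes "smooth_on_Euclidean n U f"
  shows "C_on n U k f"
  using assms
proof (induction k arbitrary: f)
  case 0
  then show ?case
    unfolding smooth_on_Euclidean_def by (auto simp: partial_derivs_def dest: spec[where x = "[]"])
next
  case (Suc k)
  have "smooth_on_Euclidean n U (partial_deriv i f)" if "i < n" for i
    unfolding smooth_on_Euclidean_def
  proof (intro allI impI)
    fix \<alpha> assume "set \<alpha> \<subseteq> {..<n}"
    then have "set (\<alpha> @ [i]) \<subseteq> {..<n}" using that by auto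
    moreover have "partial_derivs \<alpha> (partial_deriv i f) = partial_derivs (\<alpha> @ [i]) f"
      by (simp add: partial_derivs_def)
    ultimately show "continuous_on U (partial_derivs \<alpha> (partial_deriv i f)) \<and>
      (\<forall>x\<in>U. \<forall>ia<n. (\<lambda>t. partial_derivs \<alpha> (partial_deriv i f) (x(ia := t))) differentiable at (x ia))"
      using Suc.prems unfolding smooth_on_Euclidean_def by metis
  qed
  moreover have "continuous_on U f \<and> (\<forall>x\<in>U. \<forall>i<n. (\<lambda>t. f (x(i := t))) differentiable (at (x i)))"
    using Suc.prems[unfolded smooth_on_Euclidean_def, rule_format, of "[]"]
    by (simp add: partial_derivs_def)
  ultimately show ?case using Suc.IH by auto
qed

lemma smooth_on_Euclidean_iff_C_on: "smooth_on_Euclidean n U f \<longleftrightarrow> (\<forall>k. C_on n U k f)"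
proof
  assume f: "\<forall>k. C_on n U k f"
  have "\<forall>k. C_on n U k (partial_derivs \<alpha> f)" if "set \<alpha> \<subseteq> {..<n}" for \<alpha>
    using that
  proof (induction \<alpha>)
    case Nil
    then show ?case using f by (simp add: partial_derivs_def)
  next
    case (Cons i \<alpha>)
    then have "\<forall>k. C_on n U k (partial_derivs \<alpha> f)" by simp
    then have "\<forall>k. C_on n U (Suc k) (partial_derivs \<alpha> f)" by blast
    then show ?case using Cons.prems by (simp add: partial_derivs_def)
  qed
  then show "smooth_on_Euclidean n U f"
    unfolding smooth_on_Euclidean_def using C_on.simps(2)[of n U 0] by blast
qed (blast intro: smooth_imp_C_on)

text \<open>Charts are evaluated through inverses that are arbitrary outside the image of the chart, so
  every formula for a transition map holds only on the relevant open set.\<close>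

lemma C_on_cong:
  assumes U: "openin (Euclidean_space n) U" and "\<And>y. y \<in> U \<Longrightarrow> f y = g y" "C_on n U k f"
  shows "C_on n U k g"
  using assms(2,3)
proof (induction k arbitrary: f g)
  case 0
  then show ?case by (simp cong: continuous_on_cong)
next
  case (Suc k)
  have "continuous_on U g" using Suc.prems by (simp cong: continuous_on_cong)
  moreover have "(\<lambda>t. g (x(i := t))) differentiable (at (x i))" if "i < n" "x \<in> U" for i x
  proof (rule differentiable_slice_cong[where f = f, OF U that(2,1)])
    show "(\<lambda>t. f (x(i := t))) differentiable (at (x i))"
      using Suc.prems(2) that unfolding C_on.simps by blast
  qed (fact Suc.prems(1))
  moreover have "C_on n U k (partial_deriv i g)" if i: "i < n" for i
  proof (rule Suc.IH[of "partial_deriv i f"])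
    show "partial_deriv i f y = partial_deriv i g y" if "y \<in> U" for y
      using partial_deriv_cong[OF U that i, of f g] Suc.prems(1) by blast
    show "C_on n U k (partial_deriv i f)"
      using Suc.prems(2) i by simp
  qed
  ultimately show ?case by simp
qed

lemma smooth_on_Euclidean_cong:
  assumes "openin (Euclidean_space n) U" "\<And>y. y \<in> U \<Longrightarrow> f y = g y" "smooth_on_Euclidean n U f"
  shows "smooth_on_Euclidean n U g"
  using assms C_on_cong unfolding smooth_on_Euclidean_iff_C_on by blast

lemma C_on_subset: "C_on n U k f \<Longrightarrow> V \<subseteq> U \<Longrightarrow> C_on n V k f"
  by (induction k arbitrary: f) (auto intro: continuous_on_subset)

lemma partial_deriv_const: "partial_deriv i (\<lambda>x. a) = (\<lambda>x. 0)"
  by (auto simp: partial_deriv_def fun_eq_iff)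

lemma C_on_const: "C_on n U k (\<lambda>x. a)"
  by (induction k arbitrary: a) (auto simp: partial_deriv_const)

lemma C_on_add:
  assumes U: "openin (Euclidean_space n) U" and "C_on n U k f" "C_on n U k g"
  shows "C_on n U k (\<lambda>x. f x + g x)"
  using assms(2,3)
proof (induction k arbitrary: f g)
  case 0
  then show ?case by (auto intro: continuous_intros)
next
  case (Suc k)
  have diff: "(\<lambda>t. f (x(i := t))) differentiable (at (x i))" "(\<lambda>t. g (x(i := t))) differentiable (at (x i))"
    if "i < n" "x \<in> U" for i x using Suc.prems that by auto
  have "C_on n U k (partial_deriv i (\<lambda>x. f x + g x))" if i: "i < n" for i
  proof (rule C_on_cong[OF U])
    show "C_on n U k (\<lambda>x. partial_deriv i f x + partial_deriv i g x)"
      using Suc.prems i by (intro Suc.IH) auto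
    show "partial_deriv i f x + partial_deriv i g x = partial_deriv i (\<lambda>x. f x + g x) x" if "x \<in> U" for x
      by (rule partial_deriv_eqI[symmetric])
        (intro DERIV_add DERIV_partial_deriv diff i that)
  qed
  then show ?case using Suc.prems diff by (auto intro!: continuous_intros differentiable_add)
qed

lemma C_on_mult:
  assumes U: "openin (Euclidean_space n) U" and "C_on n U k f" "C_on n U k g"
  shows "C_on n U k (\<lambda>x. f x * g x)"
  using assms(2,3)
proof (induction k arbitrary: f g)
  case 0
  then show ?case by (auto intro: continuous_intros)
next
  case (Suc k)
  have diff: "(\<lambda>t. f (x(i := t))) differentiable (at (x i))" "(\<lambda>t. g (x(i := t))) differentiable (at (x i))"
    if "i < n" "x \<in> U" for i x using Suc.prems that by auto
  have lower: "C_on n U k f" "C_on n U k g" using Suc.prems C_on_SucD by blast+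
  have "C_on n U k (partial_deriv i (\<lambda>x. f x * g x))" if i: "i < n" for i
  proof (rule C_on_cong[OF U])
    show "C_on n U k (\<lambda>x. partial_deriv i f x * g x + partial_deriv i g x * f x)"
      using Suc.prems i by (intro C_on_add[OF U] Suc.IH lower) auto
    show "partial_deriv i f x * g x + partial_deriv i g x * f x = partial_deriv i (\<lambda>x. f x * g x) x"
      if "x \<in> U" for x
    proof (rule partial_deriv_eqI[symmetric])
      have "((\<lambda>t. f (x(i := t)) * g (x(i := t))) has_field_derivative
        partial_deriv i f x * g (x(i := x i)) + partial_deriv i g x * f (x(i := x i))) (at (x i))"
        by (intro DERIV_mult DERIV_partial_deriv diff i that)
      then show "((\<lambda>t. f (x(i := t)) * g (x(i := t))) has_field_derivative
        partial_deriv i f x * g x + partial_deriv i g x * f x) (at (x i))" by simp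
    qed
  qed
  then show ?case using Suc.prems diff by (auto intro!: continuous_intros differentiable_mult)
qed

lemma C_on_sum:
  assumes U: "openin (Euclidean_space n) U" and "\<And>a. a \<in> A \<Longrightarrow> C_on n U k (f a)"
  shows "C_on n U k (\<lambda>x. \<Sum>a\<in>A. f a x)"
  using assms(2)
  by (induction A rule: infinite_finite_induct) (auto intro: C_on_add[OF U] C_on_const)

text \<open>A partial derivative of \<open>f \<circ> \<phi>\<close> is the derivative of \<open>f\<close> along the curve that \<open>\<phi>\<close> makes of a
  coordinate line.\<close>

lemma partial_deriv_compose:
  assumes U: "openin (Euclidean_space n) U" and V: "openin (Euclidean_space n) V"
    and \<phi>V: "\<And>x. x \<in> U \<Longrightarrow> \<phi> x \<in> V" and x: "x \<in> U" and j: "j < n"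
    and f: "C_on n V 1 f" and \<phi>: "\<And>i. i < n \<Longrightarrow> (\<lambda>t. \<phi> (x(j := t)) i) differentiable (at (x j))"
  shows "((\<lambda>t. f (\<phi> (x(j := t)))) has_field_derivative
      (\<Sum>i<n. partial_deriv i f (\<phi> x) * partial_deriv j (\<lambda>x. \<phi> x i) x)) (at (x j))"
proof -
  have f1: "\<forall>z\<in>V. \<forall>i<n. (\<lambda>t. f (z(i := t))) differentiable (at (z i))"
    "\<forall>i<n. continuous_on V (partial_deriv i f)"
    using f unfolding One_nat_def C_on.simps by blast+
  have "((\<lambda>t. f (\<phi> (x(j := t)))) has_field_derivative
      (\<Sum>i<n. partial_deriv i f (\<phi> (x(j := x j))) * partial_deriv j (\<lambda>x. \<phi> x i) x)) (at (x j))"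
  proof (rule DERIV_along_curve[OF V])
    show "\<phi> (x(j := x j)) \<in> V" using \<phi>V x by simp
    show "\<forall>\<^sub>F s in nhds (x j). \<forall>i\<ge>n. \<phi> (x(j := s)) i = 0"
      using eventually_upd_in[OF U x j] by eventually_elim (use \<phi>V Euclidean_space_zero[OF V] in blast)
    show "((\<lambda>s. \<phi> (x(j := s)) i) has_field_derivative partial_deriv j (\<lambda>x. \<phi> x i) x) (at (x j))" if "i < n" for i
      using DERIV_partial_deriv[OF \<phi>[OF that]] .
  qed (fact f1)+
  then show ?thesis by simp
qed

lemma C_on_compose:
  assumes U: "openin (Euclidean_space n) U" and V: "openin (Euclidean_space n) V"
    and \<phi>V: "\<And>x. x \<in> U \<Longrightarrow> \<phi> x \<in> V"
    and "C_on n V k f" and "\<And>i. i < n \<Longrightarrow> C_on n U k (\<lambda>x. \<phi> x i)"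
  shows "C_on n U k (\<lambda>x. f (\<phi> x))"
  using assms(4,5)
proof (induction k arbitrary: f)
  case cont: 0
  have "continuous_on U (\<lambda>x. \<phi> x i)" for i
  proof (cases "i < n")
    case False
    then have "\<And>x. x \<in> U \<Longrightarrow> \<phi> x i = 0" using \<phi>V Euclidean_space_zero[OF V] by auto
    then show ?thesis by (simp cong: continuous_on_cong)
  qed (use cont in auto)
  then have "continuous_on U \<phi>" by (rule continuous_on_coordinatewise_then_product)
  then show ?case using cont \<phi>V by (auto intro: continuous_on_compose2[of V f U \<phi>])
next
  case (Suc k)
  have cont: "continuous_on U (\<lambda>x. f (\<phi> x))"
    using C_on_imp_continuous_on[OF Suc.IH] Suc.prems C_on_SucD by blast
  have 1: "C_on n V 1 f" using Suc.prems(1) by (auto dest: C_on_imp_continuous_on)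
  have D: "((\<lambda>t. f (\<phi> (x(j := t)))) has_field_derivative
      (\<Sum>i<n. partial_deriv i f (\<phi> x) * partial_deriv j (\<lambda>x. \<phi> x i) x)) (at (x j))"
    if "j < n" "x \<in> U" for j x
  proof (rule partial_deriv_compose[where f = f and \<phi> = \<phi>, OF U V \<phi>V that(2,1) 1])
    show "(\<lambda>t. \<phi> (x(j := t)) i) differentiable at (x j)" if "i < n" for i
      using Suc.prems(2)[OF that] \<open>j < n\<close> \<open>x \<in> U\<close> unfolding C_on.simps by blast
  qed
  have "C_on n U k (partial_deriv j (\<lambda>x. f (\<phi> x)))" if j: "j < n" for j
  proof (rule C_on_cong[OF U])
    show "C_on n U k (\<lambda>x. \<Sum>i<n. partial_deriv i f (\<phi> x) * partial_deriv j (\<lambda>x. \<phi> x i) x)"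
    proof (intro C_on_sum[OF U] C_on_mult[OF U])
      fix i assume i: "i \<in> {..<n}"
      show "C_on n U k (\<lambda>x. partial_deriv i f (\<phi> x))"
      proof (rule Suc.IH)
        show "C_on n V k (partial_deriv i f)" using Suc.prems i by auto
        show "C_on n U k (\<lambda>x. \<phi> x i)" if "i < n" for i
          using Suc.prems(2)[OF that] C_on_SucD by blast
      qed
      show "C_on n U k (partial_deriv j (\<lambda>x. \<phi> x i))"
        using Suc.prems(2)[of i] i j by auto
    qed
    show "(\<Sum>i<n. partial_deriv i f (\<phi> x) * partial_deriv j (\<lambda>x. \<phi> x i) x) =
        partial_deriv j (\<lambda>x. f (\<phi> x)) x" if "x \<in> U" for x
      by (rule partial_deriv_eqI[OF D[OF j that], symmetric])
  qed
  then show ?case using cont D by (auto simp: real_differentiable_def)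
qed

lemma smooth_on_Euclidean_partial_deriv:
  "smooth_on_Euclidean n U f \<Longrightarrow> i < n \<Longrightarrow> smooth_on_Euclidean n U (partial_deriv i f)"
  unfolding smooth_on_Euclidean_iff_C_on by (meson C_on.simps(2))

section \<open>Charts and smooth functions on a manifold\<close>

lemma compact_Pi_box:
  fixes S :: "'i \<Rightarrow> 'b::topological_space set"
  assumes "\<And>i. compact (S i)"
  shows "compact {x. \<forall>i. x i \<in> S i}"
proof -
  have "compactin (product_topology (\<lambda>i. euclidean) UNIV) (Pi\<^sub>E UNIV S)"
    unfolding compactin_PiE using assms by simp
  moreover have "Pi\<^sub>E UNIV S = {x. \<forall>i. x i \<in> S i}" by auto
  ultimately show ?thesis by (simp add: euclidean_product_topology)
qed

text \<open>Throughout, \<open>M\<close> is a smooth manifold; \<open>jac c d p\<close> below is the Jacobian matrix at \<open>p\<close> of the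
  transition from the chart \<open>c\<close> to the chart \<open>d\<close>.\<close>

locale smooth_mfd =
  fixes M :: "('a::t2_space) manifold"
  assumes smooth_M: "smooth_manifold M"
begin

definition jac :: "'a chart \<Rightarrow> 'a chart \<Rightarrow> 'a \<Rightarrow> nat \<Rightarrow> nat \<Rightarrow> real"
  where "jac c d p i j = partial_deriv j (\<lambda>x. snd d (chart_inv c x) i) (snd c p)"

lemma atlas_is_chart: "c \<in> atlas M \<Longrightarrow> is_chart (mdim M) c"
  using smooth_M by (simp add: smooth_manifold_def)

lemma chart_at: obtains c where "c \<in> atlas M" "p \<in> fst c"
proof -
  have "p \<in> \<Union>(fst ` atlas M)" using smooth_M by (simp add: smooth_manifold_def)
  then show thesis using that by auto
qed

lemma open_chart_dom: "c \<in> atlas M \<Longrightarrow> open (fst c)"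
  using atlas_is_chart by (simp add: is_chart_def)

lemma open_chart_image: "c \<in> atlas M \<Longrightarrow> openin (Euclidean_space (mdim M)) (snd c ` fst c)"
  using atlas_is_chart by (simp add: is_chart_def)

lemma chart_homeomorphism:
  "c \<in> atlas M \<Longrightarrow> homeomorphism (fst c) (snd c ` fst c) (snd c) (chart_inv c)"
  using atlas_is_chart by (simp add: is_chart_def)

lemma chart_inv_chart: "c \<in> atlas M \<Longrightarrow> p \<in> fst c \<Longrightarrow> chart_inv c (snd c p) = p"
  using homeomorphism_apply1[OF chart_homeomorphism] by blast

lemma chart_zero: "c \<in> atlas M \<Longrightarrow> p \<in> fst c \<Longrightarrow> i \<ge> mdim M \<Longrightarrow> snd c p i = 0"
  using Euclidean_space_zero[OF open_chart_image] by blast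

lemma open_image_chart:
  assumes c: "c \<in> atlas M" and W: "open W"
  shows "openin (Euclidean_space (mdim M)) (snd c ` (fst c \<inter> W))"
proof -
  have "openin (top_of_set (snd c ` fst c)) (snd c ` (fst c \<inter> W))"
    by (rule homeomorphism_imp_open_map[OF chart_homeomorphism[OF c]]) (use W in auto)
  then show ?thesis
    using open_chart_image[OF c] unfolding Euclidean_space_eq_top_of_set by (rule openin_trans)
qed

lemma transition_smooth:
  "c \<in> atlas M \<Longrightarrow> d \<in> atlas M \<Longrightarrow> i < mdim M \<Longrightarrow>
    smooth_on_Euclidean (mdim M) (snd c ` (fst c \<inter> fst d)) (\<lambda>x. snd d (chart_inv c x) i)"
  using smooth_M by (simp add: smooth_manifold_def smooth_transition_def)

lemma smooth_fun_on_cong: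
  assumes W: "open W" and fg: "\<And>p. p \<in> W \<Longrightarrow> f p = g p" and f: "smooth_fun_on M W f"
  shows "smooth_fun_on M W g"
  unfolding smooth_fun_on_def
proof
  fix c assume c: "c \<in> atlas M"
  show "smooth_on_Euclidean (mdim M) (snd c ` (fst c \<inter> W)) (\<lambda>x. g (chart_inv c x))"
  proof (rule smooth_on_Euclidean_cong[OF open_image_chart[OF c W]])
    show "smooth_on_Euclidean (mdim M) (snd c ` (fst c \<inter> W)) (\<lambda>x. f (chart_inv c x))"
      using f c by (simp add: smooth_fun_on_def)
    show "f (chart_inv c x) = g (chart_inv c x)" if "x \<in> snd c ` (fst c \<inter> W)" for x
      using that fg by (auto simp: chart_inv_chart[OF c])
  qed
qed

lemma smooth_fun_on_const: "smooth_fun_on M W (\<lambda>p. a)"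
  unfolding smooth_fun_on_def smooth_on_Euclidean_iff_C_on using C_on_const by blast

lemma smooth_fun_on_mult:
  assumes W: "open W" and f: "smooth_fun_on M W f" and g: "smooth_fun_on M W g"
  shows "smooth_fun_on M W (\<lambda>p. f p * g p)"
  using f g C_on_mult[OF open_image_chart[OF _ W]]
  unfolding smooth_fun_on_def smooth_on_Euclidean_iff_C_on by blast

lemma smooth_fun_on_prod:
  assumes W: "open W" and f: "\<And>k. k \<in> A \<Longrightarrow> smooth_fun_on M W (f k)"
  shows "smooth_fun_on M W (\<lambda>p. \<Prod>k\<in>A. f k p)"
  using f
  by (induction A rule: infinite_finite_induct) (auto intro: smooth_fun_on_mult[OF W] smooth_fun_on_const)

text \<open>Smoothness on the manifold is tested in every chart. A function given by a smooth expression in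
  one chart passes the test because in another chart it is precomposed with a smooth transition.\<close>

lemma smooth_fun_on_chart:
  assumes c: "c \<in> atlas M" and W: "open W" "W \<subseteq> fst c"
    and F: "smooth_on_Euclidean (mdim M) (snd c ` W) F"
  shows "smooth_fun_on M W (\<lambda>p. F (snd c p))"
  unfolding smooth_fun_on_def smooth_on_Euclidean_iff_C_on
proof (intro ballI allI)
  fix e k assume e: "e \<in> atlas M"
  have cW: "fst c \<inter> W = W" using W by auto
  show "C_on (mdim M) (snd e ` (fst e \<inter> W)) k (\<lambda>x. F (snd c (chart_inv e x)))"
  proof (rule C_on_compose[where f = F and \<phi> = "\<lambda>x. snd c (chart_inv e x)"])
    show "openin (Euclidean_space (mdim M)) (snd e ` (fst e \<inter> W))"
      by (rule open_image_chart[OF e W(1)])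
    show "openin (Euclidean_space (mdim M)) (snd c ` W)"
      using open_image_chart[OF c W(1)] by (simp add: cW)
    show "snd c (chart_inv e x) \<in> snd c ` W" if "x \<in> snd e ` (fst e \<inter> W)" for x
      using that by (auto simp: chart_inv_chart[OF e])
    show "C_on (mdim M) (snd c ` W) k F"
      using F smooth_imp_C_on by blast
    show "C_on (mdim M) (snd e ` (fst e \<inter> W)) k (\<lambda>x. snd c (chart_inv e x) i)" if "i < mdim M" for i
      by (rule C_on_subset[OF smooth_imp_C_on[OF transition_smooth[OF e c that]]]) (use W in auto)
  qed
qed

lemma smooth_fun_on_imp_continuous_on:
  assumes c: "c \<in> atlas M" and f: "smooth_fun_on M (fst c) f"
  shows "continuous_on (fst c) f"
proof -
  have "smooth_on_Euclidean (mdim M) (snd c ` fst c) (\<lambda>x. f (chart_inv c x))"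
    using f c by (force simp: smooth_fun_on_def)
  then have "continuous_on (snd c ` fst c) (\<lambda>x. f (chart_inv c x))"
    using smooth_imp_C_on C_on_imp_continuous_on by blast
  moreover have "continuous_on (fst c) (snd c)"
    using chart_homeomorphism[OF c] by (simp add: homeomorphism_def)
  ultimately have "continuous_on (fst c) (\<lambda>p. f (chart_inv c (snd c p)))"
    by (rule continuous_on_compose2) simp
  then show ?thesis by (simp add: chart_inv_chart[OF c] cong: continuous_on_cong)
qed

subsection \<open>Jacobians of chart transitions\<close>

lemma smooth_jac:
  assumes c: "c \<in> atlas M" and d: "d \<in> atlas M" and ij: "i < mdim M" "j < mdim M"
  shows "smooth_fun_on M (fst c \<inter> fst d) (\<lambda>p. jac c d p i j)"
  unfolding jac_def
proof (rule smooth_fun_on_chart[OF c, where F = "partial_deriv j (\<lambda>x. snd d (chart_inv c x) i)"])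
  show "open (fst c \<inter> fst d)" using open_chart_dom c d by blast
  show "smooth_on_Euclidean (mdim M) (snd c ` (fst c \<inter> fst d)) (partial_deriv j (\<lambda>x. snd d (chart_inv c x) i))"
    by (rule smooth_on_Euclidean_partial_deriv[OF transition_smooth[OF c d ij(1)] ij(2)])
qed (rule Int_lower1)

text \<open>The cocycle condition, by the chain rule. It says that coordinates prescribed in one chart
  transform consistently to all others, which is why the tangent spaces have full dimension.\<close>

lemma jac_trans:
  assumes c: "c \<in> atlas M" and d: "d \<in> atlas M" and e: "e \<in> atlas M"
    and p: "p \<in> fst c" "p \<in> fst d" "p \<in> fst e" and ij: "i < mdim M" "j < mdim M"
  shows "jac c e p i j = (\<Sum>k<mdim M. jac d e p i k * jac c d p k j)"
proof -
  let ?n = "mdim M"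
  define U where "U = snd c ` (fst c \<inter> (fst d \<inter> fst e))"
  define V where "V = snd d ` (fst d \<inter> fst e)"
  define \<phi> where "\<phi> = (\<lambda>x. snd d (chart_inv c x))"
  define f where "f = (\<lambda>y. snd e (chart_inv d y) i)"
  have U: "openin (Euclidean_space ?n) U" and V: "openin (Euclidean_space ?n) V"
    unfolding U_def V_def by (intro open_image_chart open_Int open_chart_dom c d e)+
  have x: "snd c p \<in> U" using p by (auto simp: U_def)
  have "((\<lambda>t. f (\<phi> ((snd c p)(j := t)))) has_field_derivative
      (\<Sum>k<?n. partial_deriv k f (\<phi> (snd c p)) * partial_deriv j (\<lambda>x. \<phi> x k) (snd c p))) (at (snd c p j))"
  proof (rule partial_deriv_compose[where f = f and \<phi> = \<phi>, OF U V _ x ij(2)])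
    show "\<phi> x \<in> V" if "x \<in> U" for x
      using that by (auto simp: \<phi>_def U_def V_def chart_inv_chart[OF c])
    show "C_on ?n V 1 f"
      unfolding f_def V_def by (rule smooth_imp_C_on[OF transition_smooth[OF d e ij(1)]])
    show "(\<lambda>t. \<phi> ((snd c p)(j := t)) k) differentiable at (snd c p j)" if "k < ?n" for k
    proof -
      have "C_on ?n (snd c ` (fst c \<inter> fst d)) 1 (\<lambda>x. \<phi> x k)"
        unfolding \<phi>_def by (rule smooth_imp_C_on[OF transition_smooth[OF c d that]])
      moreover have "snd c p \<in> snd c ` (fst c \<inter> fst d)" using p by auto
      ultimately show ?thesis unfolding One_nat_def C_on.simps using ij by blast
    qed
  qed
  from partial_deriv_eqI[where f = "\<lambda>x. f (\<phi> x)", OF this]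
  have "partial_deriv j (\<lambda>x. f (\<phi> x)) (snd c p) = (\<Sum>k<?n. jac d e p i k * jac c d p k j)"
    by (simp add: jac_def f_def \<phi>_def chart_inv_chart[OF c p(1)])
  moreover have "partial_deriv j (\<lambda>x. snd e (chart_inv c x) i) (snd c p) =
      partial_deriv j (\<lambda>x. f (\<phi> x)) (snd c p)"
    by (rule partial_deriv_cong[OF U x ij(2)])
       (auto simp: U_def f_def \<phi>_def chart_inv_chart[OF c] chart_inv_chart[OF d])
  ultimately show ?thesis by (simp add: jac_def)
qed

lemma jac_self:
  assumes c: "c \<in> atlas M" and p: "p \<in> fst c" and ij: "i < mdim M" "j < mdim M"
  shows "jac c c p i j = (if i = j then 1 else 0)"
proof -
  have "partial_deriv j (\<lambda>x. snd c (chart_inv c x) i) (snd c p) = partial_deriv j (\<lambda>x. x i) (snd c p)"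
    by (rule partial_deriv_cong[OF open_chart_image[OF c] _ ij(2)])
       (use p in \<open>auto simp: chart_inv_chart[OF c]\<close>)
  then show ?thesis by (auto simp: jac_def partial_deriv_def)
qed

subsection \<open>Covering compact sets by compact pieces of charts\<close>

lemma compact_chart_neighbourhood:
  obtains c L N where "c \<in> atlas M" "compact L" "L \<subseteq> fst c" "open N" "q \<in> N" "N \<subseteq> L"
proof -
  let ?n = "mdim M"
  obtain c where c: "c \<in> atlas M" "q \<in> fst c" by (rule chart_at)
  obtain \<delta> where \<delta>: "\<delta> > 0"
    "\<And>y. (\<And>i. i < ?n \<Longrightarrow> \<bar>y i - snd c q i\<bar> \<le> \<delta>) \<Longrightarrow> (\<And>i. i \<ge> ?n \<Longrightarrow> y i = 0) \<Longrightarrow> y \<in> snd c ` fst c"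
    using Euclidean_space_box[OF open_chart_image[OF c(1)]] c(2) by blast
  define B where "B = {x. \<forall>i. x i \<in> (if i < ?n then {snd c q i - \<delta>..snd c q i + \<delta>} else {0})}"
  have "compact B" unfolding B_def by (rule compact_Pi_box) auto
  have B: "B \<subseteq> snd c ` fst c"
  proof
    fix x assume "x \<in> B"
    then have x: "x i \<in> (if i < ?n then {snd c q i - \<delta>..snd c q i + \<delta>} else {0})" for i
      by (simp add: B_def)
    show "x \<in> snd c ` fst c"
    proof (rule \<delta>(2))
      show "\<bar>x i - snd c q i\<bar> \<le> \<delta>" if "i < ?n" for i
        using x[of i] that by (simp add: abs_le_iff)
      show "x i = 0" if "i \<ge> ?n" for i
        using x[of i] that by simp
    qed
  qed
  define L where "L = chart_inv c ` B"
  define N where "N = fst c \<inter> (\<Inter>i\<in>{..<?n}. fst c \<inter> (\<lambda>p. snd c p i) -` {snd c q i - \<delta><..<snd c q i + \<delta>})"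
  have cont: "continuous_on (fst c) (snd c)" "continuous_on (snd c ` fst c) (chart_inv c)"
    using chart_homeomorphism[OF c(1)] by (simp_all add: homeomorphism_def)
  show thesis
  proof
    show "c \<in> atlas M" by fact
    show "compact L" unfolding L_def
      by (rule compact_continuous_image[OF continuous_on_subset[OF cont(2) B] \<open>compact B\<close>])
    show "L \<subseteq> fst c" using B by (auto simp: L_def chart_inv_chart[OF c(1)])
    show "open N" unfolding N_def
    proof (rule open_Int[OF open_chart_dom[OF c(1)]], rule open_INT[OF finite_lessThan], rule ballI)
      fix i
      have "continuous_on (fst c) (\<lambda>p. snd c p i)"
        using cont(1) by (rule continuous_on_product_then_coordinatewise)
      then show "open (fst c \<inter> (\<lambda>p. snd c p i) -` {snd c q i - \<delta><..<snd c q i + \<delta>})"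
        by (rule continuous_open_preimage) (auto intro: open_chart_dom c)
    qed
    show "q \<in> N" using c \<delta>(1) by (auto simp: N_def)
    show "N \<subseteq> L"
    proof
      fix p assume p: "p \<in> N"
      then have "p \<in> fst c" by (auto simp: N_def)
      moreover have "snd c p i \<in> (if i < ?n then {snd c q i - \<delta>..snd c q i + \<delta>} else {0})" for i
      proof (cases "i < ?n")
        case True
        then have "snd c p i \<in> {snd c q i - \<delta><..<snd c q i + \<delta>}"
          using p unfolding N_def by blast
        then show ?thesis using True by simp
      qed (simp add: chart_zero[OF c(1) \<open>p \<in> fst c\<close>])
      then have "snd c p \<in> B" by (simp add: B_def)
      ultimately show "p \<in> L"
        unfolding L_def by (metis chart_inv_chart[OF c(1)] imageI)
    qed
  qed
qed

text \<open>This reduces every estimate along a net of points that stays in a compact set to finitely many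
  estimates, each in a single chart.\<close>

lemma compact_chart_cover:
  assumes K: "compact K"
  obtains F where "finite F" "K \<subseteq> \<Union>(snd ` F)"
    "\<And>c L. (c, L) \<in> F \<Longrightarrow> c \<in> atlas M \<and> compact L \<and> L \<subseteq> fst c"
proof -
  have "\<forall>q. \<exists>c L N. c \<in> atlas M \<and> compact L \<and> L \<subseteq> fst c \<and> open N \<and> q \<in> N \<and> N \<subseteq> L"
    using compact_chart_neighbourhood by metis
  then obtain c L N where *: "\<And>q. c q \<in> atlas M \<and> compact (L q) \<and> L q \<subseteq> fst (c q) \<and>
      open (N q) \<and> q \<in> N q \<and> N q \<subseteq> L q"
    by metis
  obtain D where D: "D \<subseteq> K" "finite D" "K \<subseteq> (\<Union>q\<in>D. N q)"
    by (rule compactE_image[OF K, of K N]) (use * in auto)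
  show thesis
  proof
    show "finite ((\<lambda>q. (c q, L q)) ` D)" using D by simp
    show "K \<subseteq> \<Union>(snd ` (\<lambda>q. (c q, L q)) ` D)" 
    proof
      fix x assume "x \<in> K"
      then obtain q where "q \<in> D" "x \<in> N q" using D(3) by blast
      moreover have "N q \<subseteq> L q" using * by blast
      ultimately show "x \<in> \<Union>(snd ` (\<lambda>q. (c q, L q)) ` D)" by auto
    qed
      show "c' \<in> atlas M \<and> compact L' \<and> L' \<subseteq> fst c'"
      if cL: "(c', L') \<in> (\<lambda>q. (c q, L q)) ` D" for c' L'
    proof -
      obtain q where "c' = c q" "L' = L q" using cL by blast
      then show ?thesis using * by blast
    qed
  qed
qed

end

section \<open>Vector bundles and fibre metrics over compact sets\<close>

lemma linear_on_subspace_sum: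
  fixes f :: "'v::real_vector \<Rightarrow> 'w::real_vector"
  assumes V: "subspace V"
    and f: "\<forall>v\<in>V. \<forall>w\<in>V. \<forall>a b. f (a *\<^sub>R v + b *\<^sub>R w) = a *\<^sub>R f v + b *\<^sub>R f w"
    and v: "\<And>i. i \<in> A \<Longrightarrow> v i \<in> V"
  shows "f (\<Sum>i\<in>A. x i *\<^sub>R v i) = (\<Sum>i\<in>A. x i *\<^sub>R f (v i))"
  using v
proof (induction A rule: infinite_finite_induct)
  case (insert i A)
  have "(\<Sum>i\<in>A. x i *\<^sub>R v i) \<in> V"
    using insert V by (intro subspace_sum subspace_scale) auto
  then have "f (x i *\<^sub>R v i + 1 *\<^sub>R (\<Sum>i\<in>A. x i *\<^sub>R v i)) = x i *\<^sub>R f (v i) + 1 *\<^sub>R f (\<Sum>i\<in>A. x i *\<^sub>R v i)"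
    using f insert by blast
  then show ?case using insert by simp
next
  case empty
  have "0 \<in> V" using V by (rule subspace_0)
  then have "f (0 *\<^sub>R 0 + 0 *\<^sub>R 0) = 0 *\<^sub>R f 0 + 0 *\<^sub>R f 0" using f by blast
  then show ?case by simp
next
  case (infinite A)
  have "0 \<in> V" using V by (rule subspace_0)
  then have "f (0 *\<^sub>R 0 + 0 *\<^sub>R 0) = 0 *\<^sub>R f 0 + 0 *\<^sub>R f 0" using f by blast
  then show ?case using infinite by simp
qed

lemma unit_vec_in_typical_fibre: "j \<in> J \<Longrightarrow> unit_vec j \<in> typical_fibre J"
  by (auto simp: unit_vec_def typical_fibre_def)

lemma typical_fibre_expand:
  assumes "finite J" "x \<in> typical_fibre J"
  shows "(\<Sum>j\<in>J. x j *\<^sub>R unit_vec j) = x"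
proof
  fix k
  have "(\<Sum>j\<in>J. x j *\<^sub>R unit_vec j) k = (\<Sum>j\<in>J. (x j *\<^sub>R unit_vec j) k)"
    using assms(1) by (induction J rule: finite_induct) auto
  also have "\<dots> = (\<Sum>j\<in>J. if j = k then x j else 0)"
    by (rule sum.cong) (auto simp: scaleR_fun_def unit_vec_def)
  also have "\<dots> = x k" using assms by (auto simp: typical_fibre_def)
  finally show "(\<Sum>j\<in>J. x j *\<^sub>R unit_vec j) k = x k" .
qed

text \<open>The compactness behind the uniform bounds for fibre metrics. The sphere lives in the space of
  all families, with possibly infinitely many indices outside \<open>J\<close>, and is a closed subset of a
  product of intervals and points.\<close>

lemma compact_unit_sphere:
  assumes J: "finite J"
  shows "compact {x \<in> typical_fibre J. (\<Sum>j\<in>J. (x j)\<^sup>2) = (1::real)}"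
proof -
  define B where "B = {x. \<forall>j. x j \<in> (if j \<in> J then {-1..1::real} else {0})}"
  have "compact B" unfolding B_def by (rule compact_Pi_box) auto
  moreover have "closed {x::'a \<Rightarrow> real. (\<Sum>j\<in>J. (x j)\<^sup>2) = 1}"
    by (rule closed_Collect_eq) (auto intro!: continuous_intros)
  ultimately have "compact (B \<inter> {x. (\<Sum>j\<in>J. (x j)\<^sup>2) = 1})"
    by (rule compact_Int_closed)
  moreover have "B \<inter> {x. (\<Sum>j\<in>J. (x j)\<^sup>2) = 1} = {x \<in> typical_fibre J. (\<Sum>j\<in>J. (x j)\<^sup>2) = 1}"
  proof (intro equalityI subsetI)
    fix x assume x: "x \<in> {x \<in> typical_fibre J. (\<Sum>j\<in>J. (x j)\<^sup>2) = 1}"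
    have "x j \<in> (if j \<in> J then {-1..1} else {0})" for j
    proof (cases "j \<in> J")
      case True
      have "(x j)\<^sup>2 \<le> (\<Sum>j\<in>J. (x j)\<^sup>2)" by (rule member_le_sum[OF True]) (use J in auto)
      then have "\<bar>x j\<bar> \<le> 1" using x by (simp add: abs_square_le_1)
      then show ?thesis using True by (simp add: abs_le_iff)
    qed (use x in \<open>simp add: typical_fibre_def\<close>)
    then show "x \<in> B \<inter> {x. (\<Sum>j\<in>J. (x j)\<^sup>2) = 1}" using x by (simp add: B_def)
  next
    fix x assume x: "x \<in> B \<inter> {x. (\<Sum>j\<in>J. (x j)\<^sup>2) = 1}"
    have "x j = 0" if "j \<notin> J" for j
      using x that by (auto simp: B_def dest: spec[of _ j])
    then show "x \<in> {x \<in> typical_fibre J. (\<Sum>j\<in>J. (x j)\<^sup>2) = 1}"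
      using x by (simp add: typical_fibre_def)
  qed
  ultimately show ?thesis by simp
qed

text \<open>The properties of a bundle that enter the estimates. The last one has content: the vector bundle
  charts are those compatible with all of the given atlas, so that one exists over each chart of
  the base expresses the smoothness of the transition matrices.\<close>

locale smooth_vb = smooth_mfd M
  for M :: "('a::t2_space) manifold" +
  fixes E :: "('a, 'f::real_vector, 'j) vbundle"
  assumes subspace_fibre: "subspace (fibre E p)"
    and finite_frame_index: "finite (frame_index E)"
    and vb_chart_over: "c \<in> atlas M \<Longrightarrow> \<exists>\<Psi>. (c, \<Psi>) \<in> vb_charts M E"
begin

context
  fixes c \<Psi> assumes C: "(c, \<Psi>) \<in> vb_charts M E"
begin

lemma vb_chart_atlas: "c \<in> atlas M"
  using C by (simp add: vb_charts_def vb_trivialization_def)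

lemma vb_chart_bij: "p \<in> fst c \<Longrightarrow> bij_betw (\<Psi> p) (fibre E p) (typical_fibre (frame_index E))"
  using C by (simp add: vb_charts_def vb_trivialization_def)

lemma vb_chart_linear: "p \<in> fst c \<Longrightarrow>
    \<forall>v\<in>fibre E p. \<forall>w\<in>fibre E p. \<forall>a b. \<Psi> p (a *\<^sub>R v + b *\<^sub>R w) = a *\<^sub>R \<Psi> p v + b *\<^sub>R \<Psi> p w"
  using C unfolding vb_charts_def vb_trivialization_def by blast

lemma vb_chart_in: "p \<in> fst c \<Longrightarrow> v \<in> fibre E p \<Longrightarrow> \<Psi> p v \<in> typical_fibre (frame_index E)"
  using vb_chart_bij by (auto dest: bij_betwE)

lemma vb_chart_0: "p \<in> fst c \<Longrightarrow> \<Psi> p 0 = 0"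
  using linear_on_subspace_sum[OF subspace_fibre vb_chart_linear, where A = "{}"] by simp

lemma vb_chart_eq_0D: "p \<in> fst c \<Longrightarrow> v \<in> fibre E p \<Longrightarrow> \<Psi> p v = 0 \<Longrightarrow> v = 0"
  using vb_chart_bij[of p] vb_chart_0[of p] subspace_0[OF subspace_fibre[of p]]
  by (metis bij_betw_imp_inj_on inj_onD)

lemma vb_frame_in:
  assumes "p \<in> fst c" "j \<in> frame_index E"
  shows "vb_frame E \<Psi> p j \<in> fibre E p" "\<Psi> p (vb_frame E \<Psi> p j) = unit_vec j"
proof -
  have "unit_vec j \<in> \<Psi> p ` fibre E p"
    using vb_chart_bij[OF assms(1)] unit_vec_in_typical_fibre[OF assms(2)] by (auto simp: bij_betw_def)
  then show "vb_frame E \<Psi> p j \<in> fibre E p" "\<Psi> p (vb_frame E \<Psi> p j) = unit_vec j"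
    unfolding vb_frame_def by (rule inv_into_into, rule f_inv_into_f)
qed

lemma vb_frame_sum:
  assumes p: "p \<in> fst c" and x: "x \<in> typical_fibre (frame_index E)"
  shows "(\<Sum>j\<in>frame_index E. x j *\<^sub>R vb_frame E \<Psi> p j) \<in> fibre E p"
    "\<Psi> p (\<Sum>j\<in>frame_index E. x j *\<^sub>R vb_frame E \<Psi> p j) = x"
proof -
  show "(\<Sum>j\<in>frame_index E. x j *\<^sub>R vb_frame E \<Psi> p j) \<in> fibre E p"
    using vb_frame_in[OF p] by (intro subspace_sum subspace_scale subspace_fibre) auto
  have "\<Psi> p (\<Sum>j\<in>frame_index E. x j *\<^sub>R vb_frame E \<Psi> p j) = (\<Sum>j\<in>frame_index E. x j *\<^sub>R unit_vec j)"
    by (subst linear_on_subspace_sum[OF subspace_fibre vb_chart_linear[OF p]])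
       (auto simp: vb_frame_in[OF p])
  then show "\<Psi> p (\<Sum>j\<in>frame_index E. x j *\<^sub>R vb_frame E \<Psi> p j) = x"
    by (simp add: typical_fibre_expand[OF finite_frame_index x])
qed

lemma vb_frame_expand:
  assumes p: "p \<in> fst c" and v: "v \<in> fibre E p"
  shows "v = (\<Sum>j\<in>frame_index E. \<Psi> p v j *\<^sub>R vb_frame E \<Psi> p j)"
  using vb_frame_sum[OF p vb_chart_in[OF p v]] vb_chart_bij[OF p] v
  by (metis bij_betw_imp_inj_on inj_onD)

end

subsection \<open>Fibre metrics\<close>

context
  fixes h assumes h: "fibre_metric M E h"
begin

lemma metric_linear: "w \<in> fibre E p \<Longrightarrow>
    \<forall>u\<in>fibre E p. \<forall>v\<in>fibre E p. \<forall>a b. h p (a *\<^sub>R u + b *\<^sub>R v) w = a *\<^sub>R h p u w + b *\<^sub>R h p v w"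
  using h unfolding fibre_metric_def real_scaleR_def by blast

lemma metric_sym: "u \<in> fibre E p \<Longrightarrow> v \<in> fibre E p \<Longrightarrow> h p u v = h p v u"
  using h unfolding fibre_metric_def by blast

lemma metric_pos: "v \<in> fibre E p \<Longrightarrow> v \<noteq> 0 \<Longrightarrow> h p v v > 0"
  using h unfolding fibre_metric_def by blast

lemma metric_0: "h p 0 0 = 0"
  using linear_on_subspace_sum[OF subspace_fibre metric_linear[of 0 p], where A = "{}"]
    subspace_0[OF subspace_fibre[of p]] by simp

lemma metric_nonneg: "v \<in> fibre E p \<Longrightarrow> h p v v \<ge> 0"
  using metric_pos metric_0 by (cases "v = 0") (auto intro: less_imp_le)

lemma fibre_norm_0: "fibre_norm h p 0 = 0"
  by (simp add: fibre_norm_def metric_0)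

lemma fibre_norm_nonneg: "v \<in> fibre E p \<Longrightarrow> fibre_norm h p v \<ge> 0"
  by (simp add: fibre_norm_def metric_nonneg)

text \<open>A quasi-triangle inequality, from the parallelogram law; the factor is harmless for
  asymptotic estimates.\<close>

lemma fibre_norm_add_le:
  assumes u: "u \<in> fibre E p" and v: "v \<in> fibre E p"
  shows "fibre_norm h p (u + v) \<le> 2 * (fibre_norm h p u + fibre_norm h p v)"
proof -
  have lin: "h p (a *\<^sub>R u + b *\<^sub>R v) w = a * h p u w + b * h p v w" if "w \<in> fibre E p" for a b w
    using metric_linear[OF that] u v by simp
  have in_E: "a *\<^sub>R u + b *\<^sub>R v \<in> fibre E p" for a b
    using u v subspace_fibre[of p] by (intro subspace_add subspace_scale)
  have sq: "h p (a *\<^sub>R u + b *\<^sub>R v) (a *\<^sub>R u + b *\<^sub>R v) = a * a * h p u u + 2 * a * b * h p u v + b * b * h p v v" for a b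
    using lin[OF in_E, of a b a b] metric_sym[OF u in_E] metric_sym[OF v in_E] lin[OF u] lin[OF v] metric_sym[OF u v]
    by (simp add: algebra_simps)
  have "h p (u + v) (u + v) \<le> 2 * h p u u + 2 * h p v v"
    using sq[of 1 1] sq[of 1 "-1"] metric_nonneg[OF in_E[of 1 "-1"]] by simp
  also have "\<dots> = 2 * (fibre_norm h p u)\<^sup>2 + 2 * (fibre_norm h p v)\<^sup>2"
    by (simp add: fibre_norm_def metric_nonneg u v)
  also have "\<dots> \<le> (2 * (fibre_norm h p u + fibre_norm h p v))\<^sup>2"
    using fibre_norm_nonneg[OF u] fibre_norm_nonneg[OF v] by (simp add: power2_eq_square algebra_simps)
  finally show ?thesis
    unfolding fibre_norm_def[of h p "u + v"]
    using fibre_norm_nonneg[OF u] fibre_norm_nonneg[OF v] by (intro real_le_lsqrt) auto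
qed

text \<open>Over a compact piece of a chart a fibre metric is a continuous family of positive definite
  forms, so on the compact product with the unit sphere it is bounded away from \<open>0\<close> and
  \<open>\<infinity>\<close>; homogeneity extends the bounds to all vectors.\<close>

lemma fibre_norm_chart_bounds:
  assumes C: "(c, \<Psi>) \<in> vb_charts M E" and L: "compact L" "L \<subseteq> fst c"
  obtains a b where "a > 0" "b > 0"
    "\<And>q v. q \<in> L \<Longrightarrow> v \<in> fibre E q \<Longrightarrow> L2_set (\<Psi> q v) (frame_index E) \<le> a * fibre_norm h q v"
    "\<And>q v. q \<in> L \<Longrightarrow> v \<in> fibre E q \<Longrightarrow> fibre_norm h q v \<le> b * L2_set (\<Psi> q v) (frame_index E)"
proof -
  define J where "J = frame_index E"
  define e where "e = vb_frame E \<Psi>"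
  define S where "S = {x \<in> typical_fibre J. (\<Sum>j\<in>J. (x j)\<^sup>2) = (1::real)}"
  define Q where "Q z = (\<Sum>i\<in>J. \<Sum>j\<in>J. snd z i * snd z j * h (fst z) (e (fst z) i) (e (fst z) j))" for z
  have fin: "finite J" by (simp add: J_def finite_frame_index)
  have Q_eq: "h q v v = Q (q, \<Psi> q v)" if q: "q \<in> fst c" and v: "v \<in> fibre E q" for q v
  proof -
    have e_in: "e q j \<in> fibre E q" if "j \<in> J" for j
      using vb_frame_in[OF C q] that by (simp add: e_def J_def)
    have ex: "h q v w = (\<Sum>i\<in>J. \<Psi> q v i * h q (e q i) w)" if w: "w \<in> fibre E q" for w
    proof -
      have "h q v w = h q (\<Sum>i\<in>J. \<Psi> q v i *\<^sub>R e q i) w"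
        using vb_frame_expand[OF C q v] by (simp add: J_def e_def)
      then show ?thesis
        using linear_on_subspace_sum[OF subspace_fibre metric_linear[OF w], of J "e q" "\<Psi> q v"] e_in by simp
    qed
    have "h q (e q i) v = (\<Sum>j\<in>J. \<Psi> q v j * h q (e q i) (e q j))" if "i \<in> J" for i
      using ex[OF e_in[OF that]] metric_sym[OF v e_in[OF that]] metric_sym[OF e_in[OF that] e_in] by simp
    then show ?thesis using ex[OF v] by (simp add: Q_def sum_distrib_left mult.assoc)
  qed
  have cont_Q: "continuous_on (L \<times> S) Q"
    unfolding Q_def
  proof (intro continuous_on_sum continuous_on_mult)
    fix i j assume ij: "i \<in> J" "j \<in> J"
    have "\<forall>(c, \<Psi>)\<in>vb_charts M E. \<forall>i\<in>frame_index E. \<forall>j\<in>frame_index E.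
       smooth_fun_on M (fst c) (\<lambda>p. h p (vb_frame E \<Psi> p i) (vb_frame E \<Psi> p j))"
      using h by (simp add: fibre_metric_def)
    then have "smooth_fun_on M (fst c) (\<lambda>q. h q (e q i) (e q j))"
      using C ij unfolding e_def J_def by fast
    then have "continuous_on L (\<lambda>q. h q (e q i) (e q j))"
      using smooth_fun_on_imp_continuous_on[OF vb_chart_atlas[OF C]] continuous_on_subset[OF _ L(2)] by blast
    then show "continuous_on (L \<times> S) (\<lambda>z. h (fst z) (e (fst z) i) (e (fst z) j))"
      by (rule continuous_on_compose2[OF _ continuous_on_fst]) (auto intro: continuous_on_id)
    have "continuous_on (L \<times> S) (\<lambda>z. snd z)" by (intro continuous_on_snd continuous_on_id)
    then show "continuous_on (L \<times> S) (\<lambda>z. snd z i)" "continuous_on (L \<times> S) (\<lambda>z. snd z j)"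
      by (rule continuous_on_product_then_coordinatewise)+
  qed
  have compact_LS: "compact (L \<times> S)"
    unfolding S_def by (intro compact_Times L compact_unit_sphere fin)
  have Q_pos: "Q z > 0" if z: "z \<in> L \<times> S" for z
  proof -
    obtain q x where qx: "z = (q, x)" "q \<in> fst c" "x \<in> S" using z L by auto
    define w where "w = (\<Sum>j\<in>J. x j *\<^sub>R e q j)"
    have w: "w \<in> fibre E q" "\<Psi> q w = x"
      using vb_frame_sum[OF C qx(2), of x] qx(3) by (auto simp: w_def e_def J_def S_def)
    have "x \<noteq> 0" using qx(3) by (auto simp: S_def)
    then have "w \<noteq> 0" using w(2) vb_chart_0[OF C qx(2)] by auto
    then show ?thesis using metric_pos[OF w(1)] Q_eq[OF qx(2) w(1)] w(2) qx(1) by simp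
  qed
  obtain m B where mB: "m > 0" "B > 0" "\<And>z. z \<in> L \<times> S \<Longrightarrow> m \<le> Q z \<and> Q z \<le> B"
  proof (cases "L \<times> S = {}")
    case True
    \<comment> \<open>There is no point or no unit vector to bound, so any constants do.\<close>
    then show ?thesis using that[of 1 1] by auto
  next
    case False
    obtain z0 where z0: "z0 \<in> L \<times> S" "\<forall>z\<in>L \<times> S. Q z0 \<le> Q z"
      using continuous_attains_inf[OF compact_LS False cont_Q] by (elim bexE) (rule that)
    obtain z1 where z1: "z1 \<in> L \<times> S" "\<forall>z\<in>L \<times> S. Q z \<le> Q z1"
      using continuous_attains_sup[OF compact_LS False cont_Q] by (elim bexE) (rule that)
    show ?thesis
      by (rule that[of "Q z0" "Q z1"]) (use z0(2) z1(2) in \<open>auto intro: Q_pos[OF z0(1)] Q_pos[OF z1(1)]\<close>)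
  qed
  have main: "m * (L2_set (\<Psi> q v) J)\<^sup>2 \<le> h q v v \<and> h q v v \<le> B * (L2_set (\<Psi> q v) J)\<^sup>2"
    if q: "q \<in> L" and v: "v \<in> fibre E q" for q v
  proof (cases "v = 0")
    case True
    have "q \<in> fst c" using q L by auto
    then show ?thesis using True by (simp add: metric_0 vb_chart_0[OF C] L2_set_def)
  next
    case False
    have qc: "q \<in> fst c" using q L by auto
    define x where "x = \<Psi> q v"
    define \<rho> where "\<rho> = L2_set x J"
    have x: "x \<in> typical_fibre J" using vb_chart_in[OF C qc v] by (simp add: x_def J_def)
    have "x \<noteq> 0" using vb_chart_eq_0D[OF C qc v] False by (auto simp: x_def)
    then obtain j where "x j \<noteq> 0" by (auto simp: fun_eq_iff)
    then have "j \<in> J" using x by (auto simp: typical_fibre_def)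
    have "\<rho> \<noteq> 0" using L2_set_eq_0_iff[OF fin, of x] \<open>x j \<noteq> 0\<close> \<open>j \<in> J\<close> by (auto simp: \<rho>_def)
    then have \<rho>: "\<rho> > 0" by (simp add: \<rho>_def less_le)
    have \<rho>2: "\<rho>\<^sup>2 = (\<Sum>j\<in>J. (x j)\<^sup>2)" by (simp add: \<rho>_def L2_set_def sum_nonneg)
    have "(\<Sum>j\<in>J. (x j / \<rho>)\<^sup>2) = 1"
      using \<rho> by (simp add: power_divide \<rho>2[symmetric] sum_divide_distrib[symmetric])
    then have "(\<lambda>j. x j / \<rho>) \<in> S" using x by (auto simp: S_def typical_fibre_def)
    then have bd: "m \<le> Q (q, \<lambda>j. x j / \<rho>) \<and> Q (q, \<lambda>j. x j / \<rho>) \<le> B" using mB(3) q by blast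
    have "Q (q, \<lambda>j. x j / \<rho>) = h q v v / \<rho>\<^sup>2"
      unfolding Q_eq[OF qc v] x_def[symmetric]
      by (simp add: Q_def sum_divide_distrib power2_eq_square)
    then have "m \<le> h q v v / \<rho>\<^sup>2" "h q v v / \<rho>\<^sup>2 \<le> B" using bd by auto
    then show ?thesis using \<rho> by (simp add: x_def[symmetric] \<rho>_def[symmetric] field_simps)
  qed
  show thesis
  proof
    show "1 / sqrt m > 0" "sqrt B > 0" using mB by auto
    fix q v assume qv: "q \<in> L" "v \<in> fibre E q"
    have "sqrt (m * (L2_set (\<Psi> q v) J)\<^sup>2) \<le> sqrt (h q v v)" "sqrt (h q v v) \<le> sqrt (B * (L2_set (\<Psi> q v) J)\<^sup>2)"
      using main[OF qv] by auto
    then show "L2_set (\<Psi> q v) (frame_index E) \<le> 1 / sqrt m * fibre_norm h q v"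
      "fibre_norm h q v \<le> sqrt B * L2_set (\<Psi> q v) (frame_index E)"
      using mB(1) by (simp_all add: real_sqrt_mult fibre_norm_def J_def field_simps)
  qed
qed

end

text \<open>On each piece of a finite cover both norms are comparable with the Euclidean norm of the
  components in one vector bundle chart.\<close>

lemma fibre_norms_comparable:
  assumes h: "fibre_metric M E h" "fibre_metric M E h'" and K: "compact K"
  shows "\<exists>C>0. \<forall>q\<in>K. \<forall>v\<in>fibre E q. fibre_norm h q v \<le> C * fibre_norm h' q v"
proof -
  obtain F where F: "finite F" "K \<subseteq> \<Union>(snd ` F)"
    "\<And>c L. (c, L) \<in> F \<Longrightarrow> c \<in> atlas M \<and> compact L \<and> L \<subseteq> fst c"
    using compact_chart_cover[OF K] by blast
  have "\<exists>C>0. \<forall>q\<in>snd z. \<forall>v\<in>fibre E q. fibre_norm h q v \<le> C * fibre_norm h' q v" if z: "z \<in> F" for z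
  proof -
    obtain c L where cL: "z = (c, L)" "c \<in> atlas M" "compact L" "L \<subseteq> fst c"
      using F(3) z by (metis prod.collapse)
    obtain \<Psi> where \<Psi>: "(c, \<Psi>) \<in> vb_charts M E" using vb_chart_over cL by blast
    obtain b where b: "b > 0" "\<And>q v. q \<in> L \<Longrightarrow> v \<in> fibre E q \<Longrightarrow> fibre_norm h q v \<le> b * L2_set (\<Psi> q v) (frame_index E)"
      using fibre_norm_chart_bounds[OF h(1) \<Psi> cL(3,4)] by metis
    obtain a where a: "a > 0" "\<And>q v. q \<in> L \<Longrightarrow> v \<in> fibre E q \<Longrightarrow> L2_set (\<Psi> q v) (frame_index E) \<le> a * fibre_norm h' q v"
      using fibre_norm_chart_bounds[OF h(2) \<Psi> cL(3,4)] by metis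
    have "fibre_norm h q v \<le> (b * a) * fibre_norm h' q v" if "q \<in> L" "v \<in> fibre E q" for q v
      using order_trans[OF b(2)[OF that] mult_left_mono[OF a(2)[OF that], of b]] b(1) by (simp add: mult.assoc)
    then show ?thesis using a(1) b(1) cL(1) by (intro exI[of _ "b * a"]) auto
  qed
  then obtain C where C: "\<And>z. z \<in> F \<Longrightarrow> C z > 0"
    "\<And>z q v. z \<in> F \<Longrightarrow> q \<in> snd z \<Longrightarrow> v \<in> fibre E q \<Longrightarrow> fibre_norm h q v \<le> C z * fibre_norm h' q v"
    by metis
  \<comment> \<open>The sum dominates each \<open>C z\<close>; the summand \<open>1\<close> keeps the constant positive if \<open>F\<close> is empty.\<close>
  show ?thesis
  proof (intro exI[of _ "1 + sum C F"] conjI ballI)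
    show "1 + sum C F > 0" using C(1) by (intro add_pos_nonneg sum_nonneg) (auto intro: less_imp_le)
    fix q v assume q: "q \<in> K" and v: "v \<in> fibre E q"
    then obtain z where z: "z \<in> F" "q \<in> snd z" using F(2) by auto
    have "C z \<le> sum C F" using C(1) F(1) z(1) by (intro member_le_sum) (auto intro: less_imp_le)
    then have "C z * fibre_norm h' q v \<le> (1 + sum C F) * fibre_norm h' q v"
      using fibre_norm_nonneg[OF h(2) v] by (intro mult_right_mono) auto
    then show "fibre_norm h q v \<le> (1 + sum C F) * fibre_norm h' q v"
      using C(2)[OF z v] by simp
  qed
qed

subsection \<open>Representatives of generalized sections\<close>

text \<open>Moderateness speaks of all differential operators; the order \<open>0\<close> part, which is all that a
  point value sees, is obtained from the identity.\<close>

lemma id_vb_diff_op: "(\<lambda>s. s) \<in> vb_diff_ops M E"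
proof -
  have "\<exists>a. (\<forall>\<alpha>. \<forall>i\<in>frame_index E. \<forall>j\<in>frame_index E. smooth_fun_on M (fst c) (a \<alpha> i j)) \<and>
       (\<forall>s\<in>smooth_sections M E. \<forall>p\<in>fst c. \<forall>i\<in>frame_index E.
          \<Psi> p (s p) i =
            (\<Sum>\<alpha>\<in>index_lists (mdim M) 0. \<Sum>j\<in>frame_index E.
               a \<alpha> i j p *
               partial_derivs \<alpha> (\<lambda>x. \<Psi> (chart_inv c x) (s (chart_inv c x)) j) (snd c p)))"
    if C: "(c, \<Psi>) \<in> vb_charts M E" for c \<Psi>
  proof (intro exI[of _ "\<lambda>\<alpha> i j p. if i = j then 1 else 0"] conjI allI ballI)
    show "smooth_fun_on M (fst c) (\<lambda>p. if i = j then 1 else 0)" for i j :: 'j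
      by (rule smooth_fun_on_const)
    have "index_lists (mdim M) 0 = {[]}" by (auto simp: index_lists_def)
    then show "\<Psi> p (s p) i = (\<Sum>\<alpha>\<in>index_lists (mdim M) 0. \<Sum>j\<in>frame_index E.
               (if i = j then 1 else 0) *
               partial_derivs \<alpha> (\<lambda>x. \<Psi> (chart_inv c x) (s (chart_inv c x)) j) (snd c p))"
      if "p \<in> fst c" "i \<in> frame_index E" for s p i
      using that finite_frame_index
      by (simp add: partial_derivs_def chart_inv_chart[OF vb_chart_atlas[OF C]] if_distrib[of "\<lambda>x. x * _"] cong: if_cong)
  qed
  then show ?thesis unfolding vb_diff_ops_def by blast
qed

lemma zero_smooth_section: "0 \<in> smooth_sections M E"
proof -
  have "smooth_fun_on M (fst c) (\<lambda>p. \<Psi> p (0 p) j)" if C: "(c, \<Psi>) \<in> vb_charts M E" for c \<Psi> j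
    by (rule smooth_fun_on_cong[OF open_chart_dom[OF vb_chart_atlas[OF C]] _ smooth_fun_on_const[of _ 0]])
       (simp add: vb_chart_0[OF C])
  then show ?thesis
    using subspace_0[OF subspace_fibre] by (auto simp: smooth_sections_def)
qed

lemma vb_diff_op_zero: "P \<in> vb_diff_ops M E \<Longrightarrow> P 0 = 0"
proof -
  assume "P \<in> vb_diff_ops M E"
  then have "P (0 *\<^sub>R 0 + 0 *\<^sub>R 0) = 0 *\<^sub>R P 0 + 0 *\<^sub>R P 0"
    unfolding vb_diff_ops_def using zero_smooth_section by blast
  then show "P 0 = 0" by simp
qed

text \<open>A class of sections is the set of its representatives, and the zero net is what shows that it
  contains the section that it was formed from.\<close>

lemma zero_negligible_section:
  assumes h: "fibre_metric M E h"
  shows "0 \<in> negligible_sections M E"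
proof -
  have *: "sup_bigo K (\<lambda>\<epsilon> p. 0) (\<lambda>\<epsilon>. b \<epsilon>)" if "\<And>\<epsilon>. \<epsilon> > 0 \<Longrightarrow> b \<epsilon> \<ge> 0" for K :: "'a set" and b :: "real \<Rightarrow> real"
    unfolding sup_bigo_def by (intro exI[of _ 1] conjI) (use that in auto)
  have "0 \<in> moderate_sections M E"
    unfolding moderate_sections_def
    using h zero_smooth_section
    by (auto simp: vb_diff_op_zero fibre_norm_0[OF h] intro!: exI[of _ h] exI[of _ "0::nat"] *)
  then show ?thesis
    unfolding negligible_sections_def
    using h by (auto simp: fibre_norm_0[OF h] intro!: exI[of _ h] *)
qed

text \<open>Each summand of a representative comes with a fibre metric of its own; comparability on
  compact sets turns the two bounds into one.\<close>

lemma rep_gen_section: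
  assumes A: "A \<in> gen_sections M E"
  obtains h where "fibre_metric M E h"
    "\<And>\<epsilon> q. \<epsilon> \<in> {0<..1} \<Longrightarrow> rep A \<epsilon> q \<in> fibre E q"
    "\<And>K. compact K \<Longrightarrow> \<exists>N::nat. sup_bigo K (\<lambda>\<epsilon> p. fibre_norm h p (rep A \<epsilon> p)) (\<lambda>\<epsilon>. 1 / \<epsilon> ^ N)"
proof -
  obtain s where s: "s \<in> moderate_sections M E" "A = section_class M E s"
    using A by (auto simp: gen_sections_def)
  obtain h where h: "fibre_metric M E h"
    "\<forall>P\<in>vb_diff_ops M E. \<forall>K. compact K \<longrightarrow>
       (\<exists>N::nat. sup_bigo K (\<lambda>\<epsilon> p. fibre_norm h p (P (s \<epsilon>) p)) (\<lambda>\<epsilon>. 1 / \<epsilon> ^ N))"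
    using s(1) unfolding moderate_sections_def mem_Collect_eq by (elim conjE exE) (rule that)
  have "s \<in> A" using zero_negligible_section[OF h(1)] by (simp add: s(2) section_class_def)
  then have "rep A \<in> A" unfolding rep_def by (rule someI[of "\<lambda>x. x \<in> A"])
  define n where "n = rep A - s"
  have n: "n \<in> negligible_sections M E" using \<open>rep A \<in> A\<close> by (simp add: n_def s(2) section_class_def)
  then obtain h' where h': "fibre_metric M E h'"
    "\<forall>K. compact K \<longrightarrow> (\<forall>m. sup_bigo K (\<lambda>\<epsilon> p. fibre_norm h' p (n \<epsilon> p)) (\<lambda>\<epsilon>. \<epsilon> ^ m))"
    unfolding negligible_sections_def mem_Collect_eq by (elim conjE exE) (rule that)
  have rep_eq: "rep A \<epsilon> q = s \<epsilon> q + n \<epsilon> q" for \<epsilon> q by (simp add: n_def)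
  have s_in: "s \<epsilon> q \<in> fibre E q" and n_in: "n \<epsilon> q \<in> fibre E q" if "\<epsilon> \<in> {0<..1}" for \<epsilon> q
    using s(1) n that by (auto simp: negligible_sections_def moderate_sections_def smooth_sections_def)
  show thesis
  proof
    show "fibre_metric M E h" by fact
    show "rep A \<epsilon> q \<in> fibre E q" if "\<epsilon> \<in> {0<..1}" for \<epsilon> q
      unfolding rep_eq by (intro subspace_add subspace_fibre s_in n_in that)
    fix K :: "'a set" assume K: "compact K"
    obtain N C1 e1 where 1: "C1 > 0" "e1 > 0"
      "\<forall>\<epsilon>\<in>{0<..1}. \<epsilon> < e1 \<longrightarrow> (\<forall>p\<in>K. \<bar>fibre_norm h p (s \<epsilon> p)\<bar> \<le> C1 * (1 / \<epsilon> ^ N))"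
      using h(2)[rule_format, OF id_vb_diff_op K] unfolding sup_bigo_def by auto
    obtain C2 e2 where 2: "C2 > 0" "e2 > 0"
      "\<forall>\<epsilon>\<in>{0<..1}. \<epsilon> < e2 \<longrightarrow> (\<forall>p\<in>K. \<bar>fibre_norm h' p (n \<epsilon> p)\<bar> \<le> C2 * \<epsilon> ^ 0)"
      using h'(2)[rule_format, OF K, of 0] unfolding sup_bigo_def by auto
    obtain C3 where 3: "C3 > 0" "\<forall>q\<in>K. \<forall>v\<in>fibre E q. fibre_norm h q v \<le> C3 * fibre_norm h' q v"
      using fibre_norms_comparable[OF h(1) h'(1) K] by (elim exE conjE) (rule that)
    have "\<bar>fibre_norm h p (rep A \<epsilon> p)\<bar> \<le> (2 * (C1 + C3 * C2)) * (1 / \<epsilon> ^ N)"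
      if e: "\<epsilon> \<in> {0<..1}" "\<epsilon> < min e1 e2" and p: "p \<in> K" for \<epsilon> p
    proof -
      have "fibre_norm h p (rep A \<epsilon> p) \<le> 2 * (fibre_norm h p (s \<epsilon> p) + fibre_norm h p (n \<epsilon> p))"
        unfolding rep_eq by (rule fibre_norm_add_le[OF h(1) s_in[OF e(1)] n_in[OF e(1)]])
      moreover have "fibre_norm h p (s \<epsilon> p) \<le> C1 * (1 / \<epsilon> ^ N)"
        using 1(3) e p by (meson abs_le_D1 min_less_iff_conj)
      moreover have "fibre_norm h p (n \<epsilon> p) \<le> C3 * C2 * (1 / \<epsilon> ^ N)"
      proof -
        have "fibre_norm h' p (n \<epsilon> p) \<le> C2 * \<epsilon> ^ 0"
          using 2(3) e p by (meson abs_le_D1 min_less_iff_conj)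
        then have "fibre_norm h' p (n \<epsilon> p) \<le> C2" by simp
        then have "C3 * fibre_norm h' p (n \<epsilon> p) \<le> C3 * C2" using 3(1) by simp
        moreover have "1 \<le> 1 / \<epsilon> ^ N" using e(1) by (simp add: power_le_one)
        then have "C3 * C2 * 1 \<le> C3 * C2 * (1 / \<epsilon> ^ N)" using 3(1) 2(1) by (intro mult_left_mono) auto
        ultimately show ?thesis using 3(2)[rule_format, OF p n_in[OF e(1)]] by linarith
      qed
      moreover have "fibre_norm h p (rep A \<epsilon> p) \<ge> 0"
        unfolding rep_eq
        by (rule fibre_norm_nonneg[OF h(1) subspace_add[OF subspace_fibre s_in[OF e(1)] n_in[OF e(1)]]])
      ultimately show ?thesis unfolding distrib_left distrib_right by linarith
    qed
    moreover have "2 * (C1 + C3 * C2) > 0" "min e1 e2 > 0"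
      using 1(1,2) 2(1,2) 3(1) by (auto intro: add_pos_pos)
    ultimately show "\<exists>N::nat. sup_bigo K (\<lambda>\<epsilon> p. fibre_norm h p (rep A \<epsilon> p)) (\<lambda>\<epsilon>. 1 / \<epsilon> ^ N)"
      unfolding sup_bigo_def by blast
  qed
qed

end

section \<open>Tangent, cotangent and tensor bundles\<close>

lemma subspaceI_combination:
  assumes "0 \<in> V" "\<And>v w a b. v \<in> V \<Longrightarrow> w \<in> V \<Longrightarrow> a *\<^sub>R v + b *\<^sub>R w \<in> V"
  shows "subspace V"
  unfolding subspace_def
proof (intro conjI ballI allI)
  show "0 \<in> V" by fact
  show "x + y \<in> V" if "x \<in> V" "y \<in> V" for x y using assms(2)[OF that, of 1 1] by simp
  show "c *\<^sub>R x \<in> V" if "x \<in> V" for x c using assms(2)[OF that that, of c 0] by simp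
qed

lemma subspace_combination: "subspace V \<Longrightarrow> v \<in> V \<Longrightarrow> w \<in> V \<Longrightarrow> a *\<^sub>R v + b *\<^sub>R w \<in> V"
  by (intro subspace_add subspace_scale)

lemma bij_betw_linearI:
  assumes "\<And>v. v \<in> V \<Longrightarrow> f v \<in> T" "\<And>x. x \<in> T \<Longrightarrow> g x \<in> V" "\<And>x. x \<in> T \<Longrightarrow> f (g x) = x"
    "\<And>v. v \<in> V \<Longrightarrow> g (f v) = v"
  shows "bij_betw f V T"
  by (rule bij_betw_byWitness[of _ g]) (use assms in auto)

lemma sum_unit_vec:
  assumes "finite J" "i \<in> J"
  shows "(\<Sum>k\<in>J. unit_vec i k * y k) = y i" "(\<Sum>k\<in>J. y k * unit_vec i k) = y i"
proof -
  have "(\<Sum>k\<in>J. unit_vec i k * y k) = (\<Sum>k\<in>J. if k = i then y k else 0)"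
    by (auto simp: unit_vec_def intro!: sum.cong)
  then show "(\<Sum>k\<in>J. unit_vec i k * y k) = y i" using assms by simp
  then show "(\<Sum>k\<in>J. y k * unit_vec i k) = y i" by (simp add: mult.commute)
qed

context smooth_mfd
begin

abbreviation "n \<equiv> mdim M"

subsection \<open>The tangent bundle\<close>

lemma subspace_tangent_space: "subspace (tangent_space M p)"
proof (rule subspaceI_combination)
  show "0 \<in> tangent_space M p" by (simp add: tangent_space_def)
  fix v w :: "'a tvec" and a b
  assume v: "v \<in> tangent_space M p" and w: "w \<in> tangent_space M p"
  have "(a *\<^sub>R v + b *\<^sub>R w) d i = (\<Sum>j<n. partial_deriv j (\<lambda>x. snd d (chart_inv c x) i) (snd c p) * (a *\<^sub>R v + b *\<^sub>R w) c j)"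
    if "c \<in> atlas M" "d \<in> atlas M" "p \<in> fst c \<inter> fst d" "i < n" for c d i
  proof -
    have "v d i = (\<Sum>j<n. partial_deriv j (\<lambda>x. snd d (chart_inv c x) i) (snd c p) * v c j)"
      "w d i = (\<Sum>j<n. partial_deriv j (\<lambda>x. snd d (chart_inv c x) i) (snd c p) * w c j)"
      using v w that by (simp_all add: tangent_space_def)
    then show ?thesis
      by (simp add: scaleR_fun_def algebra_simps sum_distrib_left sum.distrib)
  qed
  moreover have "(a *\<^sub>R v + b *\<^sub>R w) c = 0" if "\<not> (c \<in> atlas M \<and> p \<in> fst c)" for c
  proof -
    have "v c = 0" "w c = 0" using v w that unfolding tangent_space_def by blast+
    then show ?thesis by (simp add: scaleR_fun_def fun_eq_iff)
  qed
  moreover have "(a *\<^sub>R v + b *\<^sub>R w) c i = 0" if "c \<in> atlas M" "p \<in> fst c" "i \<ge> n" for c i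
  proof -
    have "v c i = 0" "w c i = 0" using v w that unfolding tangent_space_def by blast+
    then show ?thesis by (simp add: scaleR_fun_def)
  qed
  ultimately show "a *\<^sub>R v + b *\<^sub>R w \<in> tangent_space M p"
    unfolding tangent_space_def by blast
qed

lemma tangent_transform:
  assumes "v \<in> tangent_space M p" "c \<in> atlas M" "d \<in> atlas M" "p \<in> fst c" "p \<in> fst d" "i < n"
  shows "v d i = (\<Sum>j<n. jac c d p i j * v c j)"
  using assms by (simp add: tangent_space_def jac_def)

text \<open>The tangent vector with coordinates \<open>x\<close> in the chart \<open>c\<close>, written out in all charts at once.\<close>

definition tangent_of :: "'a chart \<Rightarrow> 'a \<Rightarrow> (nat \<Rightarrow> real) \<Rightarrow> 'a tvec"
  where "tangent_of c p x = (\<lambda>d i. if d \<in> atlas M \<and> p \<in> fst d \<and> i < n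
                                   then \<Sum>j<n. jac c d p i j * x j else 0)"

lemma tangent_of_in:
  assumes c: "c \<in> atlas M" "p \<in> fst c"
  shows "tangent_of c p x \<in> tangent_space M p"
proof -
  have "tangent_of c p x e i = (\<Sum>k<n. jac d e p i k * tangent_of c p x d k)"
    if d: "d \<in> atlas M" "p \<in> fst d" and e: "e \<in> atlas M" "p \<in> fst e" and i: "i < n" for d e i
  proof -
    have "tangent_of c p x e i = (\<Sum>j<n. (\<Sum>k<n. jac d e p i k * jac c d p k j) * x j)"
      using e i by (simp add: tangent_of_def jac_trans[OF c(1) d(1) e(1) c(2) d(2) e(2)])
    also have "\<dots> = (\<Sum>j<n. \<Sum>k<n. jac d e p i k * jac c d p k j * x j)"
      by (simp add: sum_distrib_right)
    also have "\<dots> = (\<Sum>k<n. \<Sum>j<n. jac d e p i k * jac c d p k j * x j)"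
      by (rule sum.swap)
    also have "\<dots> = (\<Sum>k<n. jac d e p i k * tangent_of c p x d k)"
      using d by (simp add: tangent_of_def sum_distrib_left mult.assoc)
    finally show ?thesis .
  qed
  moreover have "tangent_of c p x d = 0" if "\<not> (d \<in> atlas M \<and> p \<in> fst d)" for d
    using that by (auto simp: tangent_of_def fun_eq_iff)
  moreover have "tangent_of c p x d i = 0" if "i \<ge> n" for d i
    using that by (simp add: tangent_of_def)
  ultimately show ?thesis
    unfolding tangent_space_def jac_def by blast
qed

lemma tangent_of_self:
  assumes c: "c \<in> atlas M" "p \<in> fst c" and x: "x \<in> typical_fibre {..<n}"
  shows "tangent_of c p x c = x"
proof
  fix i
  show "tangent_of c p x c i = x i"
  proof (cases "i < n")
    case True
    then have "tangent_of c p x c i = (\<Sum>j<n. (if i = j then 1 else 0) * x j)"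
      using c by (simp add: tangent_of_def jac_self)
    then show ?thesis using True by (simp add: if_distrib[of "\<lambda>x. x * _"] cong: if_cong)
  qed (use x in \<open>simp add: tangent_of_def typical_fibre_def\<close>)
qed

lemma tangent_in_typical_fibre:
  "v \<in> tangent_space M p \<Longrightarrow> c \<in> atlas M \<Longrightarrow> p \<in> fst c \<Longrightarrow> v c \<in> typical_fibre {..<n}"
  by (auto simp: tangent_space_def typical_fibre_def)

lemma tangent_of_chart:
  assumes v: "v \<in> tangent_space M p" and c: "c \<in> atlas M" "p \<in> fst c"
  shows "tangent_of c p (v c) = v"
proof (intro ext)
  fix d i
  show "tangent_of c p (v c) d i = v d i"
  proof (cases "d \<in> atlas M \<and> p \<in> fst d")
    case True
    then have "i \<ge> n \<Longrightarrow> v d i = 0" using v by (simp add: tangent_space_def)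
    then show ?thesis
      using True tangent_transform[OF v c(1) _ c(2), of d i] by (cases "i < n") (auto simp: tangent_of_def)
  next
    case False
    then have "v d = 0" using v unfolding tangent_space_def by blast
    then show ?thesis using False by (auto simp: tangent_of_def)
  qed
qed

lemma tangent_chart_bij:
  assumes c: "c \<in> atlas M" "p \<in> fst c"
  shows "bij_betw (\<lambda>v. v c) (tangent_space M p) (typical_fibre {..<n})"
  by (rule bij_betw_linearI[where g = "tangent_of c p"])
     (use c in \<open>simp_all add: tangent_in_typical_fibre tangent_of_in tangent_of_self tangent_of_chart\<close>)

lemma coord_vec_eq:
  assumes c: "c \<in> atlas M" "p \<in> fst c" and j: "j < n"
  shows "coord_vec M c p j = tangent_of c p (unit_vec j)"
proof -
  have "unit_vec j \<in> typical_fibre {..<n}" using j by (intro unit_vec_in_typical_fibre) simp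
  then show ?thesis
    unfolding coord_vec_def vb_frame_def tangent_bundle_def vbundle.simps
    using tangent_of_self[OF c] tangent_of_in[OF c] bij_betw_imp_inj_on[OF tangent_chart_bij[OF c]]
    by (intro inv_into_f_eq) auto
qed

lemma coord_vec_in: "c \<in> atlas M \<Longrightarrow> p \<in> fst c \<Longrightarrow> j < n \<Longrightarrow> coord_vec M c p j \<in> tangent_space M p"
  by (simp add: coord_vec_eq tangent_of_in)

text \<open>The components of the coordinate fields of one chart in another are Jacobian entries; these
  are the transition matrices of the tangent bundle.\<close>

lemma coord_vec_chart:
  assumes "c \<in> atlas M" "p \<in> fst c" "j < n" "d \<in> atlas M" "p \<in> fst d" "i < n"
  shows "coord_vec M c p j d i = jac c d p i j"
proof -
  have "coord_vec M c p j d i = (\<Sum>k<n. jac c d p i k * unit_vec j k)"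
    using assms by (simp add: coord_vec_eq tangent_of_def)
  then show ?thesis using assms by (simp add: sum_unit_vec)
qed

lemma coord_vec_self:
  assumes "c \<in> atlas M" "p \<in> fst c" "j < n"
  shows "coord_vec M c p j c = unit_vec j"
  using assms by (simp add: coord_vec_eq tangent_of_self unit_vec_in_typical_fibre)

lemma tangent_vb_chart:
  assumes c: "c \<in> atlas M"
  shows "(c, \<lambda>p v. v c) \<in> vb_charts M (tangent_bundle M)"
proof -
  have trans: "vb_transition_smooth M (tangent_bundle M) (c, \<lambda>p v. v c) (d, \<lambda>p v. v d)"
    if c: "c \<in> atlas M" and d: "d \<in> atlas M" for c d
    unfolding vb_transition_smooth_def
  proof (clarsimp simp: tangent_bundle_def[THEN arg_cong[of _ _ frame_index]])
    fix i j assume ij: "i < n" "j < n"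
    show "smooth_fun_on M (fst c \<inter> fst d) (\<lambda>p. vb_frame (tangent_bundle M) (\<lambda>p v. v c) p j d i)"
      by (rule smooth_fun_on_cong[OF _ _ smooth_jac[OF c d ij]])
         (use ij c d in \<open>auto simp: open_Int open_chart_dom coord_vec_def[symmetric] coord_vec_chart\<close>)
  qed
  have lin: "(a *\<^sub>R v + b *\<^sub>R w) c = a *\<^sub>R v c + b *\<^sub>R w c" for a b and v w :: "'a tvec"
    by (auto simp: scaleR_fun_def)
  have atl: "vb_atlas (tangent_bundle M) = {(c, \<lambda>p v. v c) |c. c \<in> atlas M}"
    by (simp add: tangent_bundle_def)
  have "vb_trivialization M (tangent_bundle M) (c, \<lambda>p v. v c)"
    unfolding vb_trivialization_def using c tangent_chart_bij lin by (simp add: tangent_bundle_def)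
  then show ?thesis
    unfolding vb_charts_def atl using c trans by auto
qed

lemma smooth_vb_tangent: "smooth_vb M (tangent_bundle M)"
  by unfold_locales (use tangent_vb_chart subspace_tangent_space in \<open>auto simp: tangent_bundle_def\<close>)

lemma tangent_expand:
  assumes v: "v \<in> tangent_space M p" and c: "c \<in> atlas M" "p \<in> fst c"
  shows "v = (\<Sum>i<n. v c i *\<^sub>R coord_vec M c p i)"
  using smooth_vb.vb_frame_expand[OF smooth_vb_tangent tangent_vb_chart[OF c(1)] c(2), of v] v
  by (simp add: coord_vec_def tangent_bundle_def)

subsection \<open>The cotangent bundle\<close>

lemma subspace_cotangent_space: "subspace (cotangent_space M p)"
  by (rule subspaceI_combination) (auto simp: cotangent_space_def scaleR_fun_def algebra_simps)

lemma cotangent_expand_apply: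
  assumes \<omega>: "\<omega> \<in> cotangent_space M p" and v: "v \<in> tangent_space M p" and c: "c \<in> atlas M" "p \<in> fst c"
  shows "\<omega> v = (\<Sum>i<n. v c i * \<omega> (coord_vec M c p i))"
proof -
  have lin: "\<forall>v\<in>tangent_space M p. \<forall>w\<in>tangent_space M p. \<forall>a b. \<omega> (a *\<^sub>R v + b *\<^sub>R w) = a *\<^sub>R \<omega> v + b *\<^sub>R \<omega> w"
    using \<omega> by (simp add: cotangent_space_def)
  have "\<omega> v = \<omega> (\<Sum>i<n. v c i *\<^sub>R coord_vec M c p i)"
    using tangent_expand[OF v c] by simp
  also have "\<dots> = (\<Sum>i<n. v c i *\<^sub>R \<omega> (coord_vec M c p i))"
    by (rule linear_on_subspace_sum[OF subspace_tangent_space lin]) (use c in \<open>simp add: coord_vec_in\<close>)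
  finally show ?thesis by simp
qed

definition cot_chart :: "'a chart \<Rightarrow> 'a \<Rightarrow> 'a covec \<Rightarrow> nat \<Rightarrow> real"
  where "cot_chart c = (\<lambda>p \<omega> i. if i < n then \<omega> (coord_vec M c p i) else 0)"

lemma cot_chart_apply: "i < n \<Longrightarrow> cot_chart c p \<omega> i = \<omega> (coord_vec M c p i)"
  by (simp add: cot_chart_def)

text \<open>The covector \<open>\<Sum>\<^sub>i x\<^sub>i dx\<^sup>i\<close>, extended by \<open>0\<close> outside the tangent space.\<close>

definition covec_of :: "'a chart \<Rightarrow> 'a \<Rightarrow> (nat \<Rightarrow> real) \<Rightarrow> 'a covec"
  where "covec_of c p x = (\<lambda>v. if v \<in> tangent_space M p then \<Sum>i<n. x i * v c i else 0)"

lemma covec_of_in: "covec_of c p x \<in> cotangent_space M p"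
  unfolding cotangent_space_def
  using subspace_combination[OF subspace_tangent_space[of p]]
  by (auto simp: covec_of_def scaleR_fun_def algebra_simps sum.distrib sum_distrib_left)

lemma cot_chart_covec_of:
  assumes c: "c \<in> atlas M" "p \<in> fst c" and x: "x \<in> typical_fibre {..<n}"
  shows "cot_chart c p (covec_of c p x) = x"
proof
  fix i
  show "cot_chart c p (covec_of c p x) i = x i"
  proof (cases "i < n")
    case True
    then have "cot_chart c p (covec_of c p x) i = (\<Sum>k<n. x k * unit_vec i k)"
      using c by (simp add: cot_chart_def covec_of_def coord_vec_in coord_vec_self)
    then show ?thesis using True by (simp add: sum_unit_vec)
  qed (use x in \<open>simp add: cot_chart_def typical_fibre_def\<close>)
qed

lemma covec_of_cot_chart:
  assumes \<omega>: "\<omega> \<in> cotangent_space M p" and c: "c \<in> atlas M" "p \<in> fst c"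
  shows "covec_of c p (cot_chart c p \<omega>) = \<omega>"
proof
  fix v show "covec_of c p (cot_chart c p \<omega>) v = \<omega> v"
  proof (cases "v \<in> tangent_space M p")
    case True
    then show ?thesis
      using cotangent_expand_apply[OF \<omega> True c] by (simp add: covec_of_def cot_chart_def mult.commute)
  qed (use \<omega> in \<open>simp add: covec_of_def cotangent_space_def\<close>)
qed

lemma cot_chart_bij:
  assumes c: "c \<in> atlas M" "p \<in> fst c"
  shows "bij_betw (cot_chart c p) (cotangent_space M p) (typical_fibre {..<n})"
  by (rule bij_betw_linearI[where g = "covec_of c p"])
     (use c in \<open>simp_all add: covec_of_in cot_chart_covec_of covec_of_cot_chart\<close>,
      simp add: cot_chart_def typical_fibre_def)

lemma coord_covec_eq: 
  assumes "i < n"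
  shows "coord_covec M c p i = covec_of c p (unit_vec i)"
proof -
  have "(\<Sum>k<n. unit_vec i k * v c k) = v c i" for v :: "'a tvec"
    using assms by (intro sum_unit_vec) auto
  then show ?thesis by (auto simp: coord_covec_def covec_of_def)
qed

lemma coord_covec_in: "i < n \<Longrightarrow> coord_covec M c p i \<in> cotangent_space M p"
  by (simp add: coord_covec_eq covec_of_in)

text \<open>Covectors transform with the Jacobian in the opposite direction, so the cotangent transition
  matrices have the entries of the inverse Jacobians.\<close>

lemma coord_covec_coord_vec:
  assumes "c \<in> atlas M" "p \<in> fst c" "j < n" "d \<in> atlas M" "p \<in> fst d" "i < n"
  shows "coord_covec M d p i (coord_vec M c p j) = jac c d p i j"
  using assms by (simp add: coord_covec_def coord_vec_in coord_vec_chart)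

lemma cotangent_frame:
  assumes c: "c \<in> atlas M" "p \<in> fst c" and i: "i < n"
  shows "vb_frame (cotangent_bundle M) (cot_chart c) p i = coord_covec M c p i"
proof -
  have "unit_vec i \<in> typical_fibre {..<n}" using i by (intro unit_vec_in_typical_fibre) simp
  then show ?thesis
    unfolding vb_frame_def cotangent_bundle_def vbundle.simps coord_covec_eq[OF i]
    using cot_chart_covec_of[OF c] covec_of_in bij_betw_imp_inj_on[OF cot_chart_bij[OF c]]
    by (intro inv_into_f_eq) auto
qed

lemma cotangent_vb_chart:
  assumes c: "c \<in> atlas M"
  shows "(c, cot_chart c) \<in> vb_charts M (cotangent_bundle M)"
proof -
  have trans: "vb_transition_smooth M (cotangent_bundle M) (c, cot_chart c) (d, cot_chart d)"
    if c: "c \<in> atlas M" and d: "d \<in> atlas M" for c d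
    unfolding vb_transition_smooth_def
  proof (clarsimp simp: cotangent_bundle_def[THEN arg_cong[of _ _ frame_index]])
    fix i j assume ij: "i < n" "j < n"
    have "smooth_fun_on M (fst d \<inter> fst c) (\<lambda>p. jac d c p j i)"
      by (rule smooth_jac[OF d c ij(2,1)])
    then have *: "smooth_fun_on M (fst c \<inter> fst d) (\<lambda>p. jac d c p j i)"
      by (simp add: Int_commute)
    show "smooth_fun_on M (fst c \<inter> fst d) (\<lambda>p. cot_chart d p (vb_frame (cotangent_bundle M) (cot_chart c) p j) i)"
      by (rule smooth_fun_on_cong[OF _ _ *])
         (use ij c d in \<open>auto simp: open_Int open_chart_dom cotangent_frame cot_chart_apply coord_covec_coord_vec\<close>)
  qed
  have lin: "cot_chart c p (a *\<^sub>R v + b *\<^sub>R w) = a *\<^sub>R cot_chart c p v + b *\<^sub>R cot_chart c p w" for p a b v w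
    by (auto simp: cot_chart_def scaleR_fun_def)
  have atl: "vb_atlas (cotangent_bundle M) = {(c, cot_chart c) |c. c \<in> atlas M}"
    by (simp add: cotangent_bundle_def cot_chart_def)
  have "vb_trivialization M (cotangent_bundle M) (c, cot_chart c)"
    unfolding vb_trivialization_def using c cot_chart_bij lin by (simp add: cotangent_bundle_def)
  then show ?thesis
    unfolding vb_charts_def atl using c trans by auto
qed

lemma smooth_vb_cotangent: "smooth_vb M (cotangent_bundle M)"
  by unfold_locales (use cotangent_vb_chart subspace_cotangent_space in \<open>auto simp: cotangent_bundle_def\<close>)

lemma cotangent_expand:
  assumes \<omega>: "\<omega> \<in> cotangent_space M p" and c: "c \<in> atlas M" "p \<in> fst c"
  shows "\<omega> = (\<Sum>i<n. \<omega> (coord_vec M c p i) *\<^sub>R coord_covec M c p i)"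
proof -
  have "\<omega> = (\<Sum>i<n. cot_chart c p \<omega> i *\<^sub>R vb_frame (cotangent_bundle M) (cot_chart c) p i)"
    using smooth_vb.vb_frame_expand[OF smooth_vb_cotangent cotangent_vb_chart[OF c(1)] c(2), of \<omega>] \<omega>
    by (simp add: cotangent_bundle_def)
  also have "\<dots> = (\<Sum>i<n. \<omega> (coord_vec M c p i) *\<^sub>R coord_covec M c p i)"
    by (rule sum.cong) (use c in \<open>simp_all add: cot_chart_apply cotangent_frame\<close>)
  finally show ?thesis .
qed

end

subsection \<open>Multilinear maps in components\<close>

definition multilinear_on :: "'v::real_vector set \<Rightarrow> nat \<Rightarrow> ('v list \<Rightarrow> real) \<Rightarrow> bool"
  where "multilinear_on V k F \<longleftrightarrow> (\<forall>vs. length vs = k \<longrightarrow> set vs \<subseteq> V \<longrightarrow>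
    (\<forall>i<k. \<forall>v\<in>V. \<forall>w\<in>V. \<forall>a b.
       F (vs[i := a *\<^sub>R v + b *\<^sub>R w]) = a * F (vs[i := v]) + b * F (vs[i := w])))"

definition lists_below :: "nat \<Rightarrow> nat \<Rightarrow> nat list set"
  where "lists_below n k = {\<alpha>. length \<alpha> = k \<and> set \<alpha> \<subseteq> {..<n}}"

lemma lists_below_0: "lists_below n 0 = {[]}"
  by (auto simp: lists_below_def)

lemma lists_below_Suc: "lists_below n (Suc k) = (\<lambda>(i, \<alpha>). i # \<alpha>) ` ({..<n} \<times> lists_below n k)"
proof (intro equalityI subsetI)
  fix \<alpha> assume "\<alpha> \<in> lists_below n (Suc k)"
  then obtain i \<beta> where "\<alpha> = i # \<beta>" "i < n" "\<beta> \<in> lists_below n k"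
    by (cases \<alpha>) (auto simp: lists_below_def)
  then show "\<alpha> \<in> (\<lambda>(i, \<alpha>). i # \<alpha>) ` ({..<n} \<times> lists_below n k)" by force
qed (auto simp: lists_below_def)

lemma finite_lists_below: "finite (lists_below n k)"
  by (induction k) (auto simp: lists_below_0 lists_below_Suc)

lemma tensor_indices_eq: "tensor_indices n r s = lists_below n r \<times> lists_below n s"
  by (auto simp: tensor_indices_def lists_below_def)

lemma lists_below_nth: "\<alpha> \<in> lists_below n k \<Longrightarrow> l < k \<Longrightarrow> \<alpha> ! l < n"
  using nth_mem by (fastforce simp: lists_below_def)

text \<open>Each argument is expanded in the basis in turn: the head of the list by linearity, the tail by
  the induction hypothesis for the map with the head fixed to a basis vector.\<close>

lemma multilinear_expand:
  assumes V: "subspace V" and F: "multilinear_on V k F"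
    and b: "\<And>i. i < n \<Longrightarrow> b i \<in> V" and x: "\<And>v. v \<in> V \<Longrightarrow> v = (\<Sum>i<n. x i v *\<^sub>R b i)"
    and vs: "length vs = k" "set vs \<subseteq> V"
  shows "F vs = (\<Sum>\<alpha>\<in>lists_below n k. (\<Prod>l<k. x (\<alpha> ! l) (vs ! l)) * F (map b \<alpha>))"
  using F vs
proof (induction k arbitrary: F vs)
  case 0
  then show ?case by (simp add: lists_below_0)
next
  case (Suc k)
  then obtain v us where vs: "vs = v # us" by (cases vs) auto
  then have us: "length us = k" "set us \<subseteq> V" and v: "v \<in> V" using Suc.prems by auto
  have "\<forall>w\<in>V. \<forall>w'\<in>V. \<forall>a a'. F ((a *\<^sub>R w + a' *\<^sub>R w') # us) = a *\<^sub>R F (w # us) + a' *\<^sub>R F (w' # us)"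
    using Suc.prems(1)[unfolded multilinear_on_def, rule_format, of vs 0] Suc.prems(2,3) by (simp add: vs)
  then have lin: "F ((\<Sum>i<n. x i v *\<^sub>R b i) # us) = (\<Sum>i<n. x i v *\<^sub>R F (b i # us))"
    by (rule linear_on_subspace_sum[OF V, where f = "\<lambda>w. F (w # us)"]) (simp add: b)
  have ml: "multilinear_on V k (\<lambda>us. F (b i # us))" if i: "i < n" for i
    unfolding multilinear_on_def
  proof (intro allI impI ballI)
    fix us :: "'a list" and l v w a a'
    assume *: "length us = k" "set us \<subseteq> V" "l < k" "v \<in> V" "w \<in> V"
    then show "F (b i # us[l := a *\<^sub>R v + a' *\<^sub>R w]) = a * F (b i # us[l := v]) + a' * F (b i # us[l := w])"
      using Suc.prems(1)[unfolded multilinear_on_def, rule_format, of "b i # us" "Suc l" v w a a'] b[OF i]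
      by simp
  qed
  have "F vs = (\<Sum>i<n. x i v * F (b i # us))"
    using lin x[OF v] by (simp add: vs)
  also have "\<dots> = (\<Sum>i<n. x i v * (\<Sum>\<alpha>\<in>lists_below n k. (\<Prod>l<k. x (\<alpha> ! l) (us ! l)) * F (b i # map b \<alpha>)))"
    by (intro sum.cong refl) (use Suc.IH[OF ml us] in simp)
  also have "\<dots> = (\<Sum>(i, \<alpha>)\<in>{..<n} \<times> lists_below n k.
      x i v * ((\<Prod>l<k. x (\<alpha> ! l) (us ! l)) * F (b i # map b \<alpha>)))"
    by (simp add: sum_distrib_left sum.cartesian_product)
  also have "\<dots> = (\<Sum>\<alpha>\<in>lists_below n (Suc k). (\<Prod>l<Suc k. x (\<alpha> ! l) (vs ! l)) * F (map b \<alpha>))"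
    unfolding lists_below_Suc
    by (subst sum.reindex)
       (auto simp: inj_on_def vs prod.lessThan_Suc_shift mult.assoc intro!: sum.cong simp del: prod.lessThan_Suc)
  finally show ?case .
qed

lemma prod_list_update:
  assumes "i < k" "length vs = k"
  shows "(\<Prod>l<k. f l (vs[i := v] ! l)) = f i v * (\<Prod>l\<in>{..<k} - {i}. f l (vs ! l))"
proof -
  have "(\<Prod>l<k. f l (vs[i := v] ! l)) = f i (vs[i := v] ! i) * (\<Prod>l\<in>{..<k} - {i}. f l (vs[i := v] ! l))"
    by (rule prod.remove) (use assms in auto)
  also have "(\<Prod>l\<in>{..<k} - {i}. f l (vs[i := v] ! l)) = (\<Prod>l\<in>{..<k} - {i}. f l (vs ! l))"
    by (rule prod.cong) auto
  finally show ?thesis using assms by simp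
qed

lemma prod_unit_vec_lists:
  assumes "length \<alpha> = k" "length \<beta> = k"
  shows "(\<Prod>l<k. unit_vec (\<alpha> ! l) (\<beta> ! l)) = (if \<alpha> = \<beta> then 1 else 0)"
proof (cases "\<alpha> = \<beta>")
  case False
  then obtain l where "l < k" "\<alpha> ! l \<noteq> \<beta> ! l" using assms nth_equalityI by metis
  then have "(\<Prod>l<k. unit_vec (\<alpha> ! l) (\<beta> ! l)) = 0"
    by (intro prod_zero) (force simp: unit_vec_def)+
  then show ?thesis using False by simp
qed (simp add: unit_vec_def)

subsection \<open>The tensor bundle\<close>

context smooth_mfd
begin

lemma tensor_spaceI:
  assumes "\<And>\<omega>s vs. (\<omega>s, vs) \<notin> tensor_args M r s p \<Longrightarrow> t \<omega>s vs = 0"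
    and "\<And>\<omega>s vs i \<eta> \<theta> a b. (\<omega>s, vs) \<in> tensor_args M r s p \<Longrightarrow> i < r \<Longrightarrow>
       \<eta> \<in> cotangent_space M p \<Longrightarrow> \<theta> \<in> cotangent_space M p \<Longrightarrow>
       t (\<omega>s[i := a *\<^sub>R \<eta> + b *\<^sub>R \<theta>]) vs = a * t (\<omega>s[i := \<eta>]) vs + b * t (\<omega>s[i := \<theta>]) vs"
    and "\<And>\<omega>s vs i v w a b. (\<omega>s, vs) \<in> tensor_args M r s p \<Longrightarrow> i < s \<Longrightarrow>
       v \<in> tangent_space M p \<Longrightarrow> w \<in> tangent_space M p \<Longrightarrow>
       t \<omega>s (vs[i := a *\<^sub>R v + b *\<^sub>R w]) = a * t \<omega>s (vs[i := v]) + b * t \<omega>s (vs[i := w])"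
  shows "t \<in> tensor_space M r s p"
  unfolding tensor_space_def using assms by blast

lemma tensor_spaceD:
  assumes t: "t \<in> tensor_space M r s p"
  shows "(\<omega>s, vs) \<notin> tensor_args M r s p \<Longrightarrow> t \<omega>s vs = 0"
    and "(\<omega>s, vs) \<in> tensor_args M r s p \<Longrightarrow> i < r \<Longrightarrow>
       \<eta> \<in> cotangent_space M p \<Longrightarrow> \<theta> \<in> cotangent_space M p \<Longrightarrow>
       t (\<omega>s[i := a *\<^sub>R \<eta> + b *\<^sub>R \<theta>]) vs = a * t (\<omega>s[i := \<eta>]) vs + b * t (\<omega>s[i := \<theta>]) vs"
    and "(\<omega>s, vs) \<in> tensor_args M r s p \<Longrightarrow> i < s \<Longrightarrow>
       v \<in> tangent_space M p \<Longrightarrow> w \<in> tangent_space M p \<Longrightarrow>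
       t \<omega>s (vs[i := a *\<^sub>R v + b *\<^sub>R w]) = a * t \<omega>s (vs[i := v]) + b * t \<omega>s (vs[i := w])"
  using t unfolding tensor_space_def by blast+

lemma subspace_tensor_space: "subspace (tensor_space M r s p)"
proof (rule subspaceI_combination)
  show "0 \<in> tensor_space M r s p" by (rule tensor_spaceI) simp_all
  fix t u :: "'a tensor" and a b
  assume t: "t \<in> tensor_space M r s p" and u: "u \<in> tensor_space M r s p"
  have app: "(a *\<^sub>R t + b *\<^sub>R u) \<omega>s vs = a * t \<omega>s vs + b * u \<omega>s vs" for \<omega>s vs
    by (simp add: scaleR_fun_def)
  show "a *\<^sub>R t + b *\<^sub>R u \<in> tensor_space M r s p"
    by (rule tensor_spaceI; unfold app)
       (simp_all add: tensor_spaceD[OF t] tensor_spaceD[OF u] algebra_simps)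
qed

lemma tensor_multilinear:
  assumes t: "t \<in> tensor_space M r s p"
  shows "set vs \<subseteq> tangent_space M p \<Longrightarrow> length vs = s \<Longrightarrow>
      multilinear_on (cotangent_space M p) r (\<lambda>\<omega>s. t \<omega>s vs)"
    and "set \<omega>s \<subseteq> cotangent_space M p \<Longrightarrow> length \<omega>s = r \<Longrightarrow>
      multilinear_on (tangent_space M p) s (\<lambda>vs. t \<omega>s vs)"
  unfolding multilinear_on_def by (auto simp: tensor_args_def intro!: tensor_spaceD[OF t])

text \<open>The value of \<open>\<partial>\<^sub>\<alpha> \<otimes> dx\<^sup>\<beta>\<close> on the given covectors and vectors, that is, the product of the
  components of the arguments selected by \<open>\<alpha>\<close> and \<open>\<beta>\<close>.\<close>

definition monomial :: "'a chart \<Rightarrow> 'a \<Rightarrow> nat list \<Rightarrow> nat list \<Rightarrow> 'a covec list \<Rightarrow> 'a tvec list \<Rightarrow> real"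
  where "monomial c p \<alpha> \<beta> \<omega>s vs =
    (\<Prod>k<length \<alpha>. (\<omega>s ! k) (coord_vec M c p (\<alpha> ! k))) * (\<Prod>l<length \<beta>. (vs ! l) c (\<beta> ! l))"

definition ten_chart :: "nat \<Rightarrow> nat \<Rightarrow> 'a chart \<Rightarrow> 'a \<Rightarrow> 'a tensor \<Rightarrow> nat list \<times> nat list \<Rightarrow> real"
  where "ten_chart r s c = (\<lambda>p t (\<alpha>, \<beta>). if (\<alpha>, \<beta>) \<in> tensor_indices n r s
                       then t (map (coord_covec M c p) \<alpha>) (map (coord_vec M c p) \<beta>) else 0)"

text \<open>The formula on which the theorem rests: the value of a tensor is a polynomial in its components
  and in those of its arguments.\<close>

lemma tensor_expand:
  assumes t: "t \<in> tensor_space M r s p" and args: "(\<omega>s, vs) \<in> tensor_args M r s p"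
    and c: "c \<in> atlas M" "p \<in> fst c"
  shows "t \<omega>s vs = (\<Sum>(\<alpha>, \<beta>)\<in>tensor_indices n r s. ten_chart r s c p t (\<alpha>, \<beta>) * monomial c p \<alpha> \<beta> \<omega>s vs)"
proof -
  have \<omega>s: "length \<omega>s = r" "set \<omega>s \<subseteq> cotangent_space M p" and vs: "length vs = s" "set vs \<subseteq> tangent_space M p"
    using args by (auto simp: tensor_args_def)
  have 1: "t \<omega>s vs = (\<Sum>\<alpha>\<in>lists_below n r. (\<Prod>k<r. (\<omega>s ! k) (coord_vec M c p (\<alpha> ! k))) *
      t (map (coord_covec M c p) \<alpha>) vs)"
    by (rule multilinear_expand[where F = "\<lambda>\<omega>s. t \<omega>s vs" and x = "\<lambda>i \<omega>. \<omega> (coord_vec M c p i)",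
          OF subspace_cotangent_space tensor_multilinear(1)[OF t vs(2,1)] _ _ \<omega>s])
       (use c in \<open>simp_all add: coord_covec_in cotangent_expand[symmetric]\<close>)
  have 2: "t (map (coord_covec M c p) \<alpha>) vs = (\<Sum>\<beta>\<in>lists_below n s. (\<Prod>l<s. (vs ! l) c (\<beta> ! l)) *
      t (map (coord_covec M c p) \<alpha>) (map (coord_vec M c p) \<beta>))" if \<alpha>: "\<alpha> \<in> lists_below n r" for \<alpha>
  proof (rule multilinear_expand[where F = "\<lambda>vs. t (map (coord_covec M c p) \<alpha>) vs" and x = "\<lambda>i v. v c i",
          OF subspace_tangent_space tensor_multilinear(2)[OF t] _ _ vs])
    show "set (map (coord_covec M c p) \<alpha>) \<subseteq> cotangent_space M p" "length (map (coord_covec M c p) \<alpha>) = r"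
      using \<alpha> by (auto simp: lists_below_def intro!: coord_covec_in)
  qed (use c in \<open>simp_all add: coord_vec_in tangent_expand[symmetric]\<close>)
  have "t \<omega>s vs = (\<Sum>\<alpha>\<in>lists_below n r. \<Sum>\<beta>\<in>lists_below n s.
      ten_chart r s c p t (\<alpha>, \<beta>) * monomial c p \<alpha> \<beta> \<omega>s vs)"
    unfolding 1
  proof (rule sum.cong[OF refl])
    fix \<alpha> assume \<alpha>: "\<alpha> \<in> lists_below n r"
    show "(\<Prod>k<r. (\<omega>s ! k) (coord_vec M c p (\<alpha> ! k))) * t (map (coord_covec M c p) \<alpha>) vs =
        (\<Sum>\<beta>\<in>lists_below n s. ten_chart r s c p t (\<alpha>, \<beta>) * monomial c p \<alpha> \<beta> \<omega>s vs)"
      unfolding 2[OF \<alpha>] sum_distrib_left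
      by (rule sum.cong[OF refl])
         (use \<alpha> in \<open>auto simp: ten_chart_def tensor_indices_eq monomial_def lists_below_def\<close>)
  qed
  then show ?thesis by (simp add: sum.cartesian_product tensor_indices_eq)
qed

text \<open>The tensor \<open>\<Sum> x\<^sub>\<alpha>\<^sub>\<beta> \<partial>\<^sub>\<alpha> \<otimes> dx\<^sup>\<beta>\<close>, the inverse of the trivialization \<open>ten_chart\<close>.\<close>

definition tensor_of :: "nat \<Rightarrow> nat \<Rightarrow> 'a chart \<Rightarrow> 'a \<Rightarrow> (nat list \<times> nat list \<Rightarrow> real) \<Rightarrow> 'a tensor"
  where "tensor_of r s c p x = (\<lambda>\<omega>s vs. if (\<omega>s, vs) \<in> tensor_args M r s p
     then \<Sum>(\<alpha>, \<beta>)\<in>tensor_indices n r s. x (\<alpha>, \<beta>) * monomial c p \<alpha> \<beta> \<omega>s vs else 0)"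

lemma tensor_args_update:
  assumes "(\<omega>s, vs) \<in> tensor_args M r s p"
  shows "\<eta> \<in> cotangent_space M p \<Longrightarrow> (\<omega>s[i := \<eta>], vs) \<in> tensor_args M r s p"
    "v \<in> tangent_space M p \<Longrightarrow> (\<omega>s, vs[i := v]) \<in> tensor_args M r s p"
  using assms set_update_subset_insert[of \<omega>s i] set_update_subset_insert[of vs i]
  unfolding tensor_args_def by (auto dest!: subsetD)

lemma tensor_of_in: "tensor_of r s c p x \<in> tensor_space M r s p"
proof -
  have lin1: "tensor_of r s c p x (\<omega>s[i := a *\<^sub>R \<eta> + b *\<^sub>R \<theta>]) vs =
      a * tensor_of r s c p x (\<omega>s[i := \<eta>]) vs + b * tensor_of r s c p x (\<omega>s[i := \<theta>]) vs"
    if args: "(\<omega>s, vs) \<in> tensor_args M r s p" and i: "i < r"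
      and \<eta>: "\<eta> \<in> cotangent_space M p" and \<theta>: "\<theta> \<in> cotangent_space M p" for \<omega>s vs i a b \<eta> \<theta>
  proof -
    have mono: "monomial c p \<alpha> \<beta> (\<omega>s[i := a *\<^sub>R \<eta> + b *\<^sub>R \<theta>]) vs =
        a * monomial c p \<alpha> \<beta> (\<omega>s[i := \<eta>]) vs + b * monomial c p \<alpha> \<beta> (\<omega>s[i := \<theta>]) vs"
      if "length \<alpha> = r" for \<alpha> \<beta>
      using args i that
        prod_list_update[where f = "\<lambda>k \<omega>. \<omega> (coord_vec M c p (\<alpha> ! k))" and vs = \<omega>s and k = r and i = i]
      by (simp add: monomial_def tensor_args_def scaleR_fun_def algebra_simps)
    have "\<And>\<alpha> \<beta>. (\<alpha>, \<beta>) \<in> tensor_indices n r s \<Longrightarrow> length \<alpha> = r" by (simp add: tensor_indices_def)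
    then show ?thesis
      using tensor_args_update(1)[OF args, of _ i] \<eta> \<theta> subspace_combination[OF subspace_cotangent_space \<eta> \<theta>]
      by (auto simp: tensor_of_def mono sum_distrib_left sum.distrib[symmetric] algebra_simps intro!: sum.cong)
  qed
  have lin2: "tensor_of r s c p x \<omega>s (vs[i := a *\<^sub>R v + b *\<^sub>R w]) =
      a * tensor_of r s c p x \<omega>s (vs[i := v]) + b * tensor_of r s c p x \<omega>s (vs[i := w])"
    if args: "(\<omega>s, vs) \<in> tensor_args M r s p" and i: "i < s"
      and v: "v \<in> tangent_space M p" and w: "w \<in> tangent_space M p" for \<omega>s vs i a b v w
  proof -
    have mono: "monomial c p \<alpha> \<beta> \<omega>s (vs[i := a *\<^sub>R v + b *\<^sub>R w]) =
        a * monomial c p \<alpha> \<beta> \<omega>s (vs[i := v]) + b * monomial c p \<alpha> \<beta> \<omega>s (vs[i := w])"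
      if "length \<beta> = s" for \<alpha> \<beta>
      using args i that
        prod_list_update[where f = "\<lambda>k v. v c (\<beta> ! k)" and vs = vs and k = s and i = i]
      by (simp add: monomial_def tensor_args_def scaleR_fun_def algebra_simps)
    have "\<And>\<alpha> \<beta>. (\<alpha>, \<beta>) \<in> tensor_indices n r s \<Longrightarrow> length \<beta> = s" by (simp add: tensor_indices_def)
    then show ?thesis
      using tensor_args_update(2)[OF args, of _ i] v w subspace_combination[OF subspace_tangent_space v w]
      by (auto simp: tensor_of_def mono sum_distrib_left sum.distrib[symmetric] algebra_simps intro!: sum.cong)
  qed
  show ?thesis
    by (rule tensor_spaceI) (use lin1 lin2 in \<open>simp_all add: tensor_of_def[of r s c p x]\<close>)
qed

lemma coord_args:
  assumes "c \<in> atlas M" "p \<in> fst c" "\<alpha> \<in> lists_below n r" "\<beta> \<in> lists_below n s"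
  shows "(map (coord_covec M c p) \<alpha>, map (coord_vec M c p) \<beta>) \<in> tensor_args M r s p"
  using assms by (auto simp: tensor_args_def lists_below_def intro!: coord_covec_in coord_vec_in)

lemma monomial_coord:
  assumes c: "c \<in> atlas M" "p \<in> fst c" and d: "d \<in> atlas M" "p \<in> fst d"
    and "\<alpha> \<in> lists_below n r" "\<beta> \<in> lists_below n s" "\<alpha>' \<in> lists_below n r" "\<beta>' \<in> lists_below n s"
  shows "monomial c p \<alpha> \<beta> (map (coord_covec M d p) \<alpha>') (map (coord_vec M d p) \<beta>') =
    (\<Prod>k<r. jac c d p (\<alpha>' ! k) (\<alpha> ! k)) * (\<Prod>l<s. jac d c p (\<beta> ! l) (\<beta>' ! l))"
proof -
  have len: "length \<alpha> = r" "length \<beta> = s" "length \<alpha>' = r" "length \<beta>' = s"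
    using assms by (simp_all add: lists_below_def)
  show ?thesis
    unfolding monomial_def len
    by (intro arg_cong2[of _ _ _ _ "(*)"] prod.cong refl)
       (use assms len in \<open>simp_all add: lists_below_nth coord_covec_coord_vec coord_vec_chart\<close>)
qed

lemma monomial_coord_self:
  assumes "c \<in> atlas M" "p \<in> fst c"
    and "\<alpha> \<in> lists_below n r" "\<beta> \<in> lists_below n s" "\<alpha>' \<in> lists_below n r" "\<beta>' \<in> lists_below n s"
  shows "monomial c p \<alpha> \<beta> (map (coord_covec M c p) \<alpha>') (map (coord_vec M c p) \<beta>') = unit_vec (\<alpha>', \<beta>') (\<alpha>, \<beta>)"
proof -
  have len: "length \<alpha> = r" "length \<beta> = s" "length \<alpha>' = r" "length \<beta>' = s"
    using assms by (simp_all add: lists_below_def)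
  have "(\<Prod>k<r. jac c c p (\<alpha>' ! k) (\<alpha> ! k)) = (\<Prod>k<r. unit_vec (\<alpha>' ! k) (\<alpha> ! k))"
    "(\<Prod>l<s. jac c c p (\<beta> ! l) (\<beta>' ! l)) = (\<Prod>l<s. unit_vec (\<beta>' ! l) (\<beta> ! l))"
    using assms by (auto intro!: prod.cong simp: jac_self lists_below_nth unit_vec_def)
  then show ?thesis
    unfolding monomial_coord[OF assms(1,2,1,2,3-6)]
    by (simp only: prod_unit_vec_lists len) (auto simp: unit_vec_def)
qed

lemma ten_chart_tensor_of:
  assumes c: "c \<in> atlas M" "p \<in> fst c" and x: "x \<in> typical_fibre (tensor_indices n r s)"
  shows "ten_chart r s c p (tensor_of r s c p x) = x"
proof (rule ext, clarify)
  fix \<alpha>' \<beta>'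
  show "ten_chart r s c p (tensor_of r s c p x) (\<alpha>', \<beta>') = x (\<alpha>', \<beta>')"
  proof (cases "(\<alpha>', \<beta>') \<in> tensor_indices n r s")
    case True
    then have \<alpha>\<beta>: "\<alpha>' \<in> lists_below n r" "\<beta>' \<in> lists_below n s" by (auto simp: tensor_indices_eq)
    have "ten_chart r s c p (tensor_of r s c p x) (\<alpha>', \<beta>') =
        (\<Sum>(\<alpha>, \<beta>)\<in>tensor_indices n r s. x (\<alpha>, \<beta>) *
          monomial c p \<alpha> \<beta> (map (coord_covec M c p) \<alpha>') (map (coord_vec M c p) \<beta>'))"
      using True coord_args[OF c \<alpha>\<beta>] by (simp add: ten_chart_def tensor_of_def)
    also have "\<dots> = (\<Sum>z\<in>tensor_indices n r s. x z * unit_vec (\<alpha>', \<beta>') z)"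
      by (rule sum.cong) (use monomial_coord_self[OF c _ _ \<alpha>\<beta>] in \<open>auto simp: tensor_indices_eq\<close>)
    also have "\<dots> = x (\<alpha>', \<beta>')"
      using True by (intro sum_unit_vec) (auto simp: tensor_indices_eq finite_lists_below)
    finally show ?thesis .
  qed (use x in \<open>auto simp: ten_chart_def typical_fibre_def\<close>)
qed

lemma tensor_of_ten_chart:
  assumes t: "t \<in> tensor_space M r s p" and c: "c \<in> atlas M" "p \<in> fst c"
  shows "tensor_of r s c p (ten_chart r s c p t) = t"
proof (intro ext)
  fix \<omega>s vs
  show "tensor_of r s c p (ten_chart r s c p t) \<omega>s vs = t \<omega>s vs"
  proof (cases "(\<omega>s, vs) \<in> tensor_args M r s p")
    case True
    then show ?thesis using tensor_expand[OF t True c] by (simp add: tensor_of_def)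
  next
    case False
    then have "t \<omega>s vs = 0" by (rule tensor_spaceD(1)[OF t])
    then show ?thesis using False by (simp add: tensor_of_def)
  qed
qed

lemma ten_chart_bij:
  assumes c: "c \<in> atlas M" "p \<in> fst c"
  shows "bij_betw (ten_chart r s c p) (tensor_space M r s p) (typical_fibre (tensor_indices n r s))"
proof (rule bij_betw_linearI[where g = "tensor_of r s c p"])
  show "ten_chart r s c p t \<in> typical_fibre (tensor_indices n r s)" for t
    by (auto simp: ten_chart_def typical_fibre_def)
qed (use c in \<open>simp_all add: tensor_of_in ten_chart_tensor_of tensor_of_ten_chart\<close>)

text \<open>The transition matrix of the tensor bundle: its entries are products of entries of the Jacobians
  in both directions, hence smooth.\<close>

lemma ten_chart_frame:
  assumes c: "c \<in> atlas M" "p \<in> fst c" and d: "d \<in> atlas M" "p \<in> fst d"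
    and "\<alpha> \<in> lists_below n r" "\<beta> \<in> lists_below n s" "\<alpha>' \<in> lists_below n r" "\<beta>' \<in> lists_below n s"
  shows "ten_chart r s d p (vb_frame (tensor_bundle M r s) (ten_chart r s c) p (\<alpha>, \<beta>)) (\<alpha>', \<beta>') =
    (\<Prod>k<r. jac c d p (\<alpha>' ! k) (\<alpha> ! k)) * (\<Prod>l<s. jac d c p (\<beta> ! l) (\<beta>' ! l))"
proof -
  have idx: "(\<alpha>, \<beta>) \<in> tensor_indices n r s" "(\<alpha>', \<beta>') \<in> tensor_indices n r s"
    using assms by (auto simp: tensor_indices_eq)
  have "vb_frame (tensor_bundle M r s) (ten_chart r s c) p (\<alpha>, \<beta>) = tensor_of r s c p (unit_vec (\<alpha>, \<beta>))"
    unfolding vb_frame_def tensor_bundle_def vbundle.simps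
    using ten_chart_tensor_of[OF c unit_vec_in_typical_fibre[OF idx(1)]] tensor_of_in
      bij_betw_imp_inj_on[OF ten_chart_bij[OF c]]
    by (intro inv_into_f_eq) auto
  then have "ten_chart r s d p (vb_frame (tensor_bundle M r s) (ten_chart r s c) p (\<alpha>, \<beta>)) (\<alpha>', \<beta>') =
      (\<Sum>z\<in>tensor_indices n r s. unit_vec (\<alpha>, \<beta>) z *
        (case z of (\<gamma>, \<delta>) \<Rightarrow> monomial c p \<gamma> \<delta> (map (coord_covec M d p) \<alpha>') (map (coord_vec M d p) \<beta>')))"
    using idx coord_args[OF d assms(7,8)] by (simp add: ten_chart_def tensor_of_def case_prod_unfold)
  also have "\<dots> = monomial c p \<alpha> \<beta> (map (coord_covec M d p) \<alpha>') (map (coord_vec M d p) \<beta>')"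
    using sum_unit_vec(1)[OF _ idx(1), of "\<lambda>(\<gamma>, \<delta>). monomial c p \<gamma> \<delta> (map (coord_covec M d p) \<alpha>') (map (coord_vec M d p) \<beta>')"]
    by (simp add: tensor_indices_eq finite_lists_below)
  finally show ?thesis using monomial_coord[OF assms] by simp
qed

lemma tensor_vb_chart:
  assumes c: "c \<in> atlas M"
  shows "(c, ten_chart r s c) \<in> vb_charts M (tensor_bundle M r s)"
proof -
  have trans: "vb_transition_smooth M (tensor_bundle M r s) (c, ten_chart r s c) (d, ten_chart r s d)"
    if c: "c \<in> atlas M" and d: "d \<in> atlas M" for c d
  proof -
    have "smooth_fun_on M (fst c \<inter> fst d)
        (\<lambda>p. ten_chart r s d p (vb_frame (tensor_bundle M r s) (ten_chart r s c) p (\<alpha>, \<beta>)) (\<alpha>', \<beta>'))"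
      if idx: "\<alpha> \<in> lists_below n r" "\<beta> \<in> lists_below n s" "\<alpha>' \<in> lists_below n r" "\<beta>' \<in> lists_below n s"
      for \<alpha> \<beta> \<alpha>' \<beta>'
    proof (rule smooth_fun_on_cong)
      show op: "open (fst c \<inter> fst d)" by (intro open_Int open_chart_dom c d)
      have "smooth_fun_on M (fst c \<inter> fst d) (\<lambda>p. jac c d p (\<alpha>' ! k) (\<alpha> ! k))" if "k < r" for k
        by (rule smooth_jac[OF c d]) (use that idx in \<open>simp_all add: lists_below_nth\<close>)
      moreover have "smooth_fun_on M (fst d \<inter> fst c) (\<lambda>p. jac d c p (\<beta> ! l) (\<beta>' ! l))" if "l < s" for l
        by (rule smooth_jac[OF d c]) (use that idx in \<open>simp_all add: lists_below_nth\<close>)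
      ultimately show "smooth_fun_on M (fst c \<inter> fst d) (\<lambda>p. (\<Prod>k<r. jac c d p (\<alpha>' ! k) (\<alpha> ! k)) *
          (\<Prod>l<s. jac d c p (\<beta> ! l) (\<beta>' ! l)))"
        by (intro smooth_fun_on_mult[OF op] smooth_fun_on_prod[OF op]) (auto simp: Int_commute)
      show "(\<Prod>k<r. jac c d p (\<alpha>' ! k) (\<alpha> ! k)) * (\<Prod>l<s. jac d c p (\<beta> ! l) (\<beta>' ! l)) =
          ten_chart r s d p (vb_frame (tensor_bundle M r s) (ten_chart r s c) p (\<alpha>, \<beta>)) (\<alpha>', \<beta>')"
        if "p \<in> fst c \<inter> fst d" for p
        using ten_chart_frame[OF c _ d _ idx, of p] that by simp
    qed
    moreover have "frame_index (tensor_bundle M r s) = lists_below n r \<times> lists_below n s"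
      by (simp add: tensor_bundle_def tensor_indices_eq)
    ultimately show ?thesis unfolding vb_transition_smooth_def by auto
  qed
  have lin: "ten_chart r s c p (a *\<^sub>R v + b *\<^sub>R w) = a *\<^sub>R ten_chart r s c p v + b *\<^sub>R ten_chart r s c p w" for p a b v w
    by (auto simp: ten_chart_def scaleR_fun_def)
  have atl: "vb_atlas (tensor_bundle M r s) = {(c, ten_chart r s c) |c. c \<in> atlas M}"
    by (simp add: tensor_bundle_def ten_chart_def)
  have "vb_trivialization M (tensor_bundle M r s) (c, ten_chart r s c)"
    unfolding vb_trivialization_def using c ten_chart_bij lin by (simp add: tensor_bundle_def)
  then show ?thesis
    unfolding vb_charts_def atl using c trans by auto
qed

lemma smooth_vb_tensor: "smooth_vb M (tensor_bundle M r s)"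
proof unfold_locales
  show "subspace (fibre (tensor_bundle M r s) p)" for p
    by (simp add: tensor_bundle_def subspace_tensor_space)
  show "finite (frame_index (tensor_bundle M r s))"
    by (simp add: tensor_bundle_def tensor_indices_eq finite_lists_below)
  show "\<exists>\<Psi>. (c, \<Psi>) \<in> vb_charts M (tensor_bundle M r s)" if "c \<in> atlas M" for c
    using tensor_vb_chart[OF that] by blast
qed

end

section \<open>Moderate and negligible nets of numbers\<close>

text \<open>The points of a net wander between charts, so estimates are made separately for those
  \<open>\<epsilon>\<close> whose point lies in a given piece of a chart.\<close>

definition zero_within :: "real set \<Rightarrow> real filter"
  where "zero_within S = inf (at_right 0) (principal S)"

definition moderate_on :: "real set \<Rightarrow> (real \<Rightarrow> real) \<Rightarrow> bool"
  where "moderate_on S x \<longleftrightarrow> (\<exists>N::nat. x \<in> O[zero_within S](\<lambda>\<epsilon>. 1 / \<epsilon> ^ N))"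

definition negligible_on :: "real set \<Rightarrow> (real \<Rightarrow> real) \<Rightarrow> bool"
  where "negligible_on S x \<longleftrightarrow> (\<forall>m::nat. x \<in> O[zero_within S](\<lambda>\<epsilon>. \<epsilon> ^ m))"

lemma eventually_zero_within:
  "eventually P (zero_within S) \<longleftrightarrow> (\<exists>b>0. \<forall>\<epsilon>>0. \<epsilon> < b \<longrightarrow> \<epsilon> \<in> S \<longrightarrow> P \<epsilon>)"
  unfolding zero_within_def eventually_inf_principal eventually_at_right_field by auto

lemma eventually_zero_withinI:
  assumes "\<And>\<epsilon>. \<epsilon> \<in> {0<..1} \<Longrightarrow> \<epsilon> \<in> S \<Longrightarrow> P \<epsilon>"
  shows "eventually P (zero_within S)"
  unfolding eventually_zero_within by (rule exI[of _ 1]) (use assms in auto)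

lemma bigo_zero_withinI:
  fixes x b :: "real \<Rightarrow> real"
  assumes "\<epsilon>0 > 0" and "\<And>\<epsilon>. \<epsilon> \<in> {0<..1} \<Longrightarrow> \<epsilon> < \<epsilon>0 \<Longrightarrow> \<epsilon> \<in> S \<Longrightarrow> \<bar>x \<epsilon>\<bar> \<le> C * b \<epsilon>"
    and "\<And>\<epsilon>. \<epsilon> > 0 \<Longrightarrow> b \<epsilon> \<ge> 0"
  shows "x \<in> O[zero_within S](b)"
proof (rule bigoI)
  show "\<forall>\<^sub>F \<epsilon> in zero_within S. norm (x \<epsilon>) \<le> C * norm (b \<epsilon>)"
    unfolding eventually_zero_within
    by (rule exI[of _ "min 1 \<epsilon>0"]) (use assms in auto)
qed

lemma moderate_on_mult:
  assumes "moderate_on S x" "moderate_on S y"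
  shows "moderate_on S (\<lambda>\<epsilon>. x \<epsilon> * y \<epsilon>)"
proof -
  obtain N N' where "x \<in> O[zero_within S](\<lambda>\<epsilon>. 1 / \<epsilon> ^ N)" "y \<in> O[zero_within S](\<lambda>\<epsilon>. 1 / \<epsilon> ^ N')"
    using assms unfolding moderate_on_def by auto
  from landau_o.big.mult[OF this] have "(\<lambda>\<epsilon>. x \<epsilon> * y \<epsilon>) \<in> O[zero_within S](\<lambda>\<epsilon>. 1 / \<epsilon> ^ (N + N'))"
    by (simp add: power_add)
  then show ?thesis unfolding moderate_on_def by blast
qed

lemma moderate_on_const: "moderate_on S (\<lambda>\<epsilon>. a)"
  unfolding moderate_on_def by (rule exI[of _ 0]) simp

lemma moderate_on_prod:
  "(\<And>k. k \<in> A \<Longrightarrow> moderate_on S (x k)) \<Longrightarrow> moderate_on S (\<lambda>\<epsilon>. \<Prod>k\<in>A. x k \<epsilon>)"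
  by (induction A rule: infinite_finite_induct) (auto intro: moderate_on_mult moderate_on_const)

lemma negligible_on_mult_moderate:
  assumes x: "moderate_on S x" and y: "negligible_on S y"
  shows "negligible_on S (\<lambda>\<epsilon>. x \<epsilon> * y \<epsilon>)"
  unfolding negligible_on_def
proof
  fix m
  obtain N where "x \<in> O[zero_within S](\<lambda>\<epsilon>. 1 / \<epsilon> ^ N)"
    using x unfolding moderate_on_def by auto
  moreover have "y \<in> O[zero_within S](\<lambda>\<epsilon>. \<epsilon> ^ (N + m))"
    using y unfolding negligible_on_def by blast
  ultimately have "(\<lambda>\<epsilon>. x \<epsilon> * y \<epsilon>) \<in> O[zero_within S](\<lambda>\<epsilon>. 1 / \<epsilon> ^ N * \<epsilon> ^ (N + m))"
    by (rule landau_o.big.mult)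
  moreover have "\<forall>\<^sub>F \<epsilon> in zero_within S. 1 / \<epsilon> ^ N * \<epsilon> ^ (N + m) = \<epsilon> ^ m"
    by (rule eventually_zero_withinI) (simp add: power_add)
  note landau_o.big.cong[OF this]
  ultimately show "(\<lambda>\<epsilon>. x \<epsilon> * y \<epsilon>) \<in> O[zero_within S](\<lambda>\<epsilon>. \<epsilon> ^ m)"
    by simp
qed

lemma negligible_on_add: "negligible_on S x \<Longrightarrow> negligible_on S y \<Longrightarrow> negligible_on S (\<lambda>\<epsilon>. x \<epsilon> + y \<epsilon>)"
  unfolding negligible_on_def by (blast intro: sum_in_bigo)

lemma negligible_on_0: "negligible_on S (\<lambda>\<epsilon>. 0)"
  by (simp add: negligible_on_def)

lemma negligible_on_sum:
  "(\<And>k. k \<in> A \<Longrightarrow> negligible_on S (x k)) \<Longrightarrow> negligible_on S (\<lambda>\<epsilon>. \<Sum>k\<in>A. x k \<epsilon>)"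
  by (induction A rule: infinite_finite_induct) (auto intro: negligible_on_add negligible_on_0)

lemma negligible_on_cong:
  assumes "\<And>\<epsilon>. \<epsilon> \<in> {0<..1} \<Longrightarrow> \<epsilon> \<in> S \<Longrightarrow> x \<epsilon> = y \<epsilon>" "negligible_on S x"
  shows "negligible_on S y"
proof -
  have "\<forall>\<^sub>F \<epsilon> in zero_within S. x \<epsilon> = y \<epsilon>"
    by (rule eventually_zero_withinI) (rule assms)
  from landau_o.big.in_cong[OF this] show ?thesis
    using assms(2) unfolding negligible_on_def by blast
qed

text \<open>\<open>xy - x'y' = x (y - y') + y' (x - x')\<close>: moderate factors do not spoil negligible differences.\<close>

lemma negligible_on_mult_diff:
  assumes "moderate_on S x" "moderate_on S y'" "negligible_on S (\<lambda>\<epsilon>. x \<epsilon> - x' \<epsilon>)" "negligible_on S (\<lambda>\<epsilon>. y \<epsilon> - y' \<epsilon>)"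
  shows "negligible_on S (\<lambda>\<epsilon>. x \<epsilon> * y \<epsilon> - x' \<epsilon> * y' \<epsilon>)"
proof -
  have "negligible_on S (\<lambda>\<epsilon>. x \<epsilon> * (y \<epsilon> - y' \<epsilon>) + y' \<epsilon> * (x \<epsilon> - x' \<epsilon>))"
    by (intro negligible_on_add negligible_on_mult_moderate assms)
  then show ?thesis by (simp add: algebra_simps)
qed

lemma negligible_on_prod_diff:
  assumes "\<And>k. k \<in> A \<Longrightarrow> moderate_on S (x k)" "\<And>k. k \<in> A \<Longrightarrow> moderate_on S (y k)"
    "\<And>k. k \<in> A \<Longrightarrow> negligible_on S (\<lambda>\<epsilon>. x k \<epsilon> - y k \<epsilon>)"
  shows "negligible_on S (\<lambda>\<epsilon>. (\<Prod>k\<in>A. x k \<epsilon>) - (\<Prod>k\<in>A. y k \<epsilon>))"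
  using assms
proof (induction A rule: infinite_finite_induct)
  case (insert k A)
  then show ?case by (auto intro!: negligible_on_mult_diff moderate_on_prod)
qed (auto simp: negligible_on_0)

lemma negligible_on_Un:
  assumes "negligible_on S x" "negligible_on T x"
  shows "negligible_on (S \<union> T) x"
proof -
  have "zero_within (S \<union> T) = sup (zero_within S) (zero_within T)"
    unfolding zero_within_def sup_principal[symmetric] by (rule inf_sup_distrib1)
  then show ?thesis
    using assms landau_o.big.sup unfolding negligible_on_def by metis
qed

lemma negligible_on_UN:
  assumes "finite F" "\<And>z. z \<in> F \<Longrightarrow> negligible_on (S z) x"
  shows "negligible_on (\<Union>z\<in>F. S z) x"
  using assms
proof (induction F)
  case empty
  have "zero_within {} = bot" by (simp add: zero_within_def)
  then show ?case by (simp add: negligible_on_def)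
qed (auto intro: negligible_on_Un)

text \<open>The case \<open>m = 0\<close> already gives moderateness.\<close>

lemma negligible_nums_iff: "x \<in> negligible_nums \<longleftrightarrow> (\<forall>m::nat. x \<in> O[at_right 0](\<lambda>\<epsilon>. \<epsilon> ^ m))"
proof -
  have "x \<in> moderate_nums" if "\<forall>m::nat. x \<in> O[at_right 0](\<lambda>\<epsilon>. \<epsilon> ^ m)"
    using that[rule_format, of 0] unfolding moderate_nums_def by (auto intro!: exI[of _ "0::nat"])
  then show ?thesis by (auto simp: negligible_nums_def)
qed

lemma negligible_nums_eq_on:
  assumes S: "\<epsilon>0 > 0" "\<And>\<epsilon>. \<epsilon> \<in> {0<..1} \<Longrightarrow> \<epsilon> < \<epsilon>0 \<Longrightarrow> \<epsilon> \<in> S"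
  shows "x \<in> negligible_nums \<longleftrightarrow> negligible_on S x"
proof -
  have "\<forall>\<^sub>F \<epsilon> in at_right 0. \<epsilon> \<in> S"
    unfolding eventually_at_right_field by (rule exI[of _ "min 1 \<epsilon>0"]) (use S in auto)
  then have "zero_within S = at_right 0"
    unfolding zero_within_def by (intro inf_absorb1) (simp add: le_principal)
  then show ?thesis by (simp add: negligible_nums_iff negligible_on_def)
qed

lemma num_class_eqI:
  assumes "x - y \<in> negligible_nums"
  shows "num_class x = num_class y"
proof -
  have *: "u + v \<in> negligible_nums" "u - v \<in> negligible_nums"
    if "u \<in> negligible_nums" "v \<in> negligible_nums" for u v
    using that unfolding negligible_nums_iff plus_fun_def fun_diff_def by (blast intro: sum_in_bigo)+
  have "z - y = (z - x) + (x - y)" "z - x = (z - y) - (x - y)" for z by simp_all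
  then show ?thesis
    unfolding num_class_def using assms * by metis
qed

section \<open>Representatives of generalized points and functions\<close>

lemma deriv_funpow_const: "\<exists>b. (deriv ^^ k) (\<lambda>t::real. a::real) = (\<lambda>t. b)"
proof (induction k)
  case (Suc k)
  then obtain b where "(deriv ^^ k) (\<lambda>t::real. a) = (\<lambda>t. b)" by blast
  then have "(deriv ^^ Suc k) (\<lambda>t::real. a) = (\<lambda>t. 0)" by auto
  then show ?case by blast
qed auto

context smooth_mfd
begin

text \<open>The constant curve has velocity \<open>0\<close> and so length \<open>0\<close>.\<close>

lemma riemannian_dist_self:
  assumes g: "riemannian_metric M g"
  shows "riemannian_dist M g a a = 0"
proof -
  have smooth: "smooth_curve_on M J (\<lambda>t. a)" for J
    unfolding smooth_curve_on_def
  proof (intro conjI ballI allI impI)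
    fix c t i k
    obtain b where "(deriv ^^ k) (\<lambda>\<tau>::real. snd c a i) = (\<lambda>t. b)" using deriv_funpow_const by blast
    then show "(deriv ^^ k) (\<lambda>\<tau>. snd c a i) differentiable at t" by simp
  qed simp
  have pw: "piecewise_smooth_curve M (\<lambda>t. a)"
    unfolding piecewise_smooth_curve_def
    by (rule exI[of _ 1], rule exI[of _ real]) (use smooth in \<open>auto intro!: exI[of _ "1::real"] exI[of _ "\<lambda>t. a"]\<close>)
  have "velocity M (\<lambda>t. a) t = 0" for t
    by (auto simp: velocity_def fun_eq_iff)
  then have "fibre_norm g a (velocity M (\<lambda>t. a) t) = 0" for t
    using smooth_vb.fibre_norm_0[OF smooth_vb_tangent g[unfolded riemannian_metric_def]] by simp
  then have "curve_length M g (\<lambda>t. a) = 0" by (simp add: curve_length_def)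
  moreover have "riemannian_dist M g a a \<le> curve_length M g (\<lambda>t. a)"
    unfolding riemannian_dist_def by (rule INF_lower) (use pw in simp)
  ultimately show ?thesis by simp
qed

lemma point_nets_equiv_refl: "point_nets_equiv M p p"
  unfolding point_nets_equiv_def by (auto simp: riemannian_dist_self intro!: exI[of _ "1::real"])

lemma rep_gen_point:
  assumes "p \<in> gen_points M"
  obtains K \<epsilon>0 where "compact K" "\<epsilon>0 > 0" "\<And>\<epsilon>. \<epsilon> \<in> {0<..1} \<Longrightarrow> \<epsilon> < \<epsilon>0 \<Longrightarrow> rep p \<epsilon> \<in> K"
proof -
  obtain q where q: "q \<in> compactly_supported_nets"
    "p = {(p, q). p \<in> compactly_supported_nets \<and> q \<in> compactly_supported_nets \<and> point_nets_equiv M p q} `` {q}"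
    using assms unfolding gen_points_def quotient_def by blast
  have "q \<in> p" using q point_nets_equiv_refl by blast
  then have "rep p \<in> p" unfolding rep_def by (rule someI[of "\<lambda>x. x \<in> p"])
  then have "rep p \<in> compactly_supported_nets" using q by blast
  then show thesis using that unfolding compactly_supported_nets_def by blast
qed

lemma zero_negligible_fun: "0 \<in> negligible_funs M"
proof -
  have sb: "sup_bigo K (\<lambda>\<epsilon> p. 0) (\<lambda>\<epsilon>. b \<epsilon>)" if "\<And>\<epsilon>. \<epsilon> > 0 \<Longrightarrow> b \<epsilon> \<ge> 0" for K :: "'a set" and b :: "real \<Rightarrow> real"
    unfolding sup_bigo_def by (intro exI[of _ 1] conjI) (use that in auto)
  have z: "0 \<in> smooth_funs M"
    using smooth_fun_on_const[of UNIV 0] by (simp add: smooth_funs_def zero_fun_def)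
  have P0: "P 0 = 0" if "P \<in> diff_ops M" for P
  proof -
    have "P (0 *\<^sub>R 0 + 0 *\<^sub>R 0) = 0 *\<^sub>R P 0 + 0 *\<^sub>R P 0"
      using that z unfolding diff_ops_def by blast
    then show ?thesis by simp
  qed
  have "0 \<in> moderate_funs M"
    using z by (auto simp: moderate_funs_def P0 intro!: exI[of _ "0::nat"] sb)
  moreover have "sup_bigo K 0 (\<lambda>\<epsilon>. \<epsilon> ^ q)" for K :: "'a set" and q
    using sb[of "\<lambda>\<epsilon>. \<epsilon> ^ q" K] by (simp add: zero_fun_def)
  ultimately show ?thesis
    by (simp add: negligible_funs_def)
qed

text \<open>The chosen representative of the class of \<open>u\<close> differs from \<open>u\<close> by a net that is negligible
  uniformly on the compact set in which the points lie.\<close>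

lemma fun_point_value_class:
  assumes p: "p \<in> gen_points M"
  shows "fun_point_value (fun_class M u) p = num_class (\<lambda>\<epsilon>. u \<epsilon> (rep p \<epsilon>))"
  unfolding fun_point_value_def
proof (rule num_class_eqI)
  obtain K \<epsilon>0 where K: "compact K" "\<epsilon>0 > 0" "\<And>\<epsilon>. \<epsilon> \<in> {0<..1} \<Longrightarrow> \<epsilon> < \<epsilon>0 \<Longrightarrow> rep p \<epsilon> \<in> K"
    using rep_gen_point[OF p] by metis
  define F where "F = fun_class M u"
  have "u \<in> F" using zero_negligible_fun by (simp add: F_def fun_class_def)
  then have "rep F \<in> F" unfolding rep_def by (rule someI[of "\<lambda>x. x \<in> F"])
  then have neg: "rep F - u \<in> negligible_funs M" by (simp add: F_def fun_class_def)
  have "negligible_on {\<epsilon>. rep p \<epsilon> \<in> K} (\<lambda>\<epsilon>. rep F \<epsilon> (rep p \<epsilon>) - u \<epsilon> (rep p \<epsilon>))"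
    unfolding negligible_on_def
  proof
    fix m
    have "sup_bigo K (rep F - u) (\<lambda>\<epsilon>. \<epsilon> ^ m)"
      using neg K(1) unfolding negligible_funs_def by blast
    then obtain C e where "C > 0" "e > 0" and b: "\<forall>\<epsilon>\<in>{0<..1}. \<epsilon> < e \<longrightarrow> (\<forall>p\<in>K. \<bar>(rep F - u) \<epsilon> p\<bar> \<le> C * \<epsilon> ^ m)"
      unfolding sup_bigo_def by blast
    then show "(\<lambda>\<epsilon>. rep F \<epsilon> (rep p \<epsilon>) - u \<epsilon> (rep p \<epsilon>)) \<in> O[zero_within {\<epsilon>. rep p \<epsilon> \<in> K}](\<lambda>\<epsilon>. \<epsilon> ^ m)"
      by (intro bigo_zero_withinI[of e _ _ C]) auto
  qed
  then show "(\<lambda>\<epsilon>. rep (fun_class M u) \<epsilon> (rep p \<epsilon>)) - (\<lambda>\<epsilon>. u \<epsilon> (rep p \<epsilon>)) \<in> negligible_nums"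
    by (subst negligible_nums_eq_on[OF K(2), of "{\<epsilon>. rep p \<epsilon> \<in> K}"])
       (use K(3) in \<open>auto simp: F_def fun_diff_def\<close>)
qed

end

context smooth_vb
begin

text \<open>Equality of point values is an equality of equivalence classes; it yields the equivalence of
  the representing nets only because these nets are moderate, so that the classes are nonempty.\<close>

lemma section_point_value_eqD:
  assumes p: "p \<in> gen_points M" and B: "B \<in> gen_sections M E"
    and eq: "section_point_value M E A p = section_point_value M E B p"
  shows "vb_nets_equiv M E (\<lambda>\<epsilon>. (rep p \<epsilon>, rep A \<epsilon> (rep p \<epsilon>))) (\<lambda>\<epsilon>. (rep p \<epsilon>, rep B \<epsilon> (rep p \<epsilon>)))"
proof -
  let ?e = "\<lambda>\<epsilon>. (rep p \<epsilon>, rep B \<epsilon> (rep p \<epsilon>))"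
  obtain K \<epsilon>0 where K: "compact K" "\<epsilon>0 > 0" "\<And>\<epsilon>. \<epsilon> \<in> {0<..1} \<Longrightarrow> \<epsilon> < \<epsilon>0 \<Longrightarrow> rep p \<epsilon> \<in> K"
    using rep_gen_point[OF p] by metis
  obtain h where h: "fibre_metric M E h" "\<And>\<epsilon> q. \<epsilon> \<in> {0<..1} \<Longrightarrow> rep B \<epsilon> q \<in> fibre E q"
    "\<exists>N::nat. sup_bigo K (\<lambda>\<epsilon> p. fibre_norm h p (rep B \<epsilon> p)) (\<lambda>\<epsilon>. 1 / \<epsilon> ^ N)"
    using rep_gen_section[OF B] K(1) by metis
  obtain N C e where N: "C > 0" "e > 0"
    "\<forall>\<epsilon>\<in>{0<..1}. \<epsilon> < e \<longrightarrow> (\<forall>p\<in>K. \<bar>fibre_norm h p (rep B \<epsilon> p)\<bar> \<le> C * (1 / \<epsilon> ^ N))"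
    using h(3) unfolding sup_bigo_def by blast
  have "?e \<in> vb_moderate_nets M E"
    unfolding vb_moderate_nets_def mem_Collect_eq fst_conv snd_conv
  proof (intro conjI)
    show "\<forall>\<epsilon>\<in>{0<..1}. rep B \<epsilon> (rep p \<epsilon>) \<in> fibre E (rep p \<epsilon>)" using h(2) by blast
    show "rep p \<in> compactly_supported_nets"
      unfolding compactly_supported_nets_def using K by blast
    have "fibre_norm h (rep p \<epsilon>) (rep B \<epsilon> (rep p \<epsilon>)) \<le> C * (1 / \<epsilon> ^ N)"
      if "\<epsilon> \<in> {0<..1}" "\<epsilon> < min e \<epsilon>0" for \<epsilon>
      using N(3) K(3) that by (meson abs_le_D1 min_less_iff_conj)
    moreover have "min e \<epsilon>0 > 0" using N(2) K(2) by simp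
    ultimately show "\<exists>h. fibre_metric M E h \<and>
      (\<exists>\<epsilon>\<^sub>1>0. \<exists>N::nat. \<exists>C>0. \<forall>\<epsilon>\<in>{0<..1}. \<epsilon> < \<epsilon>\<^sub>1 \<longrightarrow>
         fibre_norm h (rep p \<epsilon>) (rep B \<epsilon> (rep p \<epsilon>)) \<le> C * (1 / \<epsilon> ^ N))"
      using h(1) N(1) by blast
  qed
  moreover have "vb_nets_equiv M E ?e ?e"
    unfolding vb_nets_equiv_def
    by (auto simp: point_nets_equiv_refl L2_set_def zero_fun_def[symmetric] intro!: exI[of _ "1::real"])
  ultimately have "?e \<in> section_point_value M E B p"
    by (simp add: section_point_value_def vb_rel_def)
  then have "?e \<in> section_point_value M E A p" using eq by simp
  then show ?thesis by (simp add: section_point_value_def vb_rel_def)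
qed

lemma rep_gen_section_in:
  assumes A: "A \<in> gen_sections M E" and \<epsilon>: "\<epsilon> \<in> {0<..1}"
  shows "rep A \<epsilon> q \<in> fibre E q"
  by (rule rep_gen_section[OF A]) (use \<epsilon> in blast)

text \<open>The fibre norm of a representative is moderate, and in a vector bundle chart it bounds the
  components.\<close>

lemma component_moderate:
  assumes A: "A \<in> gen_sections M E" and C: "(c, \<Psi>) \<in> vb_charts M E"
    and L: "compact L" "L \<subseteq> fst c" and j: "j \<in> frame_index E"
  shows "moderate_on {\<epsilon>. p \<epsilon> \<in> L} (\<lambda>\<epsilon>. \<Psi> (p \<epsilon>) (rep A \<epsilon> (p \<epsilon>)) j)"
proof -
  obtain h where h: "fibre_metric M E h" "\<And>\<epsilon> q. \<epsilon> \<in> {0<..1} \<Longrightarrow> rep A \<epsilon> q \<in> fibre E q"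
    "\<exists>N::nat. sup_bigo L (\<lambda>\<epsilon> p. fibre_norm h p (rep A \<epsilon> p)) (\<lambda>\<epsilon>. 1 / \<epsilon> ^ N)"
    using rep_gen_section[OF A] L(1) by metis
  obtain N D e where N: "D > 0" "e > 0"
    "\<forall>\<epsilon>\<in>{0<..1}. \<epsilon> < e \<longrightarrow> (\<forall>p\<in>L. \<bar>fibre_norm h p (rep A \<epsilon> p)\<bar> \<le> D * (1 / \<epsilon> ^ N))"
    using h(3) unfolding sup_bigo_def by blast
  obtain a where a: "a > 0" "\<And>q v. q \<in> L \<Longrightarrow> v \<in> fibre E q \<Longrightarrow> L2_set (\<Psi> q v) (frame_index E) \<le> a * fibre_norm h q v"
    using fibre_norm_chart_bounds[OF h(1) C L] by metis
  have "\<bar>\<Psi> (p \<epsilon>) (rep A \<epsilon> (p \<epsilon>)) j\<bar> \<le> (a * D) * (1 / \<epsilon> ^ N)"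
    if "\<epsilon> \<in> {0<..1}" "\<epsilon> < e" "p \<epsilon> \<in> L" for \<epsilon>
  proof -
    have "\<bar>\<Psi> (p \<epsilon>) (rep A \<epsilon> (p \<epsilon>)) j\<bar> \<le> L2_set (\<lambda>j. \<bar>\<Psi> (p \<epsilon>) (rep A \<epsilon> (p \<epsilon>)) j\<bar>) (frame_index E)"
      by (rule member_le_L2_set[OF finite_frame_index j])
    also have "\<dots> = L2_set (\<Psi> (p \<epsilon>) (rep A \<epsilon> (p \<epsilon>))) (frame_index E)" by (simp add: L2_set_def)
    also have "\<dots> \<le> a * fibre_norm h (p \<epsilon>) (rep A \<epsilon> (p \<epsilon>))" by (intro a(2) that h(2))
    also have "fibre_norm h (p \<epsilon>) (rep A \<epsilon> (p \<epsilon>)) \<le> D * (1 / \<epsilon> ^ N)"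
      using N(3) that by (meson abs_le_D1)
    finally show ?thesis using a(1) by (simp add: mult.assoc)
  qed
  then have "(\<lambda>\<epsilon>. \<Psi> (p \<epsilon>) (rep A \<epsilon> (p \<epsilon>)) j) \<in> O[zero_within {\<epsilon>. p \<epsilon> \<in> L}](\<lambda>\<epsilon>. 1 / \<epsilon> ^ N)"
    by (intro bigo_zero_withinI[OF N(2), where C = "a * D"]) auto
  then show ?thesis unfolding moderate_on_def by blast
qed

lemma component_diff_negligible:
  assumes eq: "vb_nets_equiv M E (\<lambda>\<epsilon>. (p \<epsilon>, u \<epsilon>)) (\<lambda>\<epsilon>. (p \<epsilon>, u' \<epsilon>))" and C: "(c, \<Psi>) \<in> vb_charts M E"
    and L: "compact L" "L \<subseteq> fst c" and j: "j \<in> frame_index E"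
  shows "negligible_on {\<epsilon>. p \<epsilon> \<in> L} (\<lambda>\<epsilon>. \<Psi> (p \<epsilon>) (u \<epsilon>) j - \<Psi> (p \<epsilon>) (u' \<epsilon>) j)"
  unfolding negligible_on_def
proof
  fix m
  have "\<forall>L. compact L \<and> L \<subseteq> fst c \<longrightarrow>
       (\<exists>\<epsilon>\<^sub>1>0. \<exists>D>0. \<forall>\<epsilon>\<in>{0<..1}. \<epsilon> < \<epsilon>\<^sub>1 \<and> p \<epsilon> \<in> L \<and> p \<epsilon> \<in> L \<longrightarrow>
          L2_set (\<Psi> (p \<epsilon>) (u \<epsilon>) - \<Psi> (p \<epsilon>) (u' \<epsilon>)) (frame_index E) \<le> D * \<epsilon> ^ m)"
    using eq C unfolding vb_nets_equiv_def fst_conv snd_conv by fast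
  then obtain e D where e: "e > 0" "D > 0" "\<And>\<epsilon>. \<epsilon> \<in> {0<..1} \<Longrightarrow> \<epsilon> < e \<Longrightarrow> p \<epsilon> \<in> L \<Longrightarrow>
      L2_set (\<Psi> (p \<epsilon>) (u \<epsilon>) - \<Psi> (p \<epsilon>) (u' \<epsilon>)) (frame_index E) \<le> D * \<epsilon> ^ m"
    using L by meson
  have "\<bar>\<Psi> (p \<epsilon>) (u \<epsilon>) j - \<Psi> (p \<epsilon>) (u' \<epsilon>) j\<bar> \<le> D * \<epsilon> ^ m"
    if "\<epsilon> \<in> {0<..1}" "\<epsilon> < e" "p \<epsilon> \<in> L" for \<epsilon>
  proof -
    let ?y = "\<Psi> (p \<epsilon>) (u \<epsilon>) - \<Psi> (p \<epsilon>) (u' \<epsilon>)"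
    have "\<bar>?y j\<bar> \<le> L2_set (\<lambda>j. \<bar>?y j\<bar>) (frame_index E)"
      by (rule member_le_L2_set[OF finite_frame_index j])
    also have "\<dots> = L2_set ?y (frame_index E)" by (simp add: L2_set_def)
    also have "\<dots> \<le> D * \<epsilon> ^ m" by (rule e(3)[OF that])
    finally show ?thesis by simp
  qed
  then show "(\<lambda>\<epsilon>. \<Psi> (p \<epsilon>) (u \<epsilon>) j - \<Psi> (p \<epsilon>) (u' \<epsilon>) j) \<in> O[zero_within {\<epsilon>. p \<epsilon> \<in> L}](\<lambda>\<epsilon>. \<epsilon> ^ m)"
    by (intro bigo_zero_withinI[OF e(1), where C = D]) auto
qed

end

section \<open>Point values of tensor fields applied to sections\<close>

context smooth_mfd
begin

text \<open>For the \<open>\<epsilon>\<close> whose point lies in \<open>L\<close>, both values are given by the component formula in the chart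
  \<open>c\<close>. The components of \<open>t\<close> and of all arguments are moderate there, and corresponding components
  of the two families of arguments differ by negligible nets.\<close>

lemma tensor_apply_diff_negligible:
  assumes t: "t \<in> gen_tensor_fields M r s" and p: "p \<in> gen_points M"
    and \<omega>s: "length \<omega>s = r" "set \<omega>s \<subseteq> gen_one_forms M"
    and \<omega>s': "length \<omega>s' = r" "set \<omega>s' \<subseteq> gen_one_forms M"
    and \<omega>_eq: "\<forall>i<r. section_point_value M (cotangent_bundle M) (\<omega>s ! i) p =
               section_point_value M (cotangent_bundle M) (\<omega>s' ! i) p"
    and \<xi>s: "length \<xi>s = s" "set \<xi>s \<subseteq> gen_vector_fields M"
    and \<xi>s': "length \<xi>s' = s" "set \<xi>s' \<subseteq> gen_vector_fields M"
    and \<xi>_eq: "\<forall>i<s. section_point_value M (tangent_bundle M) (\<xi>s ! i) p =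
               section_point_value M (tangent_bundle M) (\<xi>s' ! i) p"
    and c: "c \<in> atlas M" and L: "compact L" "L \<subseteq> fst c"
  shows "negligible_on {\<epsilon>. rep p \<epsilon> \<in> L}
    (\<lambda>\<epsilon>. rep t \<epsilon> (rep p \<epsilon>) (map (\<lambda>\<omega>. rep \<omega> \<epsilon> (rep p \<epsilon>)) \<omega>s) (map (\<lambda>\<xi>. rep \<xi> \<epsilon> (rep p \<epsilon>)) \<xi>s) -
         rep t \<epsilon> (rep p \<epsilon>) (map (\<lambda>\<omega>. rep \<omega> \<epsilon> (rep p \<epsilon>)) \<omega>s') (map (\<lambda>\<xi>. rep \<xi> \<epsilon> (rep p \<epsilon>)) \<xi>s'))"
proof -
  interpret T: smooth_vb M "tangent_bundle M" by (rule smooth_vb_tangent)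
  interpret C: smooth_vb M "cotangent_bundle M" by (rule smooth_vb_cotangent)
  interpret R: smooth_vb M "tensor_bundle M r s" by (rule smooth_vb_tensor)
  define P where "P = rep p"
  define S where "S = {\<epsilon>. P \<epsilon> \<in> L}"
  define w where "w \<omega> i \<epsilon> = rep \<omega> \<epsilon> (P \<epsilon>) (coord_vec M c (P \<epsilon>) i)" for \<omega> :: "(real \<Rightarrow> 'a \<Rightarrow> 'a covec) set" and i \<epsilon>
  define x where "x \<xi> i \<epsilon> = rep \<xi> \<epsilon> (P \<epsilon>) c i" for \<xi> :: "(real \<Rightarrow> 'a \<Rightarrow> 'a tvec) set" and i \<epsilon>
  define \<tau> where "\<tau> z \<epsilon> = ten_chart r s c (P \<epsilon>) (rep t \<epsilon> (P \<epsilon>)) z" for z \<epsilon>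
  define m where "m \<omega>s \<xi>s z \<epsilon> = (\<Prod>k<r. w (\<omega>s ! k) (fst z ! k) \<epsilon>) * (\<Prod>l<s. x (\<xi>s ! l) (snd z ! l) \<epsilon>)"
    for \<omega>s \<xi>s z \<epsilon>
  have \<tau>_mod: "moderate_on S (\<tau> z)" if "z \<in> tensor_indices n r s" for z
    unfolding \<tau>_def S_def
    by (rule R.component_moderate[OF t tensor_vb_chart[OF c] L]) (use that in \<open>simp add: tensor_bundle_def\<close>)
  have w_mod: "moderate_on S (w \<omega> i)" if "\<omega> \<in> gen_one_forms M" "i < n" for \<omega> i
  proof -
    have "moderate_on {\<epsilon>. P \<epsilon> \<in> L} (\<lambda>\<epsilon>. cot_chart c (P \<epsilon>) (rep \<omega> \<epsilon> (P \<epsilon>)) i)"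
      by (rule C.component_moderate[OF that(1) cotangent_vb_chart[OF c] L]) (use that in \<open>simp add: cotangent_bundle_def\<close>)
    then show ?thesis using that(2) by (simp add: cot_chart_apply S_def w_def[abs_def])
  qed
  have x_mod: "moderate_on S (x \<xi> i)" if "\<xi> \<in> gen_vector_fields M" "i < n" for \<xi> i
    unfolding x_def S_def
    by (rule T.component_moderate[OF that(1) tangent_vb_chart[OF c] L]) (use that in \<open>simp add: tangent_bundle_def\<close>)
  have w_neg: "negligible_on S (\<lambda>\<epsilon>. w (\<omega>s ! k) i \<epsilon> - w (\<omega>s' ! k) i \<epsilon>)" if "k < r" "i < n" for k i
  proof -
    have "\<omega>s' ! k \<in> gen_one_forms M" using \<omega>s' that(1) by auto
    from C.section_point_value_eqD[OF p this \<omega>_eq[rule_format, OF that(1)]]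
    have "negligible_on {\<epsilon>. P \<epsilon> \<in> L} (\<lambda>\<epsilon>. cot_chart c (P \<epsilon>) (rep (\<omega>s ! k) \<epsilon> (P \<epsilon>)) i -
        cot_chart c (P \<epsilon>) (rep (\<omega>s' ! k) \<epsilon> (P \<epsilon>)) i)"
      unfolding P_def
      by (rule C.component_diff_negligible[OF _ cotangent_vb_chart[OF c] L]) (use that in \<open>simp add: cotangent_bundle_def\<close>)
    then show ?thesis using that(2) by (simp add: cot_chart_apply S_def w_def)
  qed
  have x_neg: "negligible_on S (\<lambda>\<epsilon>. x (\<xi>s ! k) i \<epsilon> - x (\<xi>s' ! k) i \<epsilon>)" if "k < s" "i < n" for k i
  proof -
    have "\<xi>s' ! k \<in> gen_vector_fields M" using \<xi>s' that(1) by auto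
    from T.section_point_value_eqD[OF p this \<xi>_eq[rule_format, OF that(1)]]
    show ?thesis
      unfolding P_def S_def x_def
      by (rule T.component_diff_negligible[OF _ tangent_vb_chart[OF c] L]) (use that in \<open>simp add: tangent_bundle_def\<close>)
  qed
  have expand: "rep t \<epsilon> (P \<epsilon>) (map (\<lambda>\<omega>. rep \<omega> \<epsilon> (P \<epsilon>)) \<omega>s) (map (\<lambda>\<xi>. rep \<xi> \<epsilon> (P \<epsilon>)) \<xi>s) =
      (\<Sum>z\<in>tensor_indices n r s. \<tau> z \<epsilon> * m \<omega>s \<xi>s z \<epsilon>)"
    if \<epsilon>: "\<epsilon> \<in> {0<..1}" "\<epsilon> \<in> S" and \<omega>s: "length \<omega>s = r" "set \<omega>s \<subseteq> gen_one_forms M"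
      and \<xi>s: "length \<xi>s = s" "set \<xi>s \<subseteq> gen_vector_fields M" for \<epsilon> \<omega>s \<xi>s
  proof -
    have Pc: "P \<epsilon> \<in> fst c" using \<epsilon>(2) L by (auto simp: S_def)
    have "rep \<omega> \<epsilon> (P \<epsilon>) \<in> cotangent_space M (P \<epsilon>)" if "\<omega> \<in> gen_one_forms M" for \<omega>
      using C.rep_gen_section_in[OF that \<epsilon>(1), of "P \<epsilon>"] by (simp add: cotangent_bundle_def)
    moreover have "rep \<xi> \<epsilon> (P \<epsilon>) \<in> tangent_space M (P \<epsilon>)" if "\<xi> \<in> gen_vector_fields M" for \<xi>
      using T.rep_gen_section_in[OF that \<epsilon>(1), of "P \<epsilon>"] by (simp add: tangent_bundle_def)
    ultimately have args: "(map (\<lambda>\<omega>. rep \<omega> \<epsilon> (P \<epsilon>)) \<omega>s, map (\<lambda>\<xi>. rep \<xi> \<epsilon> (P \<epsilon>)) \<xi>s) \<in> tensor_args M r s (P \<epsilon>)"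
      using \<omega>s \<xi>s by (auto simp: tensor_args_def)
    have t_in: "rep t \<epsilon> (P \<epsilon>) \<in> tensor_space M r s (P \<epsilon>)"
      using R.rep_gen_section_in[OF t \<epsilon>(1), of "P \<epsilon>"] by (simp add: tensor_bundle_def)
    have "monomial c (P \<epsilon>) (fst z) (snd z) (map (\<lambda>\<omega>. rep \<omega> \<epsilon> (P \<epsilon>)) \<omega>s) (map (\<lambda>\<xi>. rep \<xi> \<epsilon> (P \<epsilon>)) \<xi>s) =
        m \<omega>s \<xi>s z \<epsilon>" if "z \<in> tensor_indices n r s" for z
      using that \<omega>s \<xi>s by (auto simp: monomial_def m_def w_def x_def tensor_indices_def)
    then show ?thesis
      unfolding tensor_expand[OF t_in args c Pc]
      by (intro sum.cong) (auto simp: \<tau>_def case_prod_unfold)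
  qed
  have "negligible_on S (\<lambda>\<epsilon>. \<tau> z \<epsilon> * (m \<omega>s \<xi>s z \<epsilon> - m \<omega>s' \<xi>s' z \<epsilon>))" if z: "z \<in> tensor_indices n r s" for z
  proof (rule negligible_on_mult_moderate[OF \<tau>_mod[OF z]])
    have idx: "fst z ! k < n" if "k < r" for k
      using z that by (auto simp: tensor_indices_eq lists_below_nth)
    have idx': "snd z ! l < n" if "l < s" for l
      using z that by (auto simp: tensor_indices_eq lists_below_nth)
    have wm: "moderate_on S (w (\<omega>s ! k) (fst z ! k))" "moderate_on S (w (\<omega>s' ! k) (fst z ! k))"
        "negligible_on S (\<lambda>\<epsilon>. w (\<omega>s ! k) (fst z ! k) \<epsilon> - w (\<omega>s' ! k) (fst z ! k) \<epsilon>)"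
      if "k \<in> {..<r}" for k
      using that \<omega>s \<omega>s' idx[of k] by (auto intro!: w_mod w_neg)
    have xm: "moderate_on S (x (\<xi>s ! l) (snd z ! l))" "moderate_on S (x (\<xi>s' ! l) (snd z ! l))"
        "negligible_on S (\<lambda>\<epsilon>. x (\<xi>s ! l) (snd z ! l) \<epsilon> - x (\<xi>s' ! l) (snd z ! l) \<epsilon>)"
      if "l \<in> {..<s}" for l
      using that \<xi>s \<xi>s' idx'[of l] by (auto intro!: x_mod x_neg)
    show "negligible_on S (\<lambda>\<epsilon>. m \<omega>s \<xi>s z \<epsilon> - m \<omega>s' \<xi>s' z \<epsilon>)"
      unfolding m_def
      by (intro negligible_on_mult_diff negligible_on_prod_diff moderate_on_prod wm xm)
  qed
  then have sum: "negligible_on S (\<lambda>\<epsilon>. \<Sum>z\<in>tensor_indices n r s. \<tau> z \<epsilon> * (m \<omega>s \<xi>s z \<epsilon> - m \<omega>s' \<xi>s' z \<epsilon>))"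
    by (rule negligible_on_sum)
  have "negligible_on S (\<lambda>\<epsilon>.
         rep t \<epsilon> (P \<epsilon>) (map (\<lambda>\<omega>. rep \<omega> \<epsilon> (P \<epsilon>)) \<omega>s) (map (\<lambda>\<xi>. rep \<xi> \<epsilon> (P \<epsilon>)) \<xi>s) -
         rep t \<epsilon> (P \<epsilon>) (map (\<lambda>\<omega>. rep \<omega> \<epsilon> (P \<epsilon>)) \<omega>s') (map (\<lambda>\<xi>. rep \<xi> \<epsilon> (P \<epsilon>)) \<xi>s'))"
    by (rule negligible_on_cong[OF _ sum])
       (simp add: expand[OF _ _ \<omega>s \<xi>s] expand[OF _ _ \<omega>s' \<xi>s'] right_diff_distrib sum_subtractf)
  then show ?thesis by (simp add: S_def P_def)
qed

end

theorem proposition3p8: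
  fixes M :: "('a::t2_space) manifold"
    and r s :: nat
    and t :: "(real \<Rightarrow> 'a \<Rightarrow> 'a tensor) set"
    and p :: "(real \<Rightarrow> 'a) set"
    and \<omega>s \<omega>s' :: "(real \<Rightarrow> 'a \<Rightarrow> 'a covec) set list"
    and \<xi>s \<xi>s' :: "(real \<Rightarrow> 'a \<Rightarrow> 'a tvec) set list"
  assumes "smooth_manifold M"
    and "t \<in> gen_tensor_fields M r s"
    and "p \<in> gen_points M"
    and "length \<omega>s = r" and "set \<omega>s \<subseteq> gen_one_forms M"
    and "length \<omega>s' = r" and "set \<omega>s' \<subseteq> gen_one_forms M"
    and "\<forall>i<r. section_point_value M (cotangent_bundle M) (\<omega>s ! i) p =
               section_point_value M (cotangent_bundle M) (\<omega>s' ! i) p"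
    and "length \<xi>s = s" and "set \<xi>s \<subseteq> gen_vector_fields M"
    and "length \<xi>s' = s" and "set \<xi>s' \<subseteq> gen_vector_fields M"
    and "\<forall>i<s. section_point_value M (tangent_bundle M) (\<xi>s ! i) p =
               section_point_value M (tangent_bundle M) (\<xi>s' ! i) p"
  shows "fun_point_value (tensor_apply M t \<omega>s \<xi>s) p =
         fun_point_value (tensor_apply M t \<omega>s' \<xi>s') p"
proof -
  interpret smooth_mfd M by unfold_locales fact
  obtain K \<epsilon>0 where K: "compact K" "\<epsilon>0 > 0" "\<And>\<epsilon>. \<epsilon> \<in> {0<..1} \<Longrightarrow> \<epsilon> < \<epsilon>0 \<Longrightarrow> rep p \<epsilon> \<in> K"
    using rep_gen_point[OF assms(3)] by metis
  obtain F where F: "finite F" "K \<subseteq> \<Union>(snd ` F)"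
    "\<And>c L. (c, L) \<in> F \<Longrightarrow> c \<in> atlas M \<and> compact L \<and> L \<subseteq> fst c"
    using compact_chart_cover[OF K(1)] by blast
  define D where "D = (\<lambda>\<epsilon>.
      rep t \<epsilon> (rep p \<epsilon>) (map (\<lambda>\<omega>. rep \<omega> \<epsilon> (rep p \<epsilon>)) \<omega>s) (map (\<lambda>\<xi>. rep \<xi> \<epsilon> (rep p \<epsilon>)) \<xi>s) -
      rep t \<epsilon> (rep p \<epsilon>) (map (\<lambda>\<omega>. rep \<omega> \<epsilon> (rep p \<epsilon>)) \<omega>s') (map (\<lambda>\<xi>. rep \<xi> \<epsilon> (rep p \<epsilon>)) \<xi>s'))"
  have "negligible_on (\<Union>z\<in>F. {\<epsilon>. rep p \<epsilon> \<in> snd z}) D"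
  proof (rule negligible_on_UN[OF F(1)])
    fix z assume "z \<in> F"
    then have z: "fst z \<in> atlas M" "compact (snd z)" "snd z \<subseteq> fst (fst z)"
      using F(3)[of "fst z" "snd z"] by simp_all
    show "negligible_on {\<epsilon>. rep p \<epsilon> \<in> snd z} D"
      unfolding D_def by (rule tensor_apply_diff_negligible[OF assms(2-13) z])
  qed
  moreover have "\<epsilon> \<in> (\<Union>z\<in>F. {\<epsilon>. rep p \<epsilon> \<in> snd z})" if "\<epsilon> \<in> {0<..1}" "\<epsilon> < \<epsilon>0" for \<epsilon>
    using K(3)[OF that] F(2) by blast
  ultimately have "D \<in> negligible_nums"
    by (simp only: negligible_nums_eq_on[OF K(2), of "\<Union>z\<in>F. {\<epsilon>. rep p \<epsilon> \<in> snd z}"])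
  then show ?thesis
    unfolding tensor_apply_def fun_point_value_class[OF assms(3)]
    by (intro num_class_eqI) (simp add: D_def fun_diff_def)
qed

end
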